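(* Let $p$ be an odd prime and $r\ge3$ with $p\nmid r$. The number of (isomorphism classes of) irreducible rotary augmented PX maps of length $r$ is $|\mathrm{Irr}(\mathrm{D}_{2r})|$ if $r$ is odd, and $|\mathrm{Irr}(\mathrm{D}_{2r})|-1$ if $r$ is even.
   Context: $\mathrm{Irr}(\mathrm{D}_{2r})$ is the set of isomorphism classes of irreducible representations of the dihedral group $\mathrm{D}_{2r}$ over $\mathbb{F}_p$. The augmented Praeger–Xu graph $\mathrm{C}^*(p,r,s,\delta)$ (of length $r$) is: for $s\ge1$, the graph with vertex set $\mathbb{Z}_r\times\mathbb{Z}_p^s$ and edges $\{(i,x_0,\dots,x_{s-1}),(i+1,x_1,\dots,x_s)\}$; for $s=0,\delta=1$, the cycle of length $r$ with $p$ parallel edges between adjacent vertices; for $s=0,\delta=-1$, the cycle $\mathrm{C}_{pr}$. A map is a 2-cell embedding of a connected graph (multiple edges allowed, no loops) in a closed orientable surface; it is rotary if its orientation-preserving automorphism group $G$ is arc-transitive (then arc-regular). An augmented PX map of length $r$ is a map whose underlying graph is an augmented Praeger–Xu graph of length $r$. A rotary augmented PX map is irreducible if its arc-regular group $G$ is isomorphic to $\mathbb{Z}_p^{d}\rtimes_\psi\mathrm{D}_{2r}$ with $\psi$ an irreducible representation over $\mathbb{F}_p$. *)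

theory Defs
  imports "HOL-Algebra.Group" "HOL-Combinatorics.Permutations"
    "Berlekamp_Zassenhaus.Finite_Field" "Jordan_Normal_Form.Matrix"
begin

type_synonym ('v,'e) mgraph = "'v set \<times> 'e set \<times> ('e \<Rightarrow> 'v set)"

definition mgraph_iso :: "('v,'e) mgraph \<Rightarrow> ('w,'f) mgraph \<Rightarrow> bool" where
  "mgraph_iso G H = (case G of (V, E, ends) \<Rightarrow> case H of (V', E', ends') \<Rightarrow>
     (\<exists>\<phi> \<psi>. bij_betw \<phi> V V' \<and> bij_betw \<psi> E E' \<and> (\<forall>e\<in>E. ends' (\<psi> e) = \<phi> ` ends e)))"

text \<open>Elements of Z_p^s are lists of length s with entries in {0..<p}; Z_r is {0..<r}.
  For s \<ge> 0 (and for s = 0, delta = 1) the graph C*(p,r,s,delta) has vertices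
  Z_r \<times> Z_p^s and one edge for every (i, x_0,...,x_s) in Z_r \<times> Z_p^(s+1), joining
  (i,x_0..x_(s-1)) and (i+1,x_1..x_s).  For s = 0 this is the r-cycle with p parallel edges
  between consecutive vertices.  For s = 0, delta = -1 it is the cycle C_(pr).\<close>

definition PX_graph :: "nat \<Rightarrow> nat \<Rightarrow> nat \<Rightarrow> (nat \<times> nat list, nat \<times> nat list) mgraph" where
  "PX_graph p r s =
     ({(i, xs). i < r \<and> length xs = s \<and> (\<forall>x\<in>set xs. x < p)},
      {(i, xs). i < r \<and> length xs = Suc s \<and> (\<forall>x\<in>set xs. x < p)},
      (\<lambda>(i, xs). {(i, butlast xs), ((i + 1) mod r, tl xs)}))"

definition cycle_graph :: "nat \<Rightarrow> (nat \<times> nat list, nat \<times> nat list) mgraph" where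
  "cycle_graph n =
     ({(i, []) | i. i < n}, {(i, []) | i. i < n},
      (\<lambda>(i, xs). {(i, []), ((i + 1) mod n, [])}))"

definition aug_PX_graph :: "nat \<Rightarrow> nat \<Rightarrow> nat \<Rightarrow> int \<Rightarrow> (nat \<times> nat list, nat \<times> nat list) mgraph" where
  "aug_PX_graph p r s \<delta> = (if s = 0 \<and> \<delta> = -1 then cycle_graph (p * r) else PX_graph p r s)"

text \<open>A map (2-cell embedding of a connected multigraph without loops in a closed orientable
  surface) is encoded by its dart (arc) set D, the rotation R (cyclic successor of a dart
  around its initial vertex) and the dart-reversing involution L.\<close>

definition R_orbit :: "('d \<Rightarrow> 'd) \<Rightarrow> 'd \<Rightarrow> 'd set" where
  "R_orbit R x = {(R ^^ k) x | k. True}"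

definition is_map :: "'d set \<Rightarrow> ('d \<Rightarrow> 'd) \<Rightarrow> ('d \<Rightarrow> 'd) \<Rightarrow> bool" where
  "is_map D R L =
     (finite D \<and> D \<noteq> {} \<and> R permutes D \<and> L permutes D \<and>
      (\<forall>x\<in>D. L (L x) = x \<and> L x \<noteq> x) \<and>
      \<comment> \<open>connectedness: the monodromy group \<langle>R, L\<rangle> is transitive on darts\<close>
      (\<forall>x\<in>D. \<forall>y\<in>D. (\<lambda>a b. b = R a \<or> b = L a)\<^sup>*\<^sup>* x y) \<and>
      \<comment> \<open>no loops: the two darts of an edge lie at different vertices\<close>
      (\<forall>x\<in>D. L x \<notin> R_orbit R x))"

definition map_graph :: "'d set \<Rightarrow> ('d \<Rightarrow> 'd) \<Rightarrow> ('d \<Rightarrow> 'd) \<Rightarrow> ('d set, 'd set) mgraph" where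
  "map_graph D R L =
     (let V = R_orbit R ` D in
      (V, {{x, L x} | x. x \<in> D}, (\<lambda>e. {v \<in> V. v \<inter> e \<noteq> {}})))"

definition map_auts :: "'d set \<Rightarrow> ('d \<Rightarrow> 'd) \<Rightarrow> ('d \<Rightarrow> 'd) \<Rightarrow> ('d \<Rightarrow> 'd) set" where
  "map_auts D R L = {f. f permutes D \<and> (\<forall>x\<in>D. f (R x) = R (f x) \<and> f (L x) = L (f x))}"

definition map_aut_group :: "'d set \<Rightarrow> ('d \<Rightarrow> 'd) \<Rightarrow> ('d \<Rightarrow> 'd) \<Rightarrow> ('d \<Rightarrow> 'd) monoid" where
  "map_aut_group D R L = \<lparr>carrier = map_auts D R L, monoid.mult = (\<circ>), one = id\<rparr>"

definition rotary :: "'d set \<Rightarrow> ('d \<Rightarrow> 'd) \<Rightarrow> ('d \<Rightarrow> 'd) \<Rightarrow> bool" where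
  "rotary D R L = (\<forall>x\<in>D. \<forall>y\<in>D. \<exists>f\<in>map_auts D R L. f x = y)"

definition map_iso :: "'d set \<Rightarrow> ('d \<Rightarrow> 'd) \<Rightarrow> ('d \<Rightarrow> 'd) \<Rightarrow> 'e set \<Rightarrow> ('e \<Rightarrow> 'e) \<Rightarrow> ('e \<Rightarrow> 'e) \<Rightarrow> bool" where
  "map_iso D R L D' R' L' =
     (\<exists>f. bij_betw f D D' \<and> (\<forall>x\<in>D. f (R x) = R' (f x) \<and> f (L x) = L' (f x)))"

definition aug_PX_map :: "nat \<Rightarrow> nat \<Rightarrow> 'd set \<Rightarrow> ('d \<Rightarrow> 'd) \<Rightarrow> ('d \<Rightarrow> 'd) \<Rightarrow> bool" where
  "aug_PX_map p r D R L =
     (is_map D R L \<and>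
      (\<exists>s \<delta>. (\<delta> = 1 \<or> \<delta> = -1) \<and> mgraph_iso (map_graph D R L) (aug_PX_graph p r s \<delta>)))"

text \<open>Element (k, e) stands for rho^k tau^e, where rho^r = tau^2 = 1, tau rho tau = rho^(-1).\<close>
definition dihedral :: "nat \<Rightarrow> (nat \<times> bool) monoid" where
  "dihedral r = \<lparr>carrier = {0..<r} \<times> UNIV,
     monoid.mult = (\<lambda>(k1, e1) (k2, e2). ((if e1 then k1 + r - k2 else k1 + k2) mod r, e1 \<noteq> e2)),
     one = (0, False)\<rparr>"

definition is_rep :: "nat \<Rightarrow> nat \<Rightarrow> (nat \<times> bool \<Rightarrow> 'a::field mat) \<Rightarrow> bool" where
  "is_rep r d \<psi> =
     ((\<forall>g\<in>carrier (dihedral r). \<psi> g \<in> carrier_mat d d) \<and>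
      \<psi> \<one>\<^bsub>dihedral r\<^esub> = 1\<^sub>m d \<and>
      (\<forall>g\<in>carrier (dihedral r). \<forall>h\<in>carrier (dihedral r).
          \<psi> (g \<otimes>\<^bsub>dihedral r\<^esub> h) = \<psi> g * \<psi> h))"

definition irreducible_rep :: "nat \<Rightarrow> nat \<Rightarrow> (nat \<times> bool \<Rightarrow> 'a::field mat) \<Rightarrow> bool" where
  "irreducible_rep r d \<psi> =
     (is_rep r d \<psi> \<and> d > 0 \<and>
      (\<forall>W \<subseteq> carrier_vec d.
         (0\<^sub>v d \<in> W \<and> (\<forall>v\<in>W. \<forall>w\<in>W. v + w \<in> W) \<and> (\<forall>c. \<forall>v\<in>W. c \<cdot>\<^sub>v v \<in> W) \<and>
          (\<forall>g\<in>carrier (dihedral r). \<forall>v\<in>W. \<psi> g *\<^sub>v v \<in> W))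
         \<longrightarrow> W = {0\<^sub>v d} \<or> W = carrier_vec d))"

definition rep_equiv :: "nat \<Rightarrow> ((nat \<times> (nat \<times> bool \<Rightarrow> 'a::field mat)) \<times> (nat \<times> (nat \<times> bool \<Rightarrow> 'a mat))) set" where
  "rep_equiv r = {((d, \<psi>), (d', \<psi>')). d = d' \<and>
     (\<exists>P \<in> carrier_mat d d. invertible_mat P \<and>
        (\<forall>g\<in>carrier (dihedral r). P * \<psi> g = \<psi>' g * P))}"

definition Irr_D :: "'p::prime_card itself \<Rightarrow> nat \<Rightarrow> (nat \<times> (nat \<times> bool \<Rightarrow> 'p mod_ring mat)) set set" where
  "Irr_D _ r = {(d, \<psi>). irreducible_rep r d \<psi>} // rep_equiv r"

definition semidirect :: "nat \<Rightarrow> nat \<Rightarrow> (nat \<times> bool \<Rightarrow> 'a::field mat) \<Rightarrow> ('a vec \<times> (nat \<times> bool)) monoid" where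
  "semidirect r d \<psi> = \<lparr>carrier = carrier_vec d \<times> carrier (dihedral r),
     monoid.mult = (\<lambda>(v, g) (w, h). (v + \<psi> g *\<^sub>v w, g \<otimes>\<^bsub>dihedral r\<^esub> h)),
     one = (0\<^sub>v d, \<one>\<^bsub>dihedral r\<^esub>)\<rparr>"

definition irreducible_rotary_aug_PX_map ::
  "'p::prime_card itself \<Rightarrow> nat \<Rightarrow> 'd set \<Rightarrow> ('d \<Rightarrow> 'd) \<Rightarrow> ('d \<Rightarrow> 'd) \<Rightarrow> bool" where
  "irreducible_rotary_aug_PX_map _ r D R L =
     (aug_PX_map CARD('p) r D R L \<and> rotary D R L \<and>
      (\<exists>d (\<psi> :: nat \<times> bool \<Rightarrow> 'p mod_ring mat). irreducible_rep r d \<psi> \<and>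
          map_aut_group D R L \<cong> semidirect r d \<psi>))"

text \<open>Isomorphism classes: every finite map is isomorphic to one with dart set {0..<n}.\<close>
definition irr_rotary_aug_PX_map_classes :: "'p::prime_card itself \<Rightarrow> nat \<Rightarrow> (nat \<times> (nat \<Rightarrow> nat) \<times> (nat \<Rightarrow> nat)) set set" where
  "irr_rotary_aug_PX_map_classes P r =
     {(n, R, L). irreducible_rotary_aug_PX_map P r {0..<n} R L} //
     {((n, R, L), (n', R', L')). map_iso {0..<n} R L {0..<n'} R' L'}"

end

theory Submission
  imports Defs "HOL-Algebra.Multiplicative_Group"
begin

text \<open>
  Fix the reflections \<open>\<tau>'' = (1, True)\<close> and \<open>\<tau>' = (0, True)\<close> of the dihedral group, with product
  the rotation \<open>\<rho> = (1, False)\<close>. A rotary map is its arc-regular group with a generating pair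
  \<open>(a, z)\<close>, where \<open>a\<close> rotates at a vertex and \<open>z\<close> reverses an arc. If the group is
  \<open>V \<rtimes> D\<close> and the graph is an augmented Praeger--Xu graph, counting vertices and edges gives
  \<open>|a| \<in> {2, 2p}\<close>, which forces both images in \<open>D\<close> to be reflections; after twisting the
  representation by an automorphism of \<open>D\<close> they are \<open>\<tau>''\<close> and \<open>\<tau>'\<close>. Conjugating by \<open>V\<close>
  (\<open>p\<close> is odd and \<open>1 - \<rho>\<close> is injective unless \<open>\<rho>\<close> acts trivially) normalises the pair to
  \<open>a = (u, \<tau>'')\<close>, \<open>z = (0, \<tau>')\<close> with \<open>u \<noteq> 0\<close> and either \<open>\<tau>'' u = u\<close>, or
  \<open>\<tau>'' u = -u\<close> and \<open>\<rho> = 1\<close> on \<open>V\<close>. Such \<open>u\<close> are permuted transitively by the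
  automorphisms of \<open>V\<close>, since \<open>u\<close> is cyclic for \<open>\<rho>\<close> and symmetric polynomials in \<open>\<rho>\<close>
  commute with \<open>D\<close>; so every representation gives at most one map. It gives none exactly
  when \<open>\<rho> = \<tau>'' = -1\<close>, which happens for one representation if \<open>r\<close> is even and for none if
  \<open>r\<close> is odd.

  Conversely, if \<open>\<tau>'' u = u\<close>, any \<open>d\<close> consecutive vectors \<open>\<rho>\<^sup>i u\<close> form a basis of \<open>V\<close>. The
  linear form \<open>f\<close> that vanishes on \<open>d - 1\<close> consecutive ones yields coordinates
  \<open>f (\<rho>\<^sup>-\<^sup>i w), f (\<rho>\<^sup>-\<^sup>(\<^sup>i\<^sup>+\<^sup>1\<^sup>) w), \<dots>\<close> of an arc \<open>w\<close>, in which passing to the next vertex is the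
  shift of the Praeger--Xu graph. In the remaining case the group is dihedral of order \<open>2pr\<close>
  and the graph is a cycle.
\<close>

text \<open>The group \<open>V \<rtimes> D\<close> does not determine the representation: twisting
  by an automorphism of D gives an isomorphic group. What pins it down is the marked pair. Once the
  two generators project to fixed reflections, an isomorphism of maps is a group isomorphism
  inducing the identity on D, hence an equivalence of representations; so the count runs over Irr(D)
  and not over its orbits under Aut(D). V is a space over the prime field, so its subgroups are
  subspaces and its additive maps are matrices. Irreducibility can therefore be applied directly to
  subgroups and to group isomorphisms. In the direction from maps to representations the graph
  enters only through the ratio of edges to vertices, which is half the order of a; coprimality of p
  and r then removes the factor p in D. The exceptional representation fails because there 1 - rho =
  2 is invertible: conjugation moves the vector part of a to a fixed vector of tau'' = -1, that is
  to 0, and the pair generates only a complement of V.\<close>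

section \<open>Words in two generators\<close>

text \<open>Words are extended on the right and without inverses, so that a step is exactly a move
  \<open>R\<close> or \<open>L\<close> on darts under \<open>labels\<close>, and inductions run in
  parallel with the reachability in \<open>is_map\<close>. In a finite group the result is the
  generated subgroup.\<close>

inductive_set generated_by :: "('g, 'm) monoid_scheme \<Rightarrow> 'g \<Rightarrow> 'g \<Rightarrow> 'g set"
  for G (structure) and a z where
  one: "\<one> \<in> generated_by G a z"
| left: "x \<in> generated_by G a z \<Longrightarrow> x \<otimes> a \<in> generated_by G a z"
| right: "x \<in> generated_by G a z \<Longrightarrow> x \<otimes> z \<in> generated_by G a z"

lemma (in monoid) generated_by_subset:
  assumes "a \<in> carrier G" "z \<in> carrier G"
  shows "generated_by G a z \<subseteq> carrier G"
proof
  fix x assume "x \<in> generated_by G a z"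
  then show "x \<in> carrier G" by induction (use assms in auto)
qed

lemma (in monoid) generated_by_mult:
  assumes "a \<in> carrier G" "z \<in> carrier G" "x \<in> generated_by G a z" "y \<in> generated_by G a z"
  shows "x \<otimes> y \<in> generated_by G a z"
  using assms(4)
proof induction
  case one
  then show ?case using generated_by_subset[OF assms(1,2)] assms(3) by (simp add: subset_iff)
next
  case (left y)
  then show ?case
    using generated_by_subset[OF assms(1,2)] assms generated_by.left[OF left.IH]
    by (metis m_assoc subsetD)
next
  case (right y)
  then show ?case
    using generated_by_subset[OF assms(1,2)] assms generated_by.right[OF right.IH]
    by (metis m_assoc subsetD)
qed

lemma (in monoid) generated_by_gens:
  assumes "a \<in> carrier G" "z \<in> carrier G"
  shows "a \<in> generated_by G a z" "z \<in> generated_by G a z"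
  using generated_by.left[OF generated_by.one[of G a z]] generated_by.right[OF generated_by.one[of G a z]]
    assms by auto

lemma (in monoid) generated_by_pow:
  assumes "a \<in> carrier G" "z \<in> carrier G" "x \<in> generated_by G a z"
  shows "x [^] (n::nat) \<in> generated_by G a z"
  by (induction n) (use assms in \<open>auto intro: generated_by.one generated_by_mult\<close>)

text \<open>Serves to exclude generating pairs of D whose members commute, since D has order 2r >
  4.\<close>

lemma (in group) commuting_involutions_generate_at_most_4:
  assumes "a \<in> carrier G" "z \<in> carrier G" "a \<otimes> a = \<one>" "z \<otimes> z = \<one>" "a \<otimes> z = z \<otimes> a"
    and gen: "carrier G \<subseteq> generated_by G a z"
  shows "card (carrier G) \<le> 4"
proof -
  let ?S = "{\<one>, a, z, a \<otimes> z}"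
  have eqs: "a \<otimes> z \<otimes> a = z" "a \<otimes> z \<otimes> z = a" "z \<otimes> a = a \<otimes> z"
    using assms by (metis m_assoc l_one r_one)+
  have "x \<in> ?S" if "x \<in> generated_by G a z" for x
    using that by induction (use assms(1-4) eqs in \<open>auto\<close>)
  then have "carrier G \<subseteq> ?S" using gen by blast
  then have "card (carrier G) \<le> card ?S" by (rule card_mono[rotated]) simp
  also have "\<dots> \<le> 4" by (simp add: card_insert_if)
  finally show ?thesis .
qed

section \<open>The dihedral group\<close>

lemma dihedral_carrier_iff [simp]: "(k, e) \<in> carrier (dihedral r) \<longleftrightarrow> k < r"
  by (auto simp: dihedral_def)

lemma dihedral_one [simp]: "\<one>\<^bsub>dihedral r\<^esub> = (0, False)"
  by (simp add: dihedral_def)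

lemma dihedral_mult [simp]:
  "(k1, e1) \<otimes>\<^bsub>dihedral r\<^esub> (k2, e2) = ((if e1 then k1 + r - k2 else k1 + k2) mod r, e1 \<noteq> e2)"
  by (simp add: dihedral_def)

lemma finite_dihedral: "finite (carrier (dihedral r))"
  and card_dihedral: "card (carrier (dihedral r)) = 2 * r"
  by (simp_all add: dihedral_def)

text \<open>Over the integers the padded subtraction \<open>k1 + r - k2\<close> becomes a true
  difference, which turns associativity into a congruence.\<close>

lemma int_fst_dihedral_mult:
  assumes "k2 < r"
  shows "int (fst ((k1, e1) \<otimes>\<^bsub>dihedral r\<^esub> (k2, e2))) = (int k1 + (if e1 then - int k2 else int k2)) mod int r"
proof (cases e1)
  case True
  have "int ((k1 + r - k2) mod r) = (int k1 - int k2 + int r) mod int r"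
    using assms by (simp add: zmod_int of_nat_diff algebra_simps)
  then show ?thesis using True by simp
qed (simp add: zmod_int)

lemma group_dihedral:
  assumes "r > 0"
  shows "group (dihedral r)"
proof (rule groupI)
  fix x y assume "x \<in> carrier (dihedral r)" "y \<in> carrier (dihedral r)"
  then show "x \<otimes>\<^bsub>dihedral r\<^esub> y \<in> carrier (dihedral r)"
    using assms by (cases x; cases y) auto
next
  show "\<one>\<^bsub>dihedral r\<^esub> \<in> carrier (dihedral r)" using assms by auto
next
  fix x y z assume c: "x \<in> carrier (dihedral r)" "y \<in> carrier (dihedral r)" "z \<in> carrier (dihedral r)"
  obtain k1 e1 k2 e2 k3 e3 where [simp]: "x = (k1, e1)" "y = (k2, e2)" "z = (k3, e3)"
    by (cases x; cases y; cases z) blast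
  have lt: "k1 < r" "k2 < r" "k3 < r" using c by auto
  have "int (fst (x \<otimes>\<^bsub>dihedral r\<^esub> y \<otimes>\<^bsub>dihedral r\<^esub> z)) = int (fst (x \<otimes>\<^bsub>dihedral r\<^esub> (y \<otimes>\<^bsub>dihedral r\<^esub> z)))"
  proof -
    obtain m where m: "x \<otimes>\<^bsub>dihedral r\<^esub> y = (m, e1 \<noteq> e2)" by simp
    obtain n where n: "y \<otimes>\<^bsub>dihedral r\<^esub> z = (n, e2 \<noteq> e3)" by simp
    have "n < r" using n assms by auto
    note eq = int_fst_dihedral_mult[OF lt(2), of k1 e1 e2] int_fst_dihedral_mult[OF lt(3), of k2 e2 e3]
      int_fst_dihedral_mult[OF lt(3), of m "e1 \<noteq> e2" e3] int_fst_dihedral_mult[OF \<open>n < r\<close>, of k1 e1 "e2 \<noteq> e3"]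
    have mn: "int m = (int k1 + (if e1 then - int k2 else int k2)) mod int r"
      "int n = (int k2 + (if e2 then - int k3 else int k3)) mod int r"
      using eq(1,2) m n by auto
    have "int (fst (x \<otimes>\<^bsub>dihedral r\<^esub> y \<otimes>\<^bsub>dihedral r\<^esub> z)) = (int m + (if e1 \<noteq> e2 then - int k3 else int k3)) mod int r"
      unfolding m using eq(3) by simp
    also have "\<dots> = (int k1 + (if e1 then - int n else int n)) mod int r"
      unfolding mn by (cases e1; cases e2; simp add: mod_simps; simp add: algebra_simps)
    finally show ?thesis unfolding n using eq(4) by simp
  qed
  then have 1: "fst (x \<otimes>\<^bsub>dihedral r\<^esub> y \<otimes>\<^bsub>dihedral r\<^esub> z) = fst (x \<otimes>\<^bsub>dihedral r\<^esub> (y \<otimes>\<^bsub>dihedral r\<^esub> z))"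
    by (rule of_nat_eq_iff[THEN iffD1])
  have 2: "snd (x \<otimes>\<^bsub>dihedral r\<^esub> y \<otimes>\<^bsub>dihedral r\<^esub> z) = snd (x \<otimes>\<^bsub>dihedral r\<^esub> (y \<otimes>\<^bsub>dihedral r\<^esub> z))"
    by simp blast
  show "x \<otimes>\<^bsub>dihedral r\<^esub> y \<otimes>\<^bsub>dihedral r\<^esub> z = x \<otimes>\<^bsub>dihedral r\<^esub> (y \<otimes>\<^bsub>dihedral r\<^esub> z)"
    using 1 2 by (rule prod_eqI)
next
  fix x assume "x \<in> carrier (dihedral r)"
  then show "\<one>\<^bsub>dihedral r\<^esub> \<otimes>\<^bsub>dihedral r\<^esub> x = x"
    using assms by (cases x) auto
next
  fix x assume "x \<in> carrier (dihedral r)"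
  moreover obtain k e where x: "x = (k, e)" by (cases x)
  ultimately have k: "k < r" by simp
  show "\<exists>y\<in>carrier (dihedral r). y \<otimes>\<^bsub>dihedral r\<^esub> x = \<one>\<^bsub>dihedral r\<^esub>"
  proof (cases "e \<or> k = 0")
    case True
    then show ?thesis using k x by (intro bexI[of _ "(k, e)"]) auto
  next
    case False
    then show ?thesis using k x by (intro bexI[of _ "(r - k, False)"]) auto
  qed
qed

lemma dihedral_generated:
  assumes "r > 1"
  shows "carrier (dihedral r) \<subseteq> generated_by (dihedral r) (Suc 0, True) (0, True)"
proof -
  let ?S = "generated_by (dihedral r) (Suc 0, True) (0, True)"
  have rot: "(k, False) \<in> ?S" if "k < r" for k
    using that
  proof (induction k)
    case 0
    show ?case using generated_by.one[of "dihedral r"] by simp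
  next
    case (Suc k)
    then have "(k, False) \<otimes>\<^bsub>dihedral r\<^esub> (Suc 0, True) \<otimes>\<^bsub>dihedral r\<^esub> (0, True) \<in> ?S"
      by (intro generated_by.intros) auto
    then show ?case using Suc.prems by (simp flip: add_Suc)
  qed
  have "(k, True) \<in> ?S" if "k < r" for k
    using generated_by.right[OF rot[OF that]] that by simp
  with rot have "(k, e) \<in> ?S" if "k < r" for k e using that by (cases e) auto
  then show ?thesis by auto
qed

lemma dihedral_rotation_pow:
  assumes "r > 0" "k < r"
  shows "(k, False) [^]\<^bsub>dihedral r\<^esub> (n::nat) = (n * k mod r, False)"
proof -
  interpret group "dihedral r" using assms by (intro group_dihedral)
  show ?thesis by (induction n) (auto simp: mod_simps algebra_simps)
qed

text \<open>The universal property of the presentation of D. Exponents may be reduced because x^r =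
  1, and y x^l = x^(-l) y carries reflections past rotations.\<close>

lemma (in group) dihedral_hom:
  assumes x: "x \<in> carrier G" "x [^] r = \<one>" and y: "y \<in> carrier G" "y \<otimes> y = \<one>"
    and conj: "y \<otimes> x \<otimes> y = inv x"
  shows "(\<lambda>(k, e). x [^] (k::nat) \<otimes> (if e then y else \<one>)) \<in> hom (dihedral r) G"
proof (rule homI)
  fix g assume "g \<in> carrier (dihedral r)"
  then show "(case g of (k, e) \<Rightarrow> x [^] k \<otimes> (if e then y else \<one>)) \<in> carrier G"
    using x y by (auto split: prod.splits)
next
  fix g h assume gh: "g \<in> carrier (dihedral r)" "h \<in> carrier (dihedral r)"
  obtain k e l f where [simp]: "g = (k, e)" "h = (l, f)" by (cases g; cases h)
  have pow_mod: "x [^] (n mod r) = x [^] n" for n :: nat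
  proof -
    have "x [^] n = x [^] (r * (n div r) + n mod r)" by simp
    also have "\<dots> = (x [^] r) [^] (n div r) \<otimes> x [^] (n mod r)"
      using x(1) by (simp only: nat_pow_mult[symmetric] nat_pow_pow nat_pow_closed)
    finally show ?thesis using x by simp
  qed
  have yx: "y \<otimes> x [^] n = inv (x [^] n) \<otimes> y" for n :: nat
  proof (induction n)
    case (Suc n)
    have "y \<otimes> x [^] Suc n = (y \<otimes> x [^] n) \<otimes> x" using x y by (simp add: m_assoc)
    also have "\<dots> = inv (x [^] n) \<otimes> (y \<otimes> x \<otimes> y) \<otimes> y" using x y by (simp add: Suc m_assoc)
    also have "\<dots> = inv (x \<otimes> x [^] n) \<otimes> y" using x y by (simp add: conj inv_mult_group)
    finally show ?case using x by (simp add: nat_pow_comm[of x 1 n, simplified])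
  qed (use x y in auto)
  have sub: "x [^] (k + r - l) = x [^] k \<otimes> inv (x [^] l)"
  proof -
    have "x [^] (k + r - l) \<otimes> x [^] l = x [^] (k + r)" using gh x by (simp add: nat_pow_mult)
    also have "\<dots> = x [^] k" using x by (simp add: nat_pow_mult[symmetric])
    finally show ?thesis
      using x by (metis inv_solve_right nat_pow_closed)
  qed
  have main: "x [^] k \<otimes> y \<otimes> (x [^] l \<otimes> w) = x [^] k \<otimes> inv (x [^] l) \<otimes> (y \<otimes> w)" if "w \<in> carrier G" for w
  proof -
    have main: "x [^] k \<otimes> y \<otimes> (x [^] l \<otimes> w) = x [^] k \<otimes> (y \<otimes> x [^] l) \<otimes> w"
      using x y that by (simp add: m_assoc)
    then show ?thesis unfolding yx using x y that by (simp add: m_assoc)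
  qed
  show "(case g \<otimes>\<^bsub>dihedral r\<^esub> h of (k, e) \<Rightarrow> x [^] k \<otimes> (if e then y else \<one>)) =
    (case g of (k, e) \<Rightarrow> x [^] k \<otimes> (if e then y else \<one>)) \<otimes>
    (case h of (k, e) \<Rightarrow> x [^] k \<otimes> (if e then y else \<one>))"
    using x y main[of y] main[of \<one>] by (cases e; cases f)
      (simp_all add: pow_mod sub nat_pow_mult[symmetric] m_assoc)
qed

text \<open>Generation makes the homomorphism from the presentation surjective and equal cardinality
  makes it injective, so the exact order of az never has to be computed. Used both for automorphisms
  of D and for the group of order 2pr behind the cycle.\<close>

lemma (in group) dihedral_iso:
  assumes a: "a \<in> carrier G" "a \<otimes> a = \<one>" and z: "z \<in> carrier G" "z \<otimes> z = \<one>"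
    and pow: "(a \<otimes> z) [^] n = \<one>" and gen: "carrier G \<subseteq> generated_by G a z"
    and card: "card (carrier G) = 2 * n" and n: "n > 1"
  obtains \<alpha> where "\<alpha> \<in> iso (dihedral n) G" "\<alpha> (Suc 0, True) = a" "\<alpha> (0, True) = z"
proof -
  interpret D: group "dihedral n" using n by (intro group_dihedral) simp
  define x where "x = a \<otimes> z"
  have xc: "x \<in> carrier G" using a z by (simp add: x_def)
  have xz: "x \<otimes> z = a" using a z by (simp add: x_def m_assoc)
  have conj: "z \<otimes> x \<otimes> z = inv x"
  proof (rule inv_equality[symmetric])
    show "z \<otimes> x \<otimes> z \<otimes> x = \<one>"
      using a z xc by (simp add: m_assoc xz) (metis m_assoc m_closed r_one x_def)
  qed (use xc z in auto)
  define \<alpha> where "\<alpha> = (\<lambda>(k, e). x [^] (k::nat) \<otimes> (if e then z else \<one>))"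
  have hom: "\<alpha> \<in> hom (dihedral n) G"
    unfolding \<alpha>_def by (rule dihedral_hom) (use xc pow z conj in \<open>auto simp: x_def\<close>)
  have \<alpha>a: "\<alpha> (Suc 0, True) = a" and \<alpha>z: "\<alpha> (0, True) = z"
    using xc z xz by (simp_all add: \<alpha>_def)
  have "g \<in> \<alpha> ` carrier (dihedral n)" if "g \<in> generated_by G a z" for g
    using that
  proof induction
    case one
    have "\<alpha> (0, False) = \<one>" by (simp add: \<alpha>_def)
    moreover have "(0, False) \<in> carrier (dihedral n)" using n by simp
    ultimately show ?case by (metis imageI)
  next
    case (left g)
    then obtain h where h: "h \<in> carrier (dihedral n)" "g = \<alpha> h" by blast
    have c: "(Suc 0, True) \<in> carrier (dihedral n)" using n by simp
    have "g \<otimes> a = \<alpha> (h \<otimes>\<^bsub>dihedral n\<^esub> (Suc 0, True))" using hom_mult[OF hom h(1) c] h \<alpha>a by simp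
    then show ?case using D.m_closed[OF h(1) c] by blast
  next
    case (right g)
    then obtain h where h: "h \<in> carrier (dihedral n)" "g = \<alpha> h" by blast
    have c: "(0, True) \<in> carrier (dihedral n)" using n by simp
    have "g \<otimes> z = \<alpha> (h \<otimes>\<^bsub>dihedral n\<^esub> (0, True))" using hom_mult[OF hom h(1) c] h \<alpha>z by simp
    then show ?case using D.m_closed[OF h(1) c] by blast
  qed
  then have surj: "\<alpha> ` carrier (dihedral n) = carrier G"
    using gen hom by (auto simp: hom_def)
  then have "bij_betw \<alpha> (carrier (dihedral n)) (carrier G)"
    by (simp add: bij_betw_def eq_card_imp_inj_on finite_dihedral card card_dihedral)
  then show ?thesis using that hom \<alpha>a \<alpha>z by (simp add: iso_def)
qed

text \<open>The exponent 2p covers both possible orders of the vertex rotation. Two rotations cannot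
  generate D; if exactly one member is a rotation, it is central of order at most 2, so the pair
  would consist of commuting involutions. Two reflections are carried to the standard ones by the
  presentation.\<close>

lemma dihedral_generating_pair:
  assumes r: "r \<ge> 3" and p: "coprime p r"
    and a: "a \<in> carrier (dihedral r)" "a [^]\<^bsub>dihedral r\<^esub> (2 * p) = \<one>\<^bsub>dihedral r\<^esub>"
    and z: "z \<in> carrier (dihedral r)" "z \<otimes>\<^bsub>dihedral r\<^esub> z = \<one>\<^bsub>dihedral r\<^esub>"
    and gen: "carrier (dihedral r) \<subseteq> generated_by (dihedral r) a z"
  obtains \<alpha> where "\<alpha> \<in> iso (dihedral r) (dihedral r)" "\<alpha> (Suc 0, True) = a" "\<alpha> (0, True) = z"
proof -
  interpret D: group "dihedral r" using r by (intro group_dihedral) simp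
  obtain i e j f where az: "a = (i, e)" "z = (j, f)" by (cases a; cases z)
  have lt: "i < r" "j < r" using a z az by auto
  have noncomm: False if "a \<otimes>\<^bsub>dihedral r\<^esub> a = \<one>\<^bsub>dihedral r\<^esub>" "a \<otimes>\<^bsub>dihedral r\<^esub> z = z \<otimes>\<^bsub>dihedral r\<^esub> a"
    using D.commuting_involutions_generate_at_most_4[OF a(1) z(1) that(1) z(2) that(2) gen] r
    by (simp add: card_dihedral)
  \<comment> \<open>If 2k = 0 mod r then k and -k agree, so rotation by k commutes with every
    reflection.\<close>
  have comm: "(k + l) mod r = (l + r - k) mod r" if "k < r" "2 * k mod r = 0" for k l
  proof -
    have "r dvd 2 * k" using that by auto
    then obtain q where "2 * k = r * q" by (elim dvdE)
    then have "k + l + r = l + r - k + r * q" using that by linarith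
    then show ?thesis by (metis mod_add_self2 mod_mult_self2)
  qed
  have refl: e f
  proof -
    have "\<not> (\<not> e \<and> \<not> f)"
    proof
      assume *: "\<not> e \<and> \<not> f"
      have "\<not> snd x" if "x \<in> generated_by (dihedral r) a z" for x
        using that by induction (use * az in \<open>auto simp: split: prod.splits; metis dihedral_mult prod.collapse snd_conv\<close>)+
      moreover have "(0, True) \<in> carrier (dihedral r)" using r by simp
      ultimately have "\<not> snd (0::nat, True)" using gen by blast
      then show False by simp
    qed
    moreover have "\<not> (\<not> e \<and> f)"
    proof
      assume *: "\<not> e \<and> f"
      \<comment> \<open>For a rotation, a^(2p) = 1 says that r divides 2pi; p is coprime to r and
        cancels.\<close>
      have "2 * p * i mod r = 0" using a(2) az * lt by (simp add: dihedral_rotation_pow)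
      then have "r dvd p * (2 * i)" by (simp add: mult.assoc mult.left_commute mod_eq_0_iff_dvd)
      then have i2: "2 * i mod r = 0"
        using p coprime_dvd_mult_right_iff[of r p "2 * i"] by (simp add: coprime_commute mod_eq_0_iff_dvd)
      show False by (rule noncomm) (use az * i2 comm[OF lt(1) i2, of j] in \<open>auto simp flip: mult_2\<close>)
    qed
    moreover have "\<not> (e \<and> \<not> f)"
    proof
      assume *: "e \<and> \<not> f"
      have j2: "2 * j mod r = 0" using z(2) az * by (simp add: mult_2)
      show False by (rule noncomm) (use az * comm[OF lt(2) j2, of i] in \<open>auto simp: add.commute\<close>)
    qed
    ultimately show e f by blast+
  qed
  have aa: "a \<otimes>\<^bsub>dihedral r\<^esub> a = \<one>\<^bsub>dihedral r\<^esub>" using az refl by simp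
  have "(a \<otimes>\<^bsub>dihedral r\<^esub> z) [^]\<^bsub>dihedral r\<^esub> r = \<one>\<^bsub>dihedral r\<^esub>"
    using r refl by (simp add: az dihedral_rotation_pow)
  then show ?thesis
    using D.dihedral_iso[OF a(1) aa z _ gen card_dihedral] that r by auto
qed

section \<open>Irreducible representations of the dihedral group\<close>

text \<open>Every scalar of the prime field is a natural multiple of 1. Hence the translations
  inside a subgroup of the semidirect product automatically form a linear subspace.\<close>

lemma add_closed_imp_smult_closed:
  fixes W :: "'p::prime_card mod_ring vec set"
  assumes "W \<subseteq> carrier_vec d" "0\<^sub>v d \<in> W" "\<And>v w. v \<in> W \<Longrightarrow> w \<in> W \<Longrightarrow> v + w \<in> W" "v \<in> W"
  shows "c \<cdot>\<^sub>v v \<in> W"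
proof -
  have v: "v \<in> carrier_vec d" using assms by auto
  have "of_nat n \<cdot>\<^sub>v v \<in> W" for n
  proof (induction n)
    case 0
    have "of_nat 0 \<cdot>\<^sub>v v = 0\<^sub>v d" using v by (intro eq_vecI) auto
    then show ?case using assms by simp
  next
    case (Suc n)
    have "of_nat (Suc n) \<cdot>\<^sub>v v = of_nat n \<cdot>\<^sub>v v + v"
      using v by (intro eq_vecI) (auto simp: algebra_simps)
    then show ?case using Suc assms by simp
  qed
  moreover obtain n where "c = of_nat n" using surj_of_nat_mod_ring[of c] by auto
  ultimately show ?thesis by simp
qed

lemma add_closed_imp_diff_closed:
  fixes W :: "'p::prime_card mod_ring vec set"
  assumes "W \<subseteq> carrier_vec d" "0\<^sub>v d \<in> W" "\<And>v w. v \<in> W \<Longrightarrow> w \<in> W \<Longrightarrow> v + w \<in> W" "v \<in> W" "w \<in> W"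
  shows "v - w \<in> W"
proof -
  have "(-1) \<cdot>\<^sub>v w \<in> W" by (rule add_closed_imp_smult_closed[OF assms(1,2,3,5)])
  moreover have "v - w = v + (-1) \<cdot>\<^sub>v w" using assms by (intro eq_vecI) auto
  ultimately show ?thesis using assms by simp
qed

lemma semidirect_carrier [simp]: "carrier (semidirect r d \<psi>) = carrier_vec d \<times> carrier (dihedral r)"
  and semidirect_one [simp]: "\<one>\<^bsub>semidirect r d \<psi>\<^esub> = (0\<^sub>v d, (0, False))"
  and semidirect_mult [simp]: "(v, g) \<otimes>\<^bsub>semidirect r d \<psi>\<^esub> (w, h) = (v + \<psi> g *\<^sub>v w, g \<otimes>\<^bsub>dihedral r\<^esub> h)"
  by (simp_all add: semidirect_def)

locale dihedral_irrep =
  fixes r d :: nat and \<psi> :: "nat \<times> bool \<Rightarrow> 'p::prime_card mod_ring mat"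
  assumes r3: "r \<ge> 3" and p_odd: "odd CARD('p)" and p_ndvd: "\<not> CARD('p) dvd r"
    and irr: "irreducible_rep r d \<psi>"
begin

abbreviation V :: "'p mod_ring vec set" where "V \<equiv> carrier_vec d"
abbreviation G :: "('p mod_ring vec \<times> (nat \<times> bool)) monoid" where "G \<equiv> semidirect r d \<psi>"
abbreviation A :: "'p mod_ring vec \<Rightarrow> 'p mod_ring vec" where "A v \<equiv> \<psi> (Suc 0, True) *\<^sub>v v"
abbreviation Z :: "'p mod_ring vec \<Rightarrow> 'p mod_ring vec" where "Z v \<equiv> \<psi> (0, True) *\<^sub>v v"
text \<open>Powers of rho with integer exponents, so that inverse powers and index shifts need no
  truncated subtraction.\<close>

definition rot :: "int \<Rightarrow> 'p mod_ring vec \<Rightarrow> 'p mod_ring vec"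
  where "rot i v = \<psi> (nat (i mod int r), False) *\<^sub>v v"

lemma r_gt [simp]: "0 < r" "Suc 0 < r" "r \<noteq> 0" "Suc r mod r = Suc 0"
  using r3 by (auto simp: mod_Suc)

lemma two_neq_0: "(2 :: 'p mod_ring) \<noteq> 0"
proof
  assume "(2 :: 'p mod_ring) = 0"
  then have "of_nat 2 = (0 :: 'p mod_ring)" by simp
  then have "CARD('p) dvd 2" by (rule of_nat_0_mod_ring_dvd)
  then show False using p_odd prime_card[where 'a='p] by (metis dvd_antisym prime_ge_2_nat
      dvd_imp_le even_numeral le_antisym zero_less_numeral)
qed

lemma add_self_eq_0_iff: "(x :: 'p mod_ring) + x = 0 \<longleftrightarrow> x = 0"
  using two_neq_0 by (simp flip: mult_2)

lemma eq_uminus_self_iff: "(x :: 'p mod_ring) = - x \<longleftrightarrow> x = 0" "(- x :: 'p mod_ring) = x \<longleftrightarrow> x = 0"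
  using add_self_eq_0_iff[of x] by (auto simp: eq_neg_iff_add_eq_0)

lemma vec_add_self_eq_0D:
  assumes "v \<in> V" "v + v = 0\<^sub>v d"
  shows "v = 0\<^sub>v d"
proof (rule eq_vecI)
  fix i assume i: "i < dim_vec (0\<^sub>v d :: 'p mod_ring vec)"
  then have "(v + v) $ i = 0" by (simp add: assms(2))
  then show "v $ i = 0\<^sub>v d $ i" using i assms(1) by (simp add: two_neq_0 flip: mult_2)
qed (use assms in auto)

sublocale D: group "dihedral r" by (rule group_dihedral) simp

lemma rep_carrier [simp]: "g \<in> carrier (dihedral r) \<Longrightarrow> \<psi> g \<in> carrier_mat d d"
  and rep_one [simp]: "\<psi> (0, False) = 1\<^sub>m d"
  and rep_mult: "g \<in> carrier (dihedral r) \<Longrightarrow> h \<in> carrier (dihedral r) \<Longrightarrow> \<psi> (g \<otimes>\<^bsub>dihedral r\<^esub> h) = \<psi> g * \<psi> h"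
  using irr by (auto simp: irreducible_rep_def is_rep_def)

lemma d_pos: "d > 0" using irr by (simp add: irreducible_rep_def)

lemma rep_dim [simp]: "g \<in> carrier (dihedral r) \<Longrightarrow> dim_row (\<psi> g) = d" "g \<in> carrier (dihedral r) \<Longrightarrow> dim_col (\<psi> g) = d"
  using carrier_matD[OF rep_carrier] by auto

lemma nat_mod_r [simp]: "nat (i mod int r) < r"
  by (metis Euclidean_Rings.pos_mod_bound Euclidean_Rings.pos_mod_sign nat_less_iff of_nat_0_less_iff r_gt(1))

lemma act_closed [simp]: "g \<in> carrier (dihedral r) \<Longrightarrow> v \<in> V \<Longrightarrow> \<psi> g *\<^sub>v v \<in> V"
  by (rule mult_mat_vec_carrier) auto

lemma act_mult: "g \<in> carrier (dihedral r) \<Longrightarrow> h \<in> carrier (dihedral r) \<Longrightarrow> v \<in> V \<Longrightarrow>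
    \<psi> (g \<otimes>\<^bsub>dihedral r\<^esub> h) *\<^sub>v v = \<psi> g *\<^sub>v (\<psi> h *\<^sub>v v)"
  by (simp add: rep_mult assoc_mult_mat_vec[of _ d d _ d])

lemma act_add: "g \<in> carrier (dihedral r) \<Longrightarrow> v \<in> V \<Longrightarrow> w \<in> V \<Longrightarrow> \<psi> g *\<^sub>v (v + w) = \<psi> g *\<^sub>v v + \<psi> g *\<^sub>v w"
  by (rule mult_add_distrib_mat_vec) auto

lemma act_diff: "g \<in> carrier (dihedral r) \<Longrightarrow> v \<in> V \<Longrightarrow> w \<in> V \<Longrightarrow> \<psi> g *\<^sub>v (v - w) = \<psi> g *\<^sub>v v - \<psi> g *\<^sub>v w"
  by (rule mult_minus_distrib_mat_vec) auto

lemma act_smult: "g \<in> carrier (dihedral r) \<Longrightarrow> v \<in> V \<Longrightarrow> \<psi> g *\<^sub>v (c \<cdot>\<^sub>v v) = c \<cdot>\<^sub>v (\<psi> g *\<^sub>v v)"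
  by (rule mult_mat_vec) auto

lemma act_0 [simp]: "g \<in> carrier (dihedral r) \<Longrightarrow> \<psi> g *\<^sub>v 0\<^sub>v d = 0\<^sub>v d"
  by (intro eq_vecI) auto

lemma act_uminus: "g \<in> carrier (dihedral r) \<Longrightarrow> v \<in> V \<Longrightarrow> \<psi> g *\<^sub>v (- v) = - (\<psi> g *\<^sub>v v)"
  by (intro eq_vecI) auto

lemma A_A: "v \<in> V \<Longrightarrow> A (A v) = v" and Z_Z: "v \<in> V \<Longrightarrow> Z (Z v) = v"
  using act_mult[of "(Suc 0, True)" "(Suc 0, True)" v] act_mult[of "(0, True)" "(0, True)" v] by auto

lemma rot_closed [simp]: "v \<in> V \<Longrightarrow> rot i v \<in> V" by (simp add: rot_def)
lemma dim_rot [simp]: "dim_vec (rot i v) = d" by (simp add: rot_def)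
lemma rot_0 [simp]: "v \<in> V \<Longrightarrow> rot 0 v = v" by (simp add: rot_def)
lemma rot_zero [simp]: "rot i (0\<^sub>v d) = 0\<^sub>v d" by (simp add: rot_def)
lemma rot_dist: "v \<in> V \<Longrightarrow> w \<in> V \<Longrightarrow> rot i (v + w) = rot i v + rot i w"
   "v \<in> V \<Longrightarrow> w \<in> V \<Longrightarrow> rot i (v - w) = rot i v - rot i w"
   "v \<in> V \<Longrightarrow> rot i (c \<cdot>\<^sub>v v) = c \<cdot>\<^sub>v rot i v"
  by (simp_all add: rot_def act_add act_diff act_smult)

lemma int_nat_mod_r [simp]: "int (nat (i mod int r)) = i mod int r" by simp

lemma dihedral_rot_mult:
  "(nat (i mod int r), False) \<otimes>\<^bsub>dihedral r\<^esub> (nat (j mod int r), e) = (nat ((i + j) mod int r), e)"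
  "(nat (i mod int r), True) \<otimes>\<^bsub>dihedral r\<^esub> (nat (j mod int r), e) = (nat ((i - j) mod int r), \<not> e)"
proof -
  note eq = int_fst_dihedral_mult[of "nat (j mod int r)" r "nat (i mod int r)" _ e, OF nat_mod_r]
  show "(nat (i mod int r), False) \<otimes>\<^bsub>dihedral r\<^esub> (nat (j mod int r), e) = (nat ((i + j) mod int r), e)"
  proof (rule prod_eqI)
    have "int (fst ((nat (i mod int r), False) \<otimes>\<^bsub>dihedral r\<^esub> (nat (j mod int r), e))) = (i + j) mod int r"
      unfolding eq[of False] by (simp add: mod_simps)
    then show "fst ((nat (i mod int r), False) \<otimes>\<^bsub>dihedral r\<^esub> (nat (j mod int r), e)) = fst (nat ((i + j) mod int r), e)"
      by (metis fst_conv nat_int)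
  qed simp
  show "(nat (i mod int r), True) \<otimes>\<^bsub>dihedral r\<^esub> (nat (j mod int r), e) = (nat ((i - j) mod int r), \<not> e)"
  proof (rule prod_eqI)
    have "int (fst ((nat (i mod int r), True) \<otimes>\<^bsub>dihedral r\<^esub> (nat (j mod int r), e))) = (i - j) mod int r"
      unfolding eq[of True] by (simp add: mod_simps)
    then show "fst ((nat (i mod int r), True) \<otimes>\<^bsub>dihedral r\<^esub> (nat (j mod int r), e)) = fst (nat ((i - j) mod int r), \<not> e)"
      by (metis fst_conv nat_int)
  qed simp
qed

lemma rot_rot: "v \<in> V \<Longrightarrow> rot i (rot j v) = rot (i + j) v"
  using act_mult[of "(nat (i mod int r), False)" "(nat (j mod int r), False)" v]
  by (simp add: rot_def dihedral_rot_mult del: dihedral_mult)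

lemma rot_r [simp]: "rot (i + int r) v = rot i v" "rot (i - int r) v = rot i v"
  by (simp_all add: rot_def)

lemma rot_mod: "rot (i mod int r) v = rot i v"
  by (simp add: rot_def)

lemma rot_int: "k < r \<Longrightarrow> rot (int k) v = \<psi> (k, False) *\<^sub>v v"
  by (simp add: rot_def flip: zmod_int)

lemma act_True: "k < r \<Longrightarrow> v \<in> V \<Longrightarrow> \<psi> (k, True) *\<^sub>v v = rot (int k) (Z v)"
  using act_mult[of "(k, False)" "(0, True)" v] by (simp add: rot_int)

lemma Z_rot: "v \<in> V \<Longrightarrow> Z (rot i v) = rot (- i) (Z v)"
  using act_mult[of "(nat (0 mod int r), True)" "(nat (i mod int r), False)" v]
    act_mult[of "(nat ((- i) mod int r), False)" "(nat (0 mod int r), True)" v]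
  by (simp only: dihedral_rot_mult) (simp add: rot_def)

lemma A_eq: "v \<in> V \<Longrightarrow> A v = rot 1 (Z v)"
  using act_True[of "Suc 0" v] by simp

lemma rot_1: "v \<in> V \<Longrightarrow> rot 1 v = A (Z v)"
  by (simp add: A_eq Z_Z)

lemma A_rot: "v \<in> V \<Longrightarrow> A (rot i v) = rot (- i) (A v)"
  by (simp add: A_eq Z_rot rot_rot add.commute)

lemma Z_eq: "v \<in> V \<Longrightarrow> Z v = rot (-1) (A v)"
  by (simp add: A_eq rot_rot)

text \<open>The working form of irreducibility: scalars are free over the prime field, and the two
  reflections generate D. Later it is applied to eigenspaces, kernels, spans and sets of
  translations.\<close>

lemma invariant_subspace_cases:
  assumes W: "W \<subseteq> V" "0\<^sub>v d \<in> W" "\<And>v w. v \<in> W \<Longrightarrow> w \<in> W \<Longrightarrow> v + w \<in> W"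
    and AZ: "\<And>v. v \<in> W \<Longrightarrow> A v \<in> W" "\<And>v. v \<in> W \<Longrightarrow> Z v \<in> W"
  shows "W = {0\<^sub>v d} \<or> W = V"
proof -
  have inv: "\<forall>v\<in>W. \<psi> g *\<^sub>v v \<in> W" if "g \<in> carrier (dihedral r)" for g
  proof -
    have "g \<in> generated_by (dihedral r) (Suc 0, True) (0, True)"
      using that dihedral_generated[of r] by auto
    then show ?thesis
    proof induction
      case one
      then show ?case using W(1) by auto
    next
      case (left g)
      have "g \<in> carrier (dihedral r)" using left D.generated_by_subset[of "(Suc 0, True)" "(0, True)"] by auto
      then show ?case using left W(1) AZ by (simp add: act_mult subset_iff del: D.m_closed)
    next
      case (right g)
      have "g \<in> carrier (dihedral r)" using right D.generated_by_subset[of "(Suc 0, True)" "(0, True)"] by auto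
      then show ?case using right W(1) AZ by (simp add: act_mult subset_iff)
    qed
  qed
  have "0\<^sub>v d \<in> W \<and> (\<forall>v\<in>W. \<forall>w\<in>W. v + w \<in> W) \<and> (\<forall>c. \<forall>v\<in>W. c \<cdot>\<^sub>v v \<in> W) \<and>
      (\<forall>g\<in>carrier (dihedral r). \<forall>v\<in>W. \<psi> g *\<^sub>v v \<in> W) \<longrightarrow> W = {0\<^sub>v d} \<or> W = V"
    using irr W(1) unfolding irreducible_rep_def by (elim conjE) (erule allE[of _ W], erule mp)
  then show ?thesis
    by (rule mp) (intro conjI ballI allI W inv[rule_format] add_closed_imp_smult_closed[OF W])
qed

text \<open>Reflections invert rho, so they preserve its fixed space, which is therefore a
  subrepresentation.\<close>

lemma rot_1_cases:
  "(\<forall>v\<in>V. rot 1 v = v) \<or> (\<forall>v\<in>V. rot 1 v = v \<longrightarrow> v = 0\<^sub>v d)"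
proof -
  let ?W = "{v \<in> V. rot 1 v = v}"
  have m1: "rot (-1) v = v" if "v \<in> V" "rot 1 v = v" for v
    using rot_rot[of v "-1" 1] that by simp
  have "?W = {0\<^sub>v d} \<or> ?W = V"
  proof (rule invariant_subspace_cases)
    fix v assume "v \<in> ?W"
    then have v: "v \<in> V" "rot 1 v = v" by auto
    have "rot 1 (A v) = A (rot (-1) v)" "rot 1 (Z v) = Z (rot (-1) v)"
      using v by (simp_all only: A_rot Z_rot minus_minus)
    then show "A v \<in> ?W" "Z v \<in> ?W" using v by (auto simp: m1)
  qed (auto simp: rot_dist)
  then show ?thesis by blast
qed

text \<open>The vector v + A v is always fixed by \<open>A\<close>; if it vanishes for all v, then A
  = -1.\<close>

lemma A_cases: "(\<exists>u\<in>V. u \<noteq> 0\<^sub>v d \<and> A u = u) \<or> (\<forall>v\<in>V. A v = - v)"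
proof (rule disjCI)
  assume *: "\<not> (\<forall>v\<in>V. A v = - v)"
  then obtain v where v: "v \<in> V" "A v \<noteq> - v" by blast
  have "v + A v \<noteq> 0\<^sub>v d"
  proof
    assume eq: "v + A v = 0\<^sub>v d"
    have "A v = - v"
    proof (rule eq_vecI)
      fix i assume "i < dim_vec (- v)"
      then have i: "i < d" using v by simp
      have "(v + A v) $ i = 0" using i by (simp add: eq)
      then show "A v $ i = (- v) $ i" using i v by (simp add: eq_neg_iff_add_eq_0 add.commute)
    qed (use v in auto)
    then show False using v by simp
  qed
  moreover have "A (v + A v) = v + A v"
    using v by (simp add: act_add A_A comm_add_vec[of _ d])
  ultimately show "\<exists>u\<in>V. u \<noteq> 0\<^sub>v d \<and> A u = u" using v by (intro bexI[of _ "v + A v"]) auto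
qed

text \<open>When rho is trivial, \<open>A\<close> and \<open>Z\<close> coincide, so the fixed space
  of \<open>A\<close> is invariant under D.\<close>

lemma A_scalar:
  assumes "\<forall>v\<in>V. rot 1 v = v"
  shows "(\<forall>v\<in>V. A v = v) \<or> (\<forall>v\<in>V. A v = - v)"
proof -
  have AZ: "A v = Z v" if "v \<in> V" for v using assms that by (simp add: A_eq)
  let ?W = "{v \<in> V. A v = v}"
  have "?W = {0\<^sub>v d} \<or> ?W = V"
    by (rule invariant_subspace_cases) (auto simp: act_add simp flip: AZ)
  then show ?thesis using A_cases by blast
qed

text \<open>The normal form of the vector part of a when that of z is 0. A (-1)-eigenvector of
  \<open>A\<close> is accepted only for trivial rho, because otherwise conjugation by V removes it.
  Fixed vectors lead to Praeger-Xu graphs, negated ones to the cycle of length pr.\<close>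

definition admissible :: "'p mod_ring vec \<Rightarrow> bool" where
  "admissible u \<longleftrightarrow> u \<in> V \<and> u \<noteq> 0\<^sub>v d \<and> (A u = u \<or> A u = - u \<and> (\<forall>v\<in>V. rot 1 v = v))"

definition exceptional :: bool where
  "exceptional \<longleftrightarrow> (\<forall>v\<in>V. rot 1 v = - v) \<and> (\<forall>v\<in>V. A v = - v)"

text \<open>Suppose \<open>A\<close> has no nonzero fixed vector, so A = -1. Then Z = -rho, and Z^2
  = 1 gives rho^2 = 1. The (-1)-eigenspace of rho is invariant and, outside the exceptional case,
  zero; it contains every v - rho v, so rho = 1 and any nonzero vector qualifies.\<close>

lemma exists_admissible:
  assumes "\<not> exceptional"
  shows "\<exists>u. admissible u"
proof (cases "\<exists>u\<in>V. u \<noteq> 0\<^sub>v d \<and> A u = u")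
  case False
  then have A: "A v = - v" if "v \<in> V" for v using A_cases that by blast
  have Z: "Z v = - rot 1 v" if "v \<in> V" for v
    using A_A[of "Z v"] that by (simp add: rot_1 A)
  let ?W = "{v \<in> V. rot 1 v = - v}"
  have "?W = {0\<^sub>v d} \<or> ?W = V"
  proof (rule invariant_subspace_cases)
    fix v w assume "v \<in> ?W" "w \<in> ?W"
    then show "v + w \<in> ?W" by (auto simp: rot_dist intro!: eq_vecI)
  next
    fix v assume "v \<in> ?W"
    then have v: "v \<in> V" "rot 1 v = - v" by auto
    then have "A v = - v" "Z v = v" "rot 1 (- v) = v"
      by (auto simp: A Z rot_def act_uminus)
    then show "A v \<in> ?W" "Z v \<in> ?W" using v by auto
  qed auto
  moreover have "?W \<noteq> V" using assms A by (auto simp: exceptional_def)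
  ultimately have W: "?W = {0\<^sub>v d}" by blast
  have "rot 1 v = v" if v: "v \<in> V" for v
  proof -
    have "rot 1 (v - rot 1 v) = rot 1 v - v"
    proof -
      have "rot 1 (rot 1 v) = v"
        using Z_Z[OF v] v by (simp add: Z rot_def act_uminus)
      then show ?thesis using v by (simp add: rot_dist)
    qed
    also have "\<dots> = - (v - rot 1 v)" using v by (intro eq_vecI) auto
    finally have "v - rot 1 v \<in> ?W" using v by simp
    then have "v - rot 1 v = 0\<^sub>v d" unfolding W by simp
    then have "(v - rot 1 v) $ i = 0" if "i < d" for i using that by simp
    then have "v $ i = rot 1 v $ i" if "i < d" for i using that v by simp
    then show ?thesis using v by (intro eq_vecI) auto
  qed
  moreover have "unit_vec d 0 \<in> V" "(unit_vec d 0 :: 'p mod_ring vec) \<noteq> 0\<^sub>v d"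
    using d_pos by (auto dest: arg_cong[where f="\<lambda>v. v $ 0"])
  ultimately show ?thesis using A unfolding admissible_def by blast
qed (auto simp: admissible_def)

text \<open>Either alternative for u would force u = -u, impossible for a nonzero vector in odd
  characteristic.\<close>

lemma admissible_not_exceptional: "admissible u \<Longrightarrow> \<not> exceptional"
proof
  assume u: "admissible u" and e: exceptional
  have "u = - u \<or> - u = u" using u e by (auto simp: admissible_def exceptional_def)
  moreover have uV: "u \<in> V" using u by (simp add: admissible_def)
  ultimately have "u + u = 0\<^sub>v d" using uminus_r_inv_vec[OF uV] by metis
  then have "u = 0\<^sub>v d" by (rule vec_add_self_eq_0D[OF uV])
  then show False using u by (simp add: admissible_def)
qed

section \<open>The group generated by a rotary pair\<close>

sublocale G: group G
proof (rule groupI)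
  fix x y assume "x \<in> carrier G" "y \<in> carrier G"
  then show "x \<otimes>\<^bsub>G\<^esub> y \<in> carrier G"
    using D.m_closed by (auto simp del: dihedral_mult split: prod.splits)
next
  show "\<one>\<^bsub>G\<^esub> \<in> carrier G" by simp
next
  fix x y z assume "x \<in> carrier G" "y \<in> carrier G" "z \<in> carrier G"
  moreover obtain v g w h u k where "x = (v, g)" "y = (w, h)" "z = (u, k)" by (cases x; cases y; cases z)
  ultimately show "x \<otimes>\<^bsub>G\<^esub> y \<otimes>\<^bsub>G\<^esub> z = x \<otimes>\<^bsub>G\<^esub> (y \<otimes>\<^bsub>G\<^esub> z)"
    by (simp add: D.m_assoc act_mult act_add assoc_add_vec[of _ d] del: dihedral_mult)
next
  fix x assume "x \<in> carrier G"
  then show "\<one>\<^bsub>G\<^esub> \<otimes>\<^bsub>G\<^esub> x = x" by (auto simp: mod_less split: prod.splits)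
next
  fix x assume x: "x \<in> carrier G"
  obtain v g where [simp]: "x = (v, g)" by (cases x)
  have g: "g \<in> carrier (dihedral r)" and v: "v \<in> V" using x by auto
  let ?h = "inv\<^bsub>dihedral r\<^esub> g"
  have "- (\<psi> ?h *\<^sub>v v) + \<psi> ?h *\<^sub>v v = 0\<^sub>v d" using g v by (intro eq_vecI) auto
  then show "\<exists>y\<in>carrier G. y \<otimes>\<^bsub>G\<^esub> x = \<one>\<^bsub>G\<^esub>"
    using g v D.l_inv[OF g] by (intro bexI[of _ "(- (\<psi> ?h *\<^sub>v v), ?h)"]) (auto simp del: dihedral_mult)
qed

lemma rot_trivial_pow:
  assumes rot1: "\<forall>v\<in>V. rot 1 v = v" and u: "u \<in> V"
  shows "(u, (Suc 0, False)) [^]\<^bsub>G\<^esub> (n::nat) = (of_nat n \<cdot>\<^sub>v u, (n mod r, False))"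
proof (induction n)
  case 0
  have "0\<^sub>v d = (0 :: 'p mod_ring) \<cdot>\<^sub>v u" using u by (intro eq_vecI) auto
  then show ?case by simp
next
  case (Suc n)
  have rho: "\<psi> (k, False) *\<^sub>v u = u" if "k < r" for k
    using that
  proof (induction k)
    case (Suc k)
    then show ?case
      using act_mult[of "(k, False)" "(Suc 0, False)" u] u rot1 rot_int[of "Suc 0" u] by simp
  qed (use u in simp)
  have "of_nat n \<cdot>\<^sub>v u + u = (of_nat (Suc n) :: 'p mod_ring) \<cdot>\<^sub>v u"
    using u by (intro eq_vecI) (auto simp: algebra_simps)
  then show ?case using Suc u rho[of "n mod r"] by (simp add: mod_simps)
qed

text \<open>The translations in the generated set form a subspace W invariant under \<open>Z\<close>
  (conjugation by z) and \<open>A\<close>. Once W contains a nonzero vector it is all of V, and the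
  pair already generates D modulo V.\<close>

lemma generated_by_admissible:
  assumes u: "admissible u"
  shows "carrier G \<subseteq> generated_by G (u, (Suc 0, True)) (0\<^sub>v d, (0, True))" (is "_ \<subseteq> ?M")
proof -
  let ?a = "(u, (Suc 0, True))" and ?z = "(0\<^sub>v d :: 'p mod_ring vec, (0 :: nat, True))"
  have uV: "u \<in> V" "u \<noteq> 0\<^sub>v d" using u by (auto simp: admissible_def)
  have az: "?a \<in> carrier G" "?z \<in> carrier G" using uV by auto
  have MG: "?M \<subseteq> carrier G" by (rule G.generated_by_subset[OF az])
  note mult = G.generated_by_mult[OF az] and gens = G.generated_by_gens[OF az]
  define W where "W = {v \<in> V. (v, (0, False)) \<in> ?M}"
  have W: "W \<subseteq> V" "0\<^sub>v d \<in> W" "\<And>v w. v \<in> W \<Longrightarrow> w \<in> W \<Longrightarrow> v + w \<in> W"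
    using generated_by.one[of G ?a ?z] mult by (fastforce simp: W_def)+
  have uA: "u + A u \<in> W"
    using mult[OF gens(1) gens(1)] uV by (simp add: W_def)
  have "W = {0\<^sub>v d} \<or> W = V"
  proof (rule invariant_subspace_cases[OF W])
    fix v assume v: "v \<in> W"
    then have vV: "v \<in> V" and vM: "(v, (0, False)) \<in> ?M" by (auto simp: W_def)
    show "Z v \<in> W"
      using mult[OF mult[OF gens(2) vM] gens(2)] vV by (simp add: W_def)
    \<comment> \<open>Inverses are not built into the generated set. So a v a replaces the conjugate
      of v, and the known translation a a = u + A u is subtracted afterwards.\<close>
    have "(u + A v + A u, (0, False)) \<in> ?M"
      using mult[OF mult[OF gens(1) vM] gens(1)] by simp
    then have "u + A v + A u \<in> W" using vV uV by (simp add: W_def)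
    then have "(u + A v + A u) - (u + A u) \<in> W"
      using uA by (intro add_closed_imp_diff_closed[OF W])
    moreover have "(u + A v + A u) - (u + A u) = A v" using vV uV by (intro eq_vecI) auto
    ultimately show "A v \<in> W" by simp
  qed
  moreover have "W \<noteq> {0\<^sub>v d}"
  proof (cases "A u = u")
    case True
    then show ?thesis using uA uV vec_add_self_eq_0D[of u] by auto
  next
    case False
    then have rot1: "rot 1 v = v" if "v \<in> V" for v using u that by (auto simp: admissible_def)
    have az': "?a \<otimes>\<^bsub>G\<^esub> ?z = (u, (Suc 0, False))" using uV by (simp add: mod_less)
    \<comment> \<open>Here a a = 1 because A u = -u, so the nonzero translation comes from az
      instead: rho acts trivially, and (az)^r is translation by r u, nonzero since p does not divide
      r.\<close>
    have "(u, (Suc 0, False)) [^]\<^bsub>G\<^esub> r \<in> ?M"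
      using G.generated_by_pow[OF az mult[OF gens]] az' by simp
    then have "of_nat r \<cdot>\<^sub>v u \<in> W" using rot_trivial_pow[of u r] rot1 uV by (simp add: W_def)
    moreover have "of_nat r \<cdot>\<^sub>v u \<noteq> 0\<^sub>v d"
    proof
      assume eq: "of_nat r \<cdot>\<^sub>v u = 0\<^sub>v d"
      have nz: "(of_nat r :: 'p mod_ring) \<noteq> 0" using of_nat_0_mod_ring_dvd p_ndvd by blast
      have "u = 0\<^sub>v d"
      proof (rule eq_vecI)
        fix i assume i: "i < dim_vec (0\<^sub>v d :: 'p mod_ring vec)"
        then have "(of_nat r \<cdot>\<^sub>v u) $ i = 0" by (simp add: eq)
        then show "u $ i = 0\<^sub>v d $ i" using i uV nz by simp
      qed (use uV in auto)
      then show False using uV by simp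
    qed
    ultimately show ?thesis by blast
  qed
  ultimately have WV: "W = V" by blast
  have "\<exists>v\<in>V. (v, g) \<in> ?M" if "g \<in> generated_by (dihedral r) (Suc 0, True) (0, True)" for g
    using that
  proof induction
    case one
    show ?case using generated_by.one[of G ?a ?z] by auto
  next
    case (left g)
    then obtain v where "(v, g) \<in> ?M" by blast
    then have "(v, g) \<otimes>\<^bsub>G\<^esub> ?a \<in> ?M" by (rule generated_by.left)
    moreover from this have "(v, g) \<otimes>\<^bsub>G\<^esub> ?a \<in> carrier G" using MG by blast
    ultimately show ?case by (auto simp del: dihedral_mult)
  next
    case (right g)
    then obtain v where "(v, g) \<in> ?M" by blast
    then have "(v, g) \<otimes>\<^bsub>G\<^esub> ?z \<in> ?M" by (rule generated_by.right)
    moreover from this have "(v, g) \<otimes>\<^bsub>G\<^esub> ?z \<in> carrier G" using MG by blast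
    ultimately show ?case by (auto simp del: dihedral_mult)
  qed
  note lift = this
  show ?thesis
  proof
    fix x assume x: "x \<in> carrier G"
    then obtain v g where vg: "x = (v, g)" "v \<in> V" "g \<in> carrier (dihedral r)" by auto
    then obtain w where w: "w \<in> V" "(w, g) \<in> ?M" using lift[of g] dihedral_generated[of r] by auto
    have "v - w \<in> W" unfolding WV using vg w by simp
    then have "(v - w, (0, False)) \<in> ?M" by (simp add: W_def)
    then have "(v - w, (0, False)) \<otimes>\<^bsub>G\<^esub> (w, g) \<in> ?M" using w by (intro mult)
    moreover have "v - w + w = v" using vg w by (intro eq_vecI) auto
    moreover have "(0, False) \<otimes>\<^bsub>dihedral r\<^esub> g = g" using vg(3) D.l_one[of g] by simp
    ultimately show "x \<in> ?M" using vg w by (simp del: dihedral_mult)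
  qed
qed

end

section \<open>Rotary maps as groups with a marked pair of generators\<close>

text \<open>Darts are named by group elements so that \<open>R\<close> and \<open>L\<close> are
  right multiplications; left multiplications then commute with both and are the
  automorphisms.\<close>

definition labels ::
  "('g, 'm) monoid_scheme \<Rightarrow> 'g \<Rightarrow> 'g \<Rightarrow> ('g \<Rightarrow> 'd) \<Rightarrow> 'd set \<Rightarrow> ('d \<Rightarrow> 'd) \<Rightarrow> ('d \<Rightarrow> 'd) \<Rightarrow> bool" where
  "labels G a z \<beta> D R L \<longleftrightarrow> a \<in> carrier G \<and> z \<in> carrier G \<and> bij_betw \<beta> (carrier G) D \<and>
     (\<forall>x\<in>carrier G. R (\<beta> x) = \<beta> (x \<otimes>\<^bsub>G\<^esub> a) \<and> L (\<beta> x) = \<beta> (x \<otimes>\<^bsub>G\<^esub> z))"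

lemma labelsD:
  fixes G (structure)
  assumes "labels G a z \<beta> D R L"
  shows "a \<in> carrier G" "z \<in> carrier G"
    "bij_betw \<beta> (carrier G) D" "inj_on \<beta> (carrier G)" "\<beta> ` carrier G = D"
    "\<And>x. x \<in> carrier G \<Longrightarrow> \<beta> x \<in> D"
    "\<And>x. x \<in> carrier G \<Longrightarrow> R (\<beta> x) = \<beta> (x \<otimes> a)"
    "\<And>x. x \<in> carrier G \<Longrightarrow> L (\<beta> x) = \<beta> (x \<otimes> z)"
    "\<And>y. y \<in> D \<Longrightarrow> \<exists>x\<in>carrier G. y = \<beta> x"
  using assms by (auto simp: labels_def bij_betw_def)

lemma labels_iso:
  assumes "labels G a z \<beta> D R L" "\<kappa> \<in> iso G' G" "a' \<in> carrier G'" "z' \<in> carrier G'" "\<kappa> a' = a" "\<kappa> z' = z"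
  shows "labels G' a' z' (\<beta> \<circ> \<kappa>) D R L"
  using assms unfolding labels_def iso_def hom_def
  by (auto intro: bij_betw_trans simp: Pi_iff)

lemma exists_labels:
  fixes G (structure)
  assumes G: "group G" "finite (carrier G)" and az: "a \<in> carrier G" "z \<in> carrier G"
    and D: "finite D" "card D = card (carrier G)"
  obtains \<beta> R L where "labels G a z \<beta> D R L" "R permutes D" "L permutes D"
proof -
  interpret group G by fact
  obtain \<beta> where \<beta>: "bij_betw \<beta> (carrier G) D" using finite_same_card_bij[OF G(2) D(1)] D(2) by auto
  define M where "M c = (\<lambda>y. if y \<in> D then \<beta> (inv_into (carrier G) \<beta> y \<otimes> c) else y)" for c
  have M: "M c (\<beta> x) = \<beta> (x \<otimes> c)" if "x \<in> carrier G" for c x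
    using \<beta> that by (auto simp: M_def bij_betw_def)
  have "M c permutes D" if c: "c \<in> carrier G" for c
  proof (rule bij_imp_permutes)
    have inv: "bij_betw (inv_into (carrier G) \<beta>) D (carrier G)" by (rule bij_betw_inv_into[OF \<beta>])
    have "bij_betw (\<lambda>x. x \<otimes> c) (carrier G) (carrier G)"
      using c by (intro bij_betwI[where g="\<lambda>x. x \<otimes> inv c"]) (auto simp: m_assoc)
    from bij_betw_trans[OF bij_betw_trans[OF inv this] \<beta>]
    have "bij_betw (\<beta> \<circ> ((\<lambda>x. x \<otimes> c) \<circ> inv_into (carrier G) \<beta>)) D D" .
    then show "bij_betw (M c) D D"
      by (rule bij_betw_cong[THEN iffD1, rotated]) (simp add: M_def)
  qed (simp add: M_def)
  then show ?thesis using that[of \<beta> "M a" "M z"] \<beta> az M by (simp add: labels_def)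
qed

lemma map_iso_if_group_iso:
  assumes "group G" and l: "labels G a z \<beta> D R L" and l': "labels G' a' z' \<beta>' D' R' L'"
    and \<kappa>: "\<kappa> \<in> iso G G'" "\<kappa> a = a'" "\<kappa> z = z'"
  shows "map_iso D R L D' R' L'"
proof -
  interpret group G by fact
  note l = labelsD[OF l]
  have "labels G a z (\<beta>' \<circ> \<kappa>) D' R' L'" by (rule labels_iso[OF l' \<kappa>(1) l(1,2) \<kappa>(2,3)])
  note l' = labelsD[OF this]
  let ?f = "(\<beta>' \<circ> \<kappa>) \<circ> inv_into (carrier G) \<beta>"
  have "bij_betw ?f D D'"
    using bij_betw_inv_into[OF l(3)] l'(3) by (rule bij_betw_trans)
  moreover have f: "?f (\<beta> g) = (\<beta>' \<circ> \<kappa>) g" if "g \<in> carrier G" for g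
    using l(4) that by simp
  have "?f (R x) = R' (?f x) \<and> ?f (L x) = L' (?f x)" if x: "x \<in> D" for x
  proof -
    obtain g where g: "g \<in> carrier G" "x = \<beta> g" using l(9)[OF x] by blast
    show ?thesis
      unfolding g(2) f[OF g(1)] l(7,8)[OF g(1)] l'(7,8)[OF g(1)]
      using g(1) l(1,2) by (simp add: f[simplified])
  qed
  ultimately show ?thesis unfolding map_iso_def by blast
qed

text \<open>Read through the labels, a map isomorphism is a bijection commuting with right
  multiplication by the generators. Composing with the left translation that makes it preserve 1
  turns it into a homomorphism, by induction on words in the second factor.\<close>

lemma group_iso_if_map_iso:
  assumes "group G" "group G'" and l: "labels G a z \<beta> D R L" and l': "labels G' a' z' \<beta>' D' R' L'"
    and gen: "carrier G \<subseteq> generated_by G a z" and m: "map_iso D R L D' R' L'"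
  obtains \<kappa> where "\<kappa> \<in> iso G G'" "\<kappa> a = a'" "\<kappa> z = z'"
proof -
  interpret G: group G by fact
  interpret G': group G' by fact
  note l = labelsD[OF l] and l' = labelsD[OF l']
  obtain f where f: "bij_betw f D D'" "\<And>x. x \<in> D \<Longrightarrow> f (R x) = R' (f x)" "\<And>x. x \<in> D \<Longrightarrow> f (L x) = L' (f x)"
    using m by (auto simp: map_iso_def)
  define \<phi> where "\<phi> = inv_into (carrier G') \<beta>' \<circ> (f \<circ> \<beta>)"
  have \<phi>: "bij_betw \<phi> (carrier G) (carrier G')"
    unfolding \<phi>_def by (intro bij_betw_trans[OF bij_betw_trans[OF l(3) f(1)] bij_betw_inv_into[OF l'(3)]])
  have \<phi>c: "\<phi> x \<in> carrier G'" if "x \<in> carrier G" for x using \<phi> that by (auto simp: bij_betw_def)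
  have \<beta>\<phi>: "\<beta>' (\<phi> x) = f (\<beta> x)" if "x \<in> carrier G" for x
    using that l(6) f(1) l'(5) by (auto simp: \<phi>_def bij_betw_def intro!: f_inv_into_f)
  have \<phi>a: "\<phi> (x \<otimes>\<^bsub>G\<^esub> a) = \<phi> x \<otimes>\<^bsub>G'\<^esub> a'" and \<phi>z: "\<phi> (x \<otimes>\<^bsub>G\<^esub> z) = \<phi> x \<otimes>\<^bsub>G'\<^esub> z'" if x: "x \<in> carrier G" for x
  proof -
    have "\<beta>' (\<phi> (x \<otimes>\<^bsub>G\<^esub> a)) = \<beta>' (\<phi> x \<otimes>\<^bsub>G'\<^esub> a')" "\<beta>' (\<phi> (x \<otimes>\<^bsub>G\<^esub> z)) = \<beta>' (\<phi> x \<otimes>\<^bsub>G'\<^esub> z')"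
      using x l(1,2,6) f(2,3)[of "\<beta> x"] \<beta>\<phi>[of x] l'(7,8)[OF \<phi>c[OF x]]
      by (simp_all add: \<beta>\<phi> l(7,8))
    then show "\<phi> (x \<otimes>\<^bsub>G\<^esub> a) = \<phi> x \<otimes>\<^bsub>G'\<^esub> a'" "\<phi> (x \<otimes>\<^bsub>G\<^esub> z) = \<phi> x \<otimes>\<^bsub>G'\<^esub> z'"
      using x l(1,2) l'(1,2) \<phi>c by (simp_all add: inj_on_eq_iff[OF l'(4)])
  qed
  define c where "c = inv\<^bsub>G'\<^esub> (\<phi> \<one>\<^bsub>G\<^esub>)"
  have c: "c \<in> carrier G'" using \<phi>c by (simp add: c_def)
  define \<kappa> where "\<kappa> x = c \<otimes>\<^bsub>G'\<^esub> \<phi> x" for x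
  have \<kappa>c: "\<kappa> x \<in> carrier G'" if "x \<in> carrier G" for x using that \<phi>c c by (simp add: \<kappa>_def)
  have \<kappa>1: "\<kappa> \<one>\<^bsub>G\<^esub> = \<one>\<^bsub>G'\<^esub>" using \<phi>c by (simp add: \<kappa>_def c_def)
  have \<kappa>a: "\<kappa> (x \<otimes>\<^bsub>G\<^esub> a) = \<kappa> x \<otimes>\<^bsub>G'\<^esub> a'" and \<kappa>z: "\<kappa> (x \<otimes>\<^bsub>G\<^esub> z) = \<kappa> x \<otimes>\<^bsub>G'\<^esub> z'" if x: "x \<in> carrier G" for x
    using x \<phi>c c l'(1,2) by (simp_all add: \<kappa>_def \<phi>a \<phi>z G'.m_assoc)
  have hom: "\<kappa> (x \<otimes>\<^bsub>G\<^esub> y) = \<kappa> x \<otimes>\<^bsub>G'\<^esub> \<kappa> y" if x: "x \<in> carrier G" and y: "y \<in> generated_by G a z" for x y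
    using y
  proof induction
    case one
    then show ?case using x \<kappa>c by (simp add: \<kappa>1)
  next
    case (left y)
    have y: "y \<in> carrier G" using left G.generated_by_subset[OF l(1,2)] by blast
    have "\<kappa> (x \<otimes>\<^bsub>G\<^esub> (y \<otimes>\<^bsub>G\<^esub> a)) = \<kappa> (x \<otimes>\<^bsub>G\<^esub> y \<otimes>\<^bsub>G\<^esub> a)"
      using x y l(1) by (simp add: G.m_assoc)
    then show ?case using x y l'(1) \<kappa>c left.IH by (simp add: \<kappa>a G'.m_assoc)
  next
    case (right y)
    have y: "y \<in> carrier G" using right G.generated_by_subset[OF l(1,2)] by blast
    have "\<kappa> (x \<otimes>\<^bsub>G\<^esub> (y \<otimes>\<^bsub>G\<^esub> z)) = \<kappa> (x \<otimes>\<^bsub>G\<^esub> y \<otimes>\<^bsub>G\<^esub> z)"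
      using x y l(2) by (simp add: G.m_assoc)
    then show ?case using x y l'(2) \<kappa>c right.IH by (simp add: \<kappa>z G'.m_assoc)
  qed
  have "bij_betw (\<lambda>x. c \<otimes>\<^bsub>G'\<^esub> x) (carrier G') (carrier G')"
    using c by (intro bij_betwI[where g="\<lambda>x. inv\<^bsub>G'\<^esub> c \<otimes>\<^bsub>G'\<^esub> x"]) (auto simp flip: G'.m_assoc)
  from bij_betw_trans[OF \<phi> this] have "bij_betw \<kappa> (carrier G) (carrier G')"
    by (simp add: \<kappa>_def[abs_def] o_def)
  then have "\<kappa> \<in> iso G G'" using hom gen \<kappa>c by (auto simp: iso_def hom_def)
  moreover have "\<kappa> a = a'" "\<kappa> z = z'"
    using \<kappa>a[of "\<one>\<^bsub>G\<^esub>"] \<kappa>z[of "\<one>\<^bsub>G\<^esub>"] l(1,2) l'(1,2) by (simp_all add: \<kappa>1)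
  ultimately show ?thesis by (rule that)
qed

lemma labels_orbit:
  fixes G (structure)
  assumes "group G" and l: "labels G a z \<beta> D R L" and x: "x \<in> carrier G"
  shows "R_orbit R (\<beta> x) = {\<beta> (x \<otimes> a [^] (k::nat)) | k. True}"
proof -
  interpret group G by fact
  note l = labelsD[OF l]
  have "(R ^^ k) (\<beta> x) = \<beta> (x \<otimes> a [^] k)" for k
    using x l(1) by (induction k) (simp_all add: l(7) m_assoc)
  then show ?thesis by (simp add: R_orbit_def)
qed

text \<open>Paths of darts starting at the label of 1 spell words in a and z, so connectedness is
  generation; \<open>L\<close> being an involution gives z^2 = 1.\<close>

lemma labels_generated:
  fixes G (structure)
  assumes "group G" and l: "labels G a z \<beta> D R L" and m: "is_map D R L"
  shows "carrier G \<subseteq> generated_by G a z" "z \<otimes> z = \<one>"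
proof -
  interpret group G by fact
  note l = labelsD[OF l]
  note sub = generated_by_subset[OF l(1,2)]
  have "\<exists>g\<in>generated_by G a z. y = \<beta> g" if "(\<lambda>a b. b = R a \<or> b = L a)\<^sup>*\<^sup>* (\<beta> \<one>) y" for y
    using that
  proof induction
    case base
    then show ?case using generated_by.one[of G a z] by blast
  next
    case (step y w)
    then obtain g where g: "g \<in> generated_by G a z" "y = \<beta> g" by blast
    then have "w = \<beta> (g \<otimes> a) \<or> w = \<beta> (g \<otimes> z)" using step(2) sub l(7,8) by auto
    then show ?case using g by (auto intro: generated_by.intros)
  qed
  note reach = this
  show "carrier G \<subseteq> generated_by G a z"
  proof
    fix g assume g: "g \<in> carrier G"
    then have "(\<lambda>a b. b = R a \<or> b = L a)\<^sup>*\<^sup>* (\<beta> \<one>) (\<beta> g)"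
      using m l(6) by (simp add: is_map_def)
    then obtain g' where g': "g' \<in> generated_by G a z" "\<beta> g = \<beta> g'" using reach by blast
    then have "g = g'" using g sub by (auto simp: inj_on_eq_iff[OF l(4)])
    then show "g \<in> generated_by G a z" using g' by simp
  qed
  have "L (L (\<beta> \<one>)) = \<beta> \<one>" using m l(6) by (simp add: is_map_def)
  then show "z \<otimes> z = \<one>" using l(2,4) by (simp add: l(8) inj_on_eq_iff)
qed

text \<open>Orbits of \<open>R\<close> are cosets of the cyclic group of a, so keeping z outside the
  powers of a is precisely the absence of loops.\<close>

lemma labels_is_map:
  fixes G (structure)
  assumes "group G" "finite (carrier G)" and l: "labels G a z \<beta> D R L" and perm: "R permutes D" "L permutes D"
    and gen: "carrier G \<subseteq> generated_by G a z" and zz: "z \<otimes> z = \<one>"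
    and za: "\<And>k::nat. z \<noteq> a [^] k"
  shows "is_map D R L"
proof -
  interpret group G by fact
  note orb = labels_orbit[OF assms(1) l]
  note l = labelsD[OF l]
  have "(\<lambda>a b. b = R a \<or> b = L a)\<^sup>*\<^sup>* x y" if xy: "x \<in> D" "y \<in> D" for x y
  proof -
    obtain g h where gh: "g \<in> carrier G" "h \<in> carrier G" "x = \<beta> g" "y = \<beta> h" using l(9)[OF xy(1)] l(9)[OF xy(2)] by blast
    have "(\<lambda>a b. b = R a \<or> b = L a)\<^sup>*\<^sup>* (\<beta> g) (\<beta> (g \<otimes> k))" if "k \<in> generated_by G a z" for k
      using that
    proof induction
      case one
      then show ?case using gh by simp
    next
      case (left k)
      have "k \<in> carrier G" using left generated_by_subset[OF l(1,2)] by blast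
      then have "\<beta> (g \<otimes> (k \<otimes> a)) = R (\<beta> (g \<otimes> k))"
        using gh(1) l(1) by (simp add: l(7) m_assoc)
      moreover have "(\<lambda>a b. b = R a \<or> b = L a)\<^sup>*\<^sup>* (\<beta> g) (R (\<beta> (g \<otimes> k)))"
        by (rule rtranclp.rtrancl_into_rtrancl[OF left.IH]) simp
      ultimately show ?case by (simp only:)
    next
      case (right k)
      have "k \<in> carrier G" using right generated_by_subset[OF l(1,2)] by blast
      then have "\<beta> (g \<otimes> (k \<otimes> z)) = L (\<beta> (g \<otimes> k))"
        using gh(1) l(2) by (simp add: l(8) m_assoc)
      moreover have "(\<lambda>a b. b = R a \<or> b = L a)\<^sup>*\<^sup>* (\<beta> g) (L (\<beta> (g \<otimes> k)))"
        by (rule rtranclp.rtrancl_into_rtrancl[OF right.IH]) simp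
      ultimately show ?case by (simp only:)
    qed
    from this[of "inv g \<otimes> h"] show ?thesis
      using gh subsetD[OF gen, of "inv g \<otimes> h"] by (simp flip: m_assoc)
  qed
  moreover have "L (L x) = x \<and> L x \<noteq> x \<and> L x \<notin> R_orbit R x" if xD: "x \<in> D" for x
  proof -
    obtain g where g: "g \<in> carrier G" "x = \<beta> g" using l(9)[OF xD] by blast
    have "L (L x) = x" using g l(2) by (simp add: l(8) m_assoc zz)
    moreover have nin: "L x \<notin> R_orbit R x"
    proof
      assume "L x \<in> R_orbit R x"
      then obtain k :: nat where "\<beta> (g \<otimes> z) = \<beta> (g \<otimes> a [^] k)" using g orb[OF g(1)] by (auto simp: l(8))
      then have "g \<otimes> z = g \<otimes> a [^] k" using g l(1,2) by (simp add: inj_on_eq_iff[OF l(4)])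
      then show False using za[of k] g l(1,2) by simp
    qed
    moreover have "x \<in> R_orbit R x" by (auto simp: R_orbit_def intro: exI[of _ 0])
    ultimately show ?thesis by auto
  qed
  moreover have "finite D" "D \<noteq> {}" using l(5) assms(2) by auto
  ultimately show ?thesis using perm by (simp add: is_map_def)
qed

text \<open>An automorphism commutes with \<open>R\<close> and \<open>L\<close>, hence is determined
  on all words by its value at the label of 1; it therefore equals the left multiplication
  \<open>T g\<close> with the same value there.\<close>

lemma labels_rotary:
  fixes G (structure)
  assumes "group G" and l: "labels G a z \<beta> D R L" and gen: "carrier G \<subseteq> generated_by G a z"
  shows "rotary D R L" "map_aut_group D R L \<cong> G"
proof -
  interpret group G by fact
  note l = labelsD[OF l]
  define T where "T g = (\<lambda>y. if y \<in> D then \<beta> (g \<otimes> inv_into (carrier G) \<beta> y) else y)" for g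
  have T: "T g (\<beta> x) = \<beta> (g \<otimes> x)" if "x \<in> carrier G" for g x
    using l(4,6) that by (simp add: T_def)
  have aut: "T g \<in> map_auts D R L" if g: "g \<in> carrier G" for g
  proof -
    have "bij_betw (\<lambda>x. g \<otimes> x) (carrier G) (carrier G)"
      using g by (intro bij_betwI[where g="\<lambda>x. inv g \<otimes> x"]) (auto simp flip: m_assoc)
    from bij_betw_trans[OF bij_betw_trans[OF bij_betw_inv_into[OF l(3)] this] l(3)]
    have "bij_betw (T g) D D"
      by (rule bij_betw_cong[THEN iffD1, rotated]) (simp add: T_def)
    then have "T g permutes D" by (rule bij_imp_permutes) (simp add: T_def)
    moreover have "T g (R x) = R (T g x) \<and> T g (L x) = L (T g x)" if xD: "x \<in> D" for x
    proof -
      obtain h where "h \<in> carrier G" "x = \<beta> h" using l(9)[OF xD] by blast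
      then show ?thesis using g l(1,2) by (simp add: l(7,8) T m_assoc)
    qed
    ultimately show ?thesis by (simp add: map_auts_def)
  qed
  have "\<exists>f\<in>map_auts D R L. f x = y" if xy: "x \<in> D" "y \<in> D" for x y
  proof -
    obtain g h where "g \<in> carrier G" "h \<in> carrier G" "x = \<beta> g" "y = \<beta> h" using l(9)[OF xy(1)] l(9)[OF xy(2)] by blast
    then show ?thesis
      by (intro bexI[of _ "T (h \<otimes> inv g)"] aut) (auto simp: T m_assoc)
  qed
  then show "rotary D R L" by (simp add: rotary_def)
  have "T \<in> iso G (map_aut_group D R L)"
  proof (rule isoI)
    show "T \<in> hom G (map_aut_group D R L)"
    proof (rule homI)
      fix g h assume gh: "g \<in> carrier G" "h \<in> carrier G"
      have "T (g \<otimes> h) y = T g (T h y)" for y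
      proof (cases "y \<in> D")
        case True
        then obtain k where "k \<in> carrier G" "y = \<beta> k" using l(9)[of y] by blast
        then show ?thesis using gh by (simp add: T m_assoc)
      qed (simp add: T_def)
      then show "T (g \<otimes> h) = T g \<otimes>\<^bsub>map_aut_group D R L\<^esub> T h"
        by (auto simp: map_aut_group_def)
    qed (simp add: map_aut_group_def aut)
    have "inj_on T (carrier G)"
    proof (rule inj_onI)
      fix g h assume gh: "g \<in> carrier G" "h \<in> carrier G" and "T g = T h"
      then have "T g (\<beta> \<one>) = T h (\<beta> \<one>)" by simp
      then show "g = h" using gh l(4) by (simp add: T inj_on_eq_iff)
    qed
    have "f \<in> T ` carrier G" if f: "f \<in> map_auts D R L" for f
    proof -
      have "f permutes D" using f by (simp add: map_auts_def)
      then have "f (\<beta> \<one>) \<in> D" using l(6) by (simp add: permutes_in_image)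
      then obtain g where g: "g \<in> carrier G" "f (\<beta> \<one>) = \<beta> g" using l(9)[of "f (\<beta> \<one>)"] by blast
      have f\<beta>: "f (\<beta> x) = \<beta> (g \<otimes> x)" if "x \<in> generated_by G a z" for x
        using that
      proof induction
        case one
        then show ?case using g by simp
      next
        case (left x)
        then have x: "x \<in> carrier G" using generated_by_subset[OF l(1,2)] by blast
        have "f (\<beta> (x \<otimes> a)) = R (f (\<beta> x))" using f x l(6) by (simp add: map_auts_def flip: l(7))
        then show ?case using left x g l(1) by (simp add: l(7) m_assoc)
      next
        case (right x)
        then have x: "x \<in> carrier G" using generated_by_subset[OF l(1,2)] by blast
        have "f (\<beta> (x \<otimes> z)) = L (f (\<beta> x))" using f x l(6) by (simp add: map_auts_def flip: l(8))
        then show ?case using right x g l(2) by (simp add: l(8) m_assoc)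
      qed
      have "f = T g"
      proof
        fix y
        show "f y = T g y"
        proof (cases "y \<in> D")
          case True
          then obtain k where k: "k \<in> carrier G" "y = \<beta> k" using l(9)[of y] by blast
          then show ?thesis using subsetD[OF gen k(1)] by (simp add: T f\<beta>)
        next
          case False
          then show ?thesis using \<open>f permutes D\<close> by (simp add: T_def permutes_not_in)
        qed
      qed
      then show ?thesis using g by blast
    qed
    then have "map_auts D R L \<subseteq> T ` carrier G" by (rule subsetI)
    moreover note \<open>inj_on T (carrier G)\<close>
    moreover have "T ` carrier G \<subseteq> map_auts D R L" using aut by (rule image_subsetI)
    ultimately have "bij_betw T (carrier G) (map_auts D R L)"
      unfolding bij_betw_def by (intro conjI equalityI)
    then show "bij_betw T (carrier G) (carrier (map_aut_group D R L))"
      by (simp add: map_aut_group_def)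
  qed
  then have "G \<cong> map_aut_group D R L" by (auto simp: is_iso_def)
  then show "map_aut_group D R L \<cong> G" by (rule iso_sym)
qed

text \<open>Connectedness makes an automorphism determined by the image of a base dart
  \<open>x0\<close>, and rotarity makes the action transitive, so each dart is the image of
  \<open>x0\<close> under exactly one automorphism. Because automorphisms commute with
  \<open>R\<close> and \<open>L\<close>, these act from the other side, as right multiplication by
  the elements carrying \<open>x0\<close> to \<open>R x0\<close> and \<open>L x0\<close>.\<close>

lemma rotary_map_labels:
  fixes G (structure)
  assumes "group G" and m: "is_map D R L" and rot: "rotary D R L" and iso: "map_aut_group D R L \<cong> G"
  obtains a z \<beta> where "labels G a z \<beta> D R L"
proof -
  interpret group G by fact
  obtain h where h: "h \<in> iso (map_aut_group D R L) G" using iso by (auto simp: is_iso_def)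
  obtain x0 where x0: "x0 \<in> D" using m by (auto simp: is_map_def)
  have RL: "R permutes D" "L permutes D" using m by (auto simp: is_map_def)
  have eqI: "f = f'" if f: "f \<in> map_auts D R L" "f' \<in> map_auts D R L" and "f x0 = f' x0" for f f'
  proof
    fix y
    show "f y = f' y"
    proof (cases "y \<in> D")
      case True
      have "(\<lambda>a b. b = R a \<or> b = L a)\<^sup>*\<^sup>* x0 y" using m x0 True by (simp add: is_map_def)
      then have "y \<in> D \<and> f y = f' y"
      proof induction
        case base
        then show ?case using x0 that by simp
      next
        case (step y w)
        then have "w \<in> D" using RL by (auto simp: permutes_in_image)
        then show ?case using step f by (auto simp: map_auts_def)
      qed
      then show ?thesis by simp
    next
      case False
      then show ?thesis using f by (auto simp: map_auts_def permutes_not_in)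
    qed
  qed
  define \<theta> where "\<theta> = inv_into (map_auts D R L) h"
  have hb: "bij_betw h (map_auts D R L) (carrier G)" using h by (simp add: iso_def map_aut_group_def)
  have \<theta>b: "bij_betw \<theta> (carrier G) (map_auts D R L)" unfolding \<theta>_def by (rule bij_betw_inv_into[OF hb])
  have \<theta>c: "\<theta> g \<in> map_auts D R L" if "g \<in> carrier G" for g using \<theta>b that by (auto simp: bij_betw_def)
  have h\<theta>: "h (\<theta> g) = g" if "g \<in> carrier G" for g
    using hb that by (simp add: \<theta>_def bij_betw_def f_inv_into_f)
  have comp: "f \<circ> f' \<in> map_auts D R L" if "f \<in> map_auts D R L" "f' \<in> map_auts D R L" for f f'
    using that by (auto simp: map_auts_def permutes_compose permutes_in_image)
  have \<theta>m: "\<theta> (g \<otimes> k) = \<theta> g \<circ> \<theta> k" if gk: "g \<in> carrier G" "k \<in> carrier G" for g k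
  proof -
    have "h (\<theta> g \<circ> \<theta> k) = g \<otimes> k"
      using h \<theta>c[OF gk(1)] \<theta>c[OF gk(2)] gk
      by (auto simp: iso_def hom_def map_aut_group_def h\<theta>)
    then show ?thesis
      using hb comp[OF \<theta>c[OF gk(1)] \<theta>c[OF gk(2)]] by (metis \<theta>_def bij_betw_inv_into_left)
  qed
  define \<beta> where "\<beta> g = \<theta> g x0" for g
  have "bij_betw (\<lambda>f. f x0) (map_auts D R L) D"
    unfolding bij_betw_def
  proof
    show "inj_on (\<lambda>f. f x0) (map_auts D R L)" using eqI by (auto intro: inj_onI)
    show "(\<lambda>f. f x0) ` map_auts D R L = D"
    proof
      show "(\<lambda>f. f x0) ` map_auts D R L \<subseteq> D" using x0 by (auto simp: map_auts_def permutes_in_image)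
      show "D \<subseteq> (\<lambda>f. f x0) ` map_auts D R L"
      proof
        fix y assume "y \<in> D"
        then obtain f where "f \<in> map_auts D R L" "f x0 = y" using x0 rot unfolding rotary_def by blast
        then show "y \<in> (\<lambda>f. f x0) ` map_auts D R L" by blast
      qed
    qed
  qed
  from bij_betw_trans[OF \<theta>b this] have \<beta>b: "bij_betw \<beta> (carrier G) D" by (simp add: \<beta>_def[abs_def] o_def)
  have D: "R x0 \<in> D" "L x0 \<in> D" using RL x0 by (auto simp: permutes_in_image)
  obtain a where a: "a \<in> carrier G" "\<beta> a = R x0" using \<beta>b D by (auto simp: bij_betw_def)
  obtain z where z: "z \<in> carrier G" "\<beta> z = L x0" using \<beta>b D by (auto simp: bij_betw_def)
  have "R (\<beta> x) = \<beta> (x \<otimes> a) \<and> L (\<beta> x) = \<beta> (x \<otimes> z)" if x: "x \<in> carrier G" for x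
    using \<theta>c[OF x] a z x x0 unfolding \<beta>_def by (simp add: \<theta>m map_auts_def)
  then have "labels G a z \<beta> D R L" using a z \<beta>b by (simp add: labels_def)
  then show ?thesis by (rule that)
qed

section \<open>The underlying graph of a labelled map\<close>

text \<open>Two functions with the same fibres have matching images. This identifies orbits of darts
  with coordinates without choosing representatives in later arguments.\<close>

lemma bij_betw_quotient:
  assumes "\<And>x y. x \<in> C \<Longrightarrow> y \<in> C \<Longrightarrow> f x = f y \<longleftrightarrow> g x = g y"
  obtains h where "bij_betw h (f ` C) (g ` C)" "\<And>x. x \<in> C \<Longrightarrow> h (f x) = g x"
proof -
  define h where "h = g \<circ> inv_into C f"
  have h: "h (f x) = g x" if "x \<in> C" for x
  proof -
    have "inv_into C f (f x) \<in> C" "f (inv_into C f (f x)) = f x"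
      using that by (auto intro: inv_into_into f_inv_into_f)
    then show ?thesis using assms[of "inv_into C f (f x)" x] that by (simp add: h_def)
  qed
  have "inj_on h (f ` C)" by (rule inj_onI) (auto simp: h assms)
  moreover have "h ` (f ` C) = g ` C" by (auto simp: h image_image)
  ultimately show ?thesis using that h by (auto simp: bij_betw_def)
qed

text \<open>Vertices are cosets of the powers of a and edges are cosets of {1, z}. It suffices to
  give coordinates \<open>F\<close> and \<open>E\<close> separating exactly these cosets and to
  check the ends of an edge on representatives.\<close>

lemma map_graph_iso:
  fixes G (structure)
  assumes "group G" and l: "labels G a z \<beta> D R L" and zz: "z \<otimes> z = \<one>"
    and F: "\<And>x y. x \<in> carrier G \<Longrightarrow> y \<in> carrier G \<Longrightarrow> F x = F y \<longleftrightarrow> (\<exists>k::nat. y = x \<otimes> a [^] k)"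
    and E: "\<And>x y. x \<in> carrier G \<Longrightarrow> y \<in> carrier G \<Longrightarrow> E x = E y \<longleftrightarrow> y = x \<or> y = x \<otimes> z"
    and V': "F ` carrier G = V'" and E': "E ` carrier G = E'"
    and ends: "\<And>x. x \<in> carrier G \<Longrightarrow> ends (E x) = {F x, F (x \<otimes> z)}"
  shows "mgraph_iso (map_graph D R L) (V', E', ends)"
proof -
  interpret group G by fact
  note orb = labels_orbit[OF assms(1) l]
  note l = labelsD[OF l]
  define O1 where "O1 x = R_orbit R (\<beta> x)" for x
  define N where "N x = {\<beta> x, \<beta> (x \<otimes> z)}" for x
  have in_O: "\<beta> y \<in> O1 x \<longleftrightarrow> F x = F y" if "x \<in> carrier G" "y \<in> carrier G" for x y
  proof -
    have "\<beta> y \<in> O1 x \<longleftrightarrow> (\<exists>k::nat. y = x \<otimes> a [^] k)"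
      unfolding O1_def orb[OF that(1)] using that l(1) by (auto simp: inj_on_eq_iff[OF l(4)])
    then show ?thesis using F[OF that] by simp
  qed
  have O_sub: "O1 x \<subseteq> \<beta> ` carrier G" if "x \<in> carrier G" for x
    unfolding O1_def orb[OF that] using that l(1) by auto
  have O_eq: "O1 x = O1 y \<longleftrightarrow> F x = F y" if xy: "x \<in> carrier G" "y \<in> carrier G" for x y
  proof
    assume "O1 x = O1 y"
    moreover have "\<beta> y \<in> O1 y" using in_O xy by simp
    ultimately have "\<beta> y \<in> O1 x" by simp
    then show "F x = F y" using in_O[OF xy] by simp
  next
    assume eq: "F x = F y"
    show "O1 x = O1 y"
    proof (rule Set.set_eqI)
      fix w
      have "w \<in> O1 x \<longleftrightarrow> w \<in> \<beta> ` carrier G \<and> w \<in> O1 x" using O_sub xy by blast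
      also have "\<dots> \<longleftrightarrow> w \<in> \<beta> ` carrier G \<and> w \<in> O1 y" using in_O xy eq by auto
      also have "\<dots> \<longleftrightarrow> w \<in> O1 y" using O_sub xy by blast
      finally show "w \<in> O1 x \<longleftrightarrow> w \<in> O1 y" .
    qed
  qed
  have N_eq: "N x = N y \<longleftrightarrow> E x = E y" if xy: "x \<in> carrier G" "y \<in> carrier G" for x y
  proof -
    have xzz: "x \<otimes> z \<otimes> z = x" using xy l(2) by (simp add: m_assoc zz)
    have "N x = N y \<longleftrightarrow> {x, x \<otimes> z} = {y, y \<otimes> z}"
      using xy l(2) inj_on_image_eq_iff[OF l(4), of "{x, x \<otimes> z}" "{y, y \<otimes> z}"]
      by (simp add: N_def)
    also have "\<dots> \<longleftrightarrow> y = x \<or> y = x \<otimes> z"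
      using xzz by (auto simp: doubleton_eq_iff)
    finally show ?thesis using E[OF xy] by simp
  qed
  obtain \<phi> where \<phi>: "bij_betw \<phi> (O1 ` carrier G) (F ` carrier G)" "\<And>x. x \<in> carrier G \<Longrightarrow> \<phi> (O1 x) = F x"
    using bij_betw_quotient[of "carrier G" O1 F] O_eq by blast
  obtain \<psi> where \<psi>: "bij_betw \<psi> (N ` carrier G) (E ` carrier G)" "\<And>x. x \<in> carrier G \<Longrightarrow> \<psi> (N x) = E x"
    using bij_betw_quotient[of "carrier G" N E] N_eq by blast
  have V: "R_orbit R ` D = O1 ` carrier G" unfolding O1_def l(5)[symmetric] by (simp add: image_image)
  have Ed: "{{x, L x} | x. x \<in> D} = N ` carrier G"
    unfolding l(5)[symmetric] N_def using l(8) by auto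
  have "ends (\<psi> (N x)) = \<phi> ` {v \<in> O1 ` carrier G. v \<inter> N x \<noteq> {}}" if x: "x \<in> carrier G" for x
  proof -
    have xz: "x \<otimes> z \<in> carrier G" using x l(2) by simp
    have "v \<inter> N x \<noteq> {} \<longleftrightarrow> v = O1 x \<or> v = O1 (x \<otimes> z)" if v: "v \<in> O1 ` carrier G" for v
    proof -
      obtain y where y: "y \<in> carrier G" "v = O1 y" using v by blast
      have "v \<inter> N x \<noteq> {} \<longleftrightarrow> \<beta> x \<in> O1 y \<or> \<beta> (x \<otimes> z) \<in> O1 y" unfolding N_def y by blast
      also have "\<dots> \<longleftrightarrow> F y = F x \<or> F y = F (x \<otimes> z)" using in_O y x xz by simp
      finally show ?thesis using O_eq[OF y(1) x] O_eq[OF y(1) xz] y by simp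
    qed
    then have "{v \<in> O1 ` carrier G. v \<inter> N x \<noteq> {}} = {O1 x, O1 (x \<otimes> z)}" using x xz by blast
    then show ?thesis using x xz \<phi>(2) \<psi>(2) ends by simp
  qed
  then show ?thesis
    unfolding mgraph_iso_def map_graph_def Let_def V Ed
    using \<phi>(1) \<psi>(1) V' E' by (auto intro!: exI[of _ \<phi>] exI[of _ \<psi>])
qed

text \<open>The vertex orbits and the pairs {x, L x} both partition the darts, into blocks of
  constant size: the order of a, and 2.\<close>

lemma labels_card:
  fixes G (structure)
  assumes "group G" "finite (carrier G)" and l: "labels G a z \<beta> D R L" and m: "is_map D R L"
  shows "group.ord G a * card (R_orbit R ` D) = card (carrier G)"
    "2 * card {{x, L x} | x. x \<in> D} = card (carrier G)"
proof -
  interpret group G by fact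
  note orb = labels_orbit[OF assms(1) l]
  note l = labelsD[OF l]
  have finD: "finite D" using l(3) assms(2) by (simp add: bij_betw_finite)
  have cardD: "card D = card (carrier G)" using l(3) by (simp add: bij_betw_same_card)
  have orb': "R_orbit R (\<beta> x) = (\<lambda>k. \<beta> (x \<otimes> k)) ` {a [^] k | k. k \<in> (UNIV :: nat set)}"
    if "x \<in> carrier G" for x
    unfolding orb[OF that] by blast
  have card_orb: "card (R_orbit R y) = ord a" if yD: "y \<in> D" for y
  proof -
    obtain x where x: "x \<in> carrier G" "y = \<beta> x" using l(9)[OF yD] by blast
    have "inj_on (\<lambda>k. \<beta> (x \<otimes> k)) {a [^] k | k. k \<in> (UNIV :: nat set)}"
      by (rule inj_onI) (use x l(1) in \<open>auto simp: inj_on_eq_iff[OF l(4)]\<close>)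
    then have "card (R_orbit R y) = card {a [^] k | k. k \<in> (UNIV :: nat set)}"
      unfolding x orb'[OF x(1)] by (rule card_image)
    also have "\<dots> = card ((\<lambda>k. a [^] k) ` {0..ord a - 1})"
      unfolding ord_elems[OF assms(2) l(1)] by (rule arg_cong[where f=card]) blast
    also have "\<dots> = ord a"
      using card_image[OF ord_inj[OF l(1)]] ord_ge_1[OF assms(2) l(1)] by simp
    finally show ?thesis .
  qed
  have RD: "R_orbit R y \<subseteq> D" if yD: "y \<in> D" for y
  proof -
    obtain x where x: "x \<in> carrier G" "y = \<beta> x" using l(9)[OF yD] by blast
    show ?thesis unfolding x orb[OF x(1)] using x l(1,6) by auto
  qed
  have orb_eq: "R_orbit R w = R_orbit R y" if wy: "w \<in> R_orbit R y" "y \<in> D" for w y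
  proof (rule card_subset_eq)
    show "R_orbit R w \<subseteq> R_orbit R y"
    proof
      fix v assume "v \<in> R_orbit R w"
      then obtain i where "v = (R ^^ i) w" by (auto simp: R_orbit_def)
      moreover obtain j where "w = (R ^^ j) y" using wy by (auto simp: R_orbit_def)
      ultimately have "v = (R ^^ (i + j)) y" by (simp add: funpow_add)
      then show "v \<in> R_orbit R y" by (auto simp: R_orbit_def)
    qed
    have "w \<in> D" using RD[OF wy(2)] wy(1) by blast
    then show "card (R_orbit R w) = card (R_orbit R y)" using card_orb wy by simp
    show "finite (R_orbit R y)" using RD[OF wy(2)] finD by (rule finite_subset)
  qed
  have self: "y \<in> R_orbit R y" for y by (auto simp: R_orbit_def intro: exI[of _ 0])
  have un: "\<Union> (R_orbit R ` D) = D" using RD self by blast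
  have "ord a * card (R_orbit R ` D) = card (\<Union> (R_orbit R ` D))"
  proof (rule card_partition)
    fix c1 c2 assume c: "c1 \<in> R_orbit R ` D" "c2 \<in> R_orbit R ` D" "c1 \<noteq> c2"
    then obtain y1 y2 where y: "y1 \<in> D" "y2 \<in> D" "c1 = R_orbit R y1" "c2 = R_orbit R y2" by blast
    show "c1 \<inter> c2 = {}"
    proof (rule ccontr)
      assume "c1 \<inter> c2 \<noteq> {}"
      then obtain w where "w \<in> R_orbit R y1" "w \<in> R_orbit R y2" using y by blast
      then show False using orb_eq[of w y1] orb_eq[of w y2] y c by simp
    qed
  qed (use finD un card_orb in auto)
  then show "ord a * card (R_orbit R ` D) = card (carrier G)" by (simp add: un cardD)
  have L: "L x \<in> D" "L (L x) = x" "L x \<noteq> x" if "x \<in> D" for x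
    using m that by (auto simp: is_map_def permutes_in_image)
  have un2: "\<Union> {{x, L x} | x. x \<in> D} = D" using L by blast
  have "2 * card {{x, L x} | x. x \<in> D} = card (\<Union> {{x, L x} | x. x \<in> D})"
  proof (rule card_partition)
    show "finite {{x, L x} | x. x \<in> D}" using finD by simp
    fix c assume "c \<in> {{x, L x} | x. x \<in> D}"
    then obtain x where "x \<in> D" "c = {x, L x}" by blast
    then show "card c = 2" using L(3)[of x] by simp
  next
    fix c1 c2 assume c: "c1 \<in> {{x, L x} | x. x \<in> D}" "c2 \<in> {{x, L x} | x. x \<in> D}" "c1 \<noteq> c2"
    then obtain x y where xy: "x \<in> D" "y \<in> D" "c1 = {x, L x}" "c2 = {y, L y}" by blast
    have "L x = y \<longleftrightarrow> x = L y" "L x = L y \<longleftrightarrow> x = y" using L(2)[OF xy(1)] L(2)[OF xy(2)] by metis+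
    then show "c1 \<inter> c2 = {}" using c(3) xy by auto
  qed (use un2 finD in auto)
  then show "2 * card {{x, L x} | x. x \<in> D} = card (carrier G)" by (simp add: un2 cardD)
qed

lemma card_bounded_lists: "card {(i, xs). i < r \<and> length xs = n \<and> (\<forall>x\<in>set xs. x < p)} = r * p ^ n"
  for r n p :: nat
proof -
  have "{(i, xs). i < r \<and> length xs = n \<and> (\<forall>x\<in>set xs. x < p)} =
      {..<r} \<times> {xs. set xs \<subseteq> {..<p} \<and> length xs = n}" by auto
  then show ?thesis by (simp add: card_cartesian_product card_lists_length_eq)
qed

lemma finite_bounded_lists: "finite {(i, xs). i < r \<and> length xs = n \<and> (\<forall>x\<in>set xs. x < p)}"
  for r n p :: nat
proof -
  have "{(i, xs). i < r \<and> length xs = n \<and> (\<forall>x\<in>set xs. x < p)} =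
      {..<r} \<times> {xs. set xs \<subseteq> {..<p} \<and> length xs = n}" by auto
  then show ?thesis by (simp add: finite_lists_length_eq)
qed

text \<open>Counting darts at vertices and along edges gives ord a times the number of vertices
  equal to twice the number of edges. A Praeger-Xu graph has p times as many edges as vertices, a
  cycle equally many; the exponent 2p serves both cases.\<close>

lemma aug_PX_map_pow:
  fixes G (structure)
  assumes G: "group G" "finite (carrier G)" and l: "labels G a z \<beta> D R L" and m: "aug_PX_map p r D R L"
    and pos: "p > 0" "r > 0"
  shows "a [^] (2 * p) = \<one>"
proof -
  interpret group G by fact
  have map: "is_map D R L" using m by (simp add: aug_PX_map_def)
  note cards = labels_card[OF G l map]
  obtain s \<delta> where iso: "mgraph_iso (map_graph D R L) (aug_PX_graph p r s \<delta>)"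
    using m by (auto simp: aug_PX_map_def)
  let ?V = "R_orbit R ` D" and ?E = "{{x, L x} | x. x \<in> D}"
  have "ord a * card ?V = 2 * card ?E" using cards by simp
  moreover have "card ?E = p * card ?V \<and> card ?V > 0 \<or> card ?E = card ?V \<and> card ?V > 0"
  proof (cases "s = 0 \<and> \<delta> = -1")
    case True
    then have "mgraph_iso (map_graph D R L) (cycle_graph (p * r))" using iso by (simp add: aug_PX_graph_def)
    then have "card ?V = card {(i, [] :: nat list) | i. i < p * r} \<and> card ?E = card {(i, [] :: nat list) | i. i < p * r}"
      by (auto simp: mgraph_iso_def map_graph_def Let_def cycle_graph_def dest: bij_betw_same_card)
    moreover have "card {(i, [] :: nat list) | i. i < p * r} = p * r"
      using card_image[of "\<lambda>i. (i, [] :: nat list)" "{..<p * r}"] by (simp add: inj_on_def setcompr_eq_image lessThan_def)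
    ultimately show ?thesis using pos by simp
  next
    case False
    then have "mgraph_iso (map_graph D R L) (PX_graph p r s)" using iso by (auto simp: aug_PX_graph_def)
    then have "card ?V = r * p ^ s \<and> card ?E = r * p ^ Suc s"
      unfolding card_bounded_lists[symmetric]
      by (auto simp: mgraph_iso_def map_graph_def Let_def PX_graph_def dest: bij_betw_same_card)
    then show ?thesis using pos by simp
  qed
  ultimately have "ord a = 2 * p \<or> ord a = 2" by auto
  then have "ord a dvd 2 * p" by auto
  then show ?thesis using labelsD(1)[OF l] by (simp add: pow_eq_id)
qed

section \<open>Cycles\<close>

text \<open>A coordinate on the cosets of the subgroup {1, tau''}: the coset of
  \<open>(k, False)\<close> also contains (k + 1, True), the first entry mod n, which explains the
  shift by one on reflections. It is the position of a vertex around the cycle.\<close>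

definition dihedral_pos :: "nat \<Rightarrow> nat \<times> bool \<Rightarrow> nat" where
  "dihedral_pos n = (\<lambda>(k, e). if e then (k + n - 1) mod n else k)"

lemma mod_pred_Suc: "k < n \<Longrightarrow> ((k + n - 1) mod n + 1) mod n = k" for k n :: nat
  by (simp add: mod_simps)

lemma mod_Suc_pred: "k < n \<Longrightarrow> (Suc k mod n + n - Suc 0) mod n = k" for k n :: nat
  by (cases "Suc k = n") auto

lemma dihedral_pos_mult:
  assumes "g \<in> carrier (dihedral n)"
  shows "dihedral_pos n (g \<otimes>\<^bsub>dihedral n\<^esub> (Suc 0, True)) = dihedral_pos n g"
  using assms by (cases g) (auto simp: dihedral_pos_def mod_Suc_pred)

lemma dihedral_pos_eq_iff:
  assumes g: "g \<in> carrier (dihedral n)" and h: "h \<in> carrier (dihedral n)"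
  shows "dihedral_pos n g = dihedral_pos n h \<longleftrightarrow> h = g \<or> h = g \<otimes>\<^bsub>dihedral n\<^esub> (Suc 0, True)"
proof
  assume eq: "dihedral_pos n g = dihedral_pos n h"
  obtain k e l f where [simp]: "g = (k, e)" "h = (l, f)" by (cases g; cases h)
  have kl: "k < n" "l < n" using g h by auto
  show "h = g \<or> h = g \<otimes>\<^bsub>dihedral n\<^esub> (Suc 0, True)"
  proof (cases e; cases f)
    assume ef: e f
    then have "(k + n - 1) mod n = (l + n - 1) mod n" using eq by (simp add: dihedral_pos_def)
    then have "k = l" using mod_pred_Suc[OF kl(1)] mod_pred_Suc[OF kl(2)] by simp
    then show ?thesis using ef by simp
  next
    assume "\<not> e" f
    then show ?thesis using eq mod_pred_Suc[OF kl(2)] by (simp add: dihedral_pos_def)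
  qed (use eq in \<open>auto simp: dihedral_pos_def\<close>)
next
  assume "h = g \<or> h = g \<otimes>\<^bsub>dihedral n\<^esub> (Suc 0, True)"
  then show "dihedral_pos n g = dihedral_pos n h" using dihedral_pos_mult[OF g] by auto
qed

lemma dihedral_map_graph:
  assumes n: "n \<ge> 3" and l: "labels (dihedral n) (Suc 0, True) (0, True) \<beta> D R L"
  shows "mgraph_iso (map_graph D R L) (cycle_graph n)"
proof -
  interpret D: group "dihedral n" using n by (intro group_dihedral) simp
  let ?a = "(Suc 0, True)" and ?z = "(0 :: nat, True)"
  have a: "?a \<in> carrier (dihedral n)" using n by simp
  have aa: "?a \<otimes>\<^bsub>dihedral n\<^esub> ?a = \<one>\<^bsub>dihedral n\<^esub>" by simp
  have apow: "?a [^]\<^bsub>dihedral n\<^esub> k = (if even k then \<one>\<^bsub>dihedral n\<^esub> else ?a)" for k :: nat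
    by (induction k) (use n in \<open>auto simp: mod_less\<close>)
  define F where "F g = (dihedral_pos n g, [] :: nat list)" for g
  \<comment> \<open>The edge {(k, False), (k, True)} joins position k to position k - 1. The cycle
    names an edge by its first vertex, hence k - 1.\<close>
  define E where "E g = ((fst g + n - 1) mod n, [] :: nat list)" for g :: "nat \<times> bool"
  show ?thesis
    unfolding cycle_graph_def
  proof (rule map_graph_iso[OF D.is_group l, of F E])
    show "?z \<otimes>\<^bsub>dihedral n\<^esub> ?z = \<one>\<^bsub>dihedral n\<^esub>" by simp
  next
    fix x y assume xy: "x \<in> carrier (dihedral n)" "y \<in> carrier (dihedral n)"
    have "(\<exists>k::nat. y = x \<otimes>\<^bsub>dihedral n\<^esub> ?a [^]\<^bsub>dihedral n\<^esub> k) \<longleftrightarrow> y = x \<or> y = x \<otimes>\<^bsub>dihedral n\<^esub> ?a"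
    proof
      assume "y = x \<or> y = x \<otimes>\<^bsub>dihedral n\<^esub> ?a"
      then show "\<exists>k::nat. y = x \<otimes>\<^bsub>dihedral n\<^esub> ?a [^]\<^bsub>dihedral n\<^esub> k"
      proof
        assume "y = x"
        then show ?thesis using xy by (intro exI[of _ 0]) (simp del: dihedral_one)
      next
        assume "y = x \<otimes>\<^bsub>dihedral n\<^esub> ?a"
        then show ?thesis using a by (intro exI[of _ 1]) (simp add: D.nat_pow_eone del: dihedral_one)
      qed
    next
      assume "\<exists>k::nat. y = x \<otimes>\<^bsub>dihedral n\<^esub> ?a [^]\<^bsub>dihedral n\<^esub> k"
      then show "y = x \<or> y = x \<otimes>\<^bsub>dihedral n\<^esub> ?a"
        using xy by (auto simp only: apow D.r_one split: if_splits)
    qed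
    then show "F x = F y \<longleftrightarrow> (\<exists>k::nat. y = x \<otimes>\<^bsub>dihedral n\<^esub> ?a [^]\<^bsub>dihedral n\<^esub> k)"
      using dihedral_pos_eq_iff[OF xy] by (simp add: F_def)
  next
    fix x y assume xy: "x \<in> carrier (dihedral n)" "y \<in> carrier (dihedral n)"
    obtain k e l f where [simp]: "x = (k, e)" "y = (l, f)" by (cases x; cases y)
    have kl: "k < n" "l < n" using xy by auto
    have "k = l" if "(k + n - 1) mod n = (l + n - 1) mod n"
      using mod_pred_Suc[OF kl(1)] mod_pred_Suc[OF kl(2)] that by metis
    then have "E x = E y \<longleftrightarrow> k = l" by (auto simp: E_def)
    then show "E x = E y \<longleftrightarrow> y = x \<or> y = x \<otimes>\<^bsub>dihedral n\<^esub> ?z"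
      using kl by (cases e; cases f) auto
  next
    have "F (i, False) = (i, [])" "E (Suc i mod n, False) = (i, [])" if "i < n" for i
      using that by (auto simp: F_def E_def dihedral_pos_def mod_Suc_pred)
    moreover have "(i, False) \<in> carrier (dihedral n)" "(Suc i mod n, False) \<in> carrier (dihedral n)" if "i < n" for i
      using that by auto
    ultimately have "(i, []) \<in> F ` carrier (dihedral n)" "(i, []) \<in> E ` carrier (dihedral n)" if "i < n" for i
      using that by (metis imageI)+
    then have "{(i, []) | i. i < n} \<subseteq> F ` carrier (dihedral n)" "{(i, []) | i. i < n} \<subseteq> E ` carrier (dihedral n)"
      by auto
    moreover have "F ` carrier (dihedral n) \<subseteq> {(i, []) | i. i < n}" "E ` carrier (dihedral n) \<subseteq> {(i, []) | i. i < n}"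
      using n by (auto simp: F_def E_def dihedral_pos_def split: prod.splits if_splits)
    ultimately show "F ` carrier (dihedral n) = {(i, []) | i. i < n}" "E ` carrier (dihedral n) = {(i, []) | i. i < n}"
      by blast+
  next
    fix x assume x: "x \<in> carrier (dihedral n)"
    obtain k e where [simp]: "x = (k, e)" by (cases x)
    have k: "k < n" using x by simp
    show "(case E x of (i, xs) \<Rightarrow> {(i, []), ((i + 1) mod n, [])}) = {F x, F (x \<otimes>\<^bsub>dihedral n\<^esub> ?z)}"
      using mod_pred_Suc[OF k] k by (cases e) (auto simp: E_def F_def dihedral_pos_def)
  qed
qed

lemma card_carrier_vec: "card (carrier_vec n :: 'a::finite vec set) = CARD('a) ^ n"
  and finite_carrier_vec: "finite (carrier_vec n :: 'a::finite vec set)"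
proof -
  let ?L = "{xs :: 'a list. set xs \<subseteq> UNIV \<and> length xs = n}"
  have bij: "bij_betw list_of_vec (carrier_vec n) ?L"
    by (rule bij_betwI[where g=vec_of_list]) (auto simp: vec_list list_vec intro!: carrier_vecI)
  show "card (carrier_vec n :: 'a vec set) = CARD('a) ^ n"
    using bij_betw_same_card[OF bij] card_lists_length_eq[of "UNIV :: 'a set" n] by simp
  show "finite (carrier_vec n :: 'a vec set)"
    using bij_betw_finite[OF bij] finite_lists_length_eq[of "UNIV :: 'a set" n] by simp
qed

context dihedral_irrep
begin

lemma finite_V [simp]: "finite V" by (rule finite_carrier_vec)

lemma finite_G: "finite (carrier G)" by (simp add: finite_dihedral)

lemma card_G: "card (carrier G) = card V * (2 * r)"
  by (simp add: card_cartesian_product card_dihedral)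

section \<open>Praeger--Xu graphs\<close>

text \<open>The span of u, rho^-1 u, ..., rho^-(n-1) u, built one vector at a time so that
  independence can be read off from cardinalities. The exponents are negative to match the
  coordinates f(rho^-j w) of the Praeger-Xu graph.\<close>

primrec flag :: "'p mod_ring vec \<Rightarrow> nat \<Rightarrow> 'p mod_ring vec set" where
  "flag u 0 = {0\<^sub>v d}"
| "flag u (Suc n) = {w + c \<cdot>\<^sub>v rot (- int n) u | w c. w \<in> flag u n}"

lemma flag_subset: "u \<in> V \<Longrightarrow> flag u n \<subseteq> V"
  by (induction n) auto

lemma flag_add: "u \<in> V \<Longrightarrow> v \<in> flag u n \<Longrightarrow> w \<in> flag u n \<Longrightarrow> v + w \<in> flag u n"
proof (induction n arbitrary: v w)
  case (Suc n)
  obtain v' c w' c' where *: "v = v' + c \<cdot>\<^sub>v rot (- int n) u" "v' \<in> flag u n"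
    "w = w' + c' \<cdot>\<^sub>v rot (- int n) u" "w' \<in> flag u n"
    using Suc.prems by auto
  have V: "v' \<in> V" "w' \<in> V" using * flag_subset[OF Suc.prems(1)] by auto
  have "v + w = (v' + w') + (c + c') \<cdot>\<^sub>v rot (- int n) u"
    using V Suc.prems(1) by (intro eq_vecI) (auto simp: * algebra_simps)
  then show ?case using Suc.IH[OF Suc.prems(1) *(2,4)] by auto
qed auto

lemma flag_Suc_mono: "u \<in> V \<Longrightarrow> flag u n \<subseteq> flag u (Suc n)"
proof
  fix w assume u: "u \<in> V" and w: "w \<in> flag u n"
  have "w = w + 0 \<cdot>\<^sub>v rot (- int n) u"
    using u w flag_subset[OF u, of n] by (intro eq_vecI) auto
  then show "w \<in> flag u (Suc n)" using w by auto
qed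

lemma flag_mono: "u \<in> V \<Longrightarrow> m \<le> n \<Longrightarrow> flag u m \<subseteq> flag u n"
  by (rule lift_Suc_mono_le[of "flag u", OF flag_Suc_mono])

lemma zero_in_flag: "u \<in> V \<Longrightarrow> 0\<^sub>v d \<in> flag u n"
  using flag_mono[of u 0 n] by auto

lemma rot_in_flag: "u \<in> V \<Longrightarrow> rot (- int n) u \<in> flag u (Suc n)"
proof -
  assume u: "u \<in> V"
  have "rot (- int n) u = 0\<^sub>v d + 1 \<cdot>\<^sub>v rot (- int n) u" using u by (intro eq_vecI) auto
  then show ?thesis unfolding flag.simps using zero_in_flag[OF u, of n] by blast
qed

lemma flag_smult: "u \<in> V \<Longrightarrow> v \<in> flag u n \<Longrightarrow> c \<cdot>\<^sub>v v \<in> flag u n"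
  by (rule add_closed_imp_smult_closed[of _ d]) (auto intro: flag_add zero_in_flag dest: flag_subset)

lemma flag_diff: "u \<in> V \<Longrightarrow> v \<in> flag u n \<Longrightarrow> w \<in> flag u n \<Longrightarrow> v - w \<in> flag u n"
  by (rule add_closed_imp_diff_closed[of _ d]) (auto intro: flag_add zero_in_flag dest: flag_subset)

lemma rot_flag: "u \<in> V \<Longrightarrow> w \<in> flag u n \<Longrightarrow> rot (- int m) w \<in> flag u (n + m)"
proof (induction n arbitrary: w)
  case 0
  then show ?case using zero_in_flag by simp
next
  case (Suc n)
  obtain w' c where *: "w = w' + c \<cdot>\<^sub>v rot (- int n) u" "w' \<in> flag u n" using Suc.prems by auto
  have w': "w' \<in> V" using * flag_subset[OF Suc.prems(1)] by auto
  have "rot (- int m) w = rot (- int m) w' + c \<cdot>\<^sub>v rot (- int (n + m)) u"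
    using Suc.prems(1) w' by (simp add: * rot_dist rot_rot add.commute)
  then show ?case using Suc.IH[OF Suc.prems(1) *(2)] by auto
qed

text \<open>If the next vector adds nothing, the span is closed under rho^-1, hence under all powers
  of rho as rho has finite order. It is closed under \<open>A\<close> because A rho^-i u = rho^i u.
  So it is a nonzero subrepresentation.\<close>

lemma flag_eq_V:
  assumes u: "u \<in> V" "u \<noteq> 0\<^sub>v d" "A u = u" and n: "rot (- int n) u \<in> flag u n"
  shows "flag u n = V"
proof -
  have n0: "n > 0" using n u by (cases n) auto
  have eq: "flag u (Suc n) = flag u n"
  proof
    show "flag u (Suc n) \<subseteq> flag u n"
      using n u(1) by (auto intro!: flag_add flag_smult)
  qed (rule flag_Suc_mono[OF u(1)])
  have step: "rot (-1) w \<in> flag u n" if "w \<in> flag u n" for w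
    using rot_flag[OF u(1) that, of 1] eq by (simp del: flag.simps)
  have neg: "rot (- int m) w \<in> flag u n" if "w \<in> flag u n" for m w
  proof (induction m)
    case 0
    have "w \<in> V" using that flag_subset[OF u(1)] by auto
    then show ?case using that by simp
  next
    case (Suc m)
    have "w \<in> V" using that flag_subset[OF u(1)] by auto
    then have "rot (-1) (rot (- int m) w) = rot (- int (Suc m)) w" by (simp add: rot_rot algebra_simps)
    then show ?case using step[OF Suc] by simp
  qed
  have rot: "rot i w \<in> flag u n" if "w \<in> flag u n" for i w
  proof -
    \<comment> \<open>Modulo r every exponent is minus a natural number, and those were treated just
      above.\<close>
    have "rot i w = rot (- int (nat ((- i) mod int r))) w"
      unfolding rot_def by (simp add: mod_minus_eq)
    then show ?thesis using neg[OF that, of "nat ((- i) mod int r)"] by (simp only:)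
  qed
  have u_in: "u \<in> flag u n"
    using rot_in_flag[OF u(1), of 0] flag_mono[OF u(1), of 1 n] n0 u by auto
  have A: "A w \<in> flag u n" if "w \<in> flag u m" "m \<le> n" for w m
    using that
  proof (induction m arbitrary: w)
    case 0
    then show ?case using zero_in_flag[OF u(1)] by simp
  next
    case (Suc m)
    obtain w' c where *: "w = w' + c \<cdot>\<^sub>v rot (- int m) u" "w' \<in> flag u m" using Suc.prems by auto
    have w': "w' \<in> V" using * flag_subset[OF u(1)] by auto
    have "A w = A w' + c \<cdot>\<^sub>v rot (int m) u"
      using w' u by (simp add: * act_add act_smult A_rot)
    then show ?case using Suc * u(1) rot[OF u_in] by (auto intro!: flag_add flag_smult)
  qed
  have "flag u n = {0\<^sub>v d} \<or> flag u n = V"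
  proof (rule invariant_subspace_cases)
    fix v assume v: "v \<in> flag u n"
    show "A v \<in> flag u n" using A[OF v] by simp
    then have "rot (-1) (A v) \<in> flag u n" by (rule rot)
    moreover have "v \<in> V" using v flag_subset[OF u(1)] by auto
    ultimately show "Z v \<in> flag u n" by (simp add: Z_eq)
  qed (use u flag_subset flag_add zero_in_flag in auto)
  then show ?thesis using u_in u by auto
qed

lemma flag_cancel:
  assumes u: "u \<in> V" and n: "rot (- int n) u \<notin> flag u n" and w: "w \<in> flag u n" "w' \<in> flag u n"
    and eq: "w + c \<cdot>\<^sub>v rot (- int n) u = w' + c' \<cdot>\<^sub>v rot (- int n) u"
  shows "w = w' \<and> c = c'"
proof -
  let ?b = "rot (- int n) u"
  have V: "w \<in> V" "w' \<in> V" "?b \<in> V" using w flag_subset[OF u] u by auto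
  have ix: "w $ i + c * ?b $ i = w' $ i + c' * ?b $ i" if "i < d" for i
    using arg_cong[OF eq, of "\<lambda>v. v $ i"] that V by simp
  have c: "c = c'"
  proof (rule ccontr)
    assume ne: "c \<noteq> c'"
    have "?b = (1 / (c - c')) \<cdot>\<^sub>v (w' - w)"
    proof (rule eq_vecI)
      fix i assume "i < dim_vec ((1 / (c - c')) \<cdot>\<^sub>v (w' - w))"
      then have i: "i < d" using V by simp
      have "(c - c') * ?b $ i = w' $ i - w $ i" using ix[OF i] by (simp add: algebra_simps)
      then show "?b $ i = ((1 / (c - c')) \<cdot>\<^sub>v (w' - w)) $ i"
        using i V ne by (simp add: nonzero_eq_divide_eq mult.commute)
    qed (use V in auto)
    moreover have "(1 / (c - c')) \<cdot>\<^sub>v (w' - w) \<in> flag u n" using w u by (intro flag_smult flag_diff)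
    ultimately show False using n by simp
  qed
  moreover have "w = w'" using ix c V by (intro eq_vecI) auto
  ultimately show ?thesis by simp
qed

lemma card_flag_Suc:
  assumes u: "u \<in> V" and n: "rot (- int n) u \<notin> flag u n"
  shows "card (flag u (Suc n)) = card (flag u n) * CARD('p)"
proof -
  let ?h = "\<lambda>(w, c :: 'p mod_ring). w + c \<cdot>\<^sub>v rot (- int n) u"
  have "flag u (Suc n) = ?h ` (flag u n \<times> UNIV)" by auto
  moreover have "inj_on ?h (flag u n \<times> UNIV)"
    using flag_cancel[OF u n] by (auto simp: inj_on_def)
  ultimately have "card (flag u (Suc n)) = card (flag u n \<times> (UNIV :: 'p mod_ring set))"
    by (simp add: card_image)
  then show ?thesis by (simp add: card_cartesian_product)
qed

text \<open>While the vectors remain independent the flag has p^n elements, which cannot continue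
  inside the finite V. The first index that adds nothing is s + 1 = dim V, and s becomes the
  parameter of the Praeger-Xu graph.\<close>

lemma exists_flag_length:
  assumes u: "u \<in> V" "u \<noteq> 0\<^sub>v d" "A u = u"
  obtains s where "flag u (Suc s) = V" "rot (- int s) u \<notin> flag u s" "card V = CARD('p) ^ Suc s"
proof -
  have p2: "CARD('p) \<ge> 2" using prime_card[where 'a='p] prime_ge_2_nat by blast
  have card: "card (flag u n) = CARD('p) ^ n" if "\<forall>m<n. rot (- int m) u \<notin> flag u m" for n
    using that
  proof (induction n)
    case (Suc n)
    then show ?case using card_flag_Suc[OF u(1), of n] by simp
  qed simp
  have ex: "\<exists>n. rot (- int n) u \<in> flag u n"
  proof (rule ccontr)
    assume "\<not> ?thesis"
    then have "card (flag u n) = CARD('p) ^ n" for n by (intro card) auto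
    moreover have "card (flag u n) \<le> card V" for n by (intro card_mono flag_subset u finite_V)
    ultimately have "CARD('p) ^ card V \<le> card V" by metis
    moreover have "card V < 2 ^ card V" by (rule less_exp)
    moreover have "(2::nat) ^ card V \<le> CARD('p) ^ card V" using p2 by (rule power_mono) simp
    ultimately show False by linarith
  qed
  define n where "n = (LEAST n. rot (- int n) u \<in> flag u n)"
  have n: "rot (- int n) u \<in> flag u n" unfolding n_def using ex by (rule LeastI_ex)
  have less: "rot (- int m) u \<notin> flag u m" if "m < n" for m using that not_less_Least n_def by blast
  have "n \<noteq> 0" using n u by (cases n) auto
  then obtain s where s: "n = Suc s" by (cases n) auto
  have "flag u n = V" by (rule flag_eq_V[OF u n])
  then show ?thesis using that[of s] less[of s] card[of n] less s by simp
qed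

end

definition mod_ring_to_nat :: "'p::prime_card mod_ring \<Rightarrow> nat" where
  "mod_ring_to_nat c = nat (to_int_mod_ring c)"

lemma mod_ring_to_nat_less: "mod_ring_to_nat (c :: 'p::prime_card mod_ring) < CARD('p)"
  and mod_ring_to_nat_eq_iff: "mod_ring_to_nat c = mod_ring_to_nat c' \<longleftrightarrow> c = c'"
proof -
  have r: "to_int_mod_ring c \<in> {0..<int CARD('p)}" for c :: "'p mod_ring"
    using range_to_int_mod_ring[where 'a='p] by blast
  then show "mod_ring_to_nat c < CARD('p)" unfolding mod_ring_to_nat_def
    using r[of c] by (simp add: nat_less_iff)
  show "mod_ring_to_nat c = mod_ring_to_nat c' \<longleftrightarrow> c = c'"
  proof
    assume "mod_ring_to_nat c = mod_ring_to_nat c'"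
    then have "to_int_mod_ring c = to_int_mod_ring c'"
      using r[of c] r[of c'] by (simp add: mod_ring_to_nat_def eq_nat_nat_iff)
    then show "c = c'" by (metis of_int_mod_ring_to_int_mod_ring)
  qed simp
qed

context dihedral_irrep
begin

text \<open>The form f reads off the coefficient of the last basis vector rho^-s u, so its kernel is
  the span of the other s vectors.\<close>

lemma flag_functional:
  assumes u: "u \<in> V" and s: "flag u (Suc s) = V" "rot (- int s) u \<notin> flag u s"
  obtains f :: "'p mod_ring vec \<Rightarrow> 'p mod_ring"
  where "\<And>v w. v \<in> V \<Longrightarrow> w \<in> V \<Longrightarrow> f (v + w) = f v + f w"
    "\<And>v w. v \<in> V \<Longrightarrow> w \<in> V \<Longrightarrow> f (v - w) = f v - f w"
    "\<And>w. w \<in> flag u s \<Longrightarrow> f w = 0"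
    "\<And>v. v \<in> V \<Longrightarrow> f v = 0 \<Longrightarrow> v \<in> flag u s"
    "\<And>w c. w \<in> flag u s \<Longrightarrow> f (w + c \<cdot>\<^sub>v rot (- int s) u) = c"
proof -
  let ?b = "rot (- int s) u"
  define f where "f v = (THE c. \<exists>w\<in>flag u s. v = w + c \<cdot>\<^sub>v ?b)" for v
  have f: "f (w + c \<cdot>\<^sub>v ?b) = c" if "w \<in> flag u s" for w c
    unfolding f_def using flag_cancel[OF u s(2)] that by (intro the_equality) auto
  have dec: "\<exists>w c. w \<in> flag u s \<and> v = w + c \<cdot>\<^sub>v ?b" if v: "v \<in> V" for v
  proof -
    have "v \<in> flag u (Suc s)" using v s(1) by simp
    then show ?thesis by auto
  qed
  have FV: "w \<in> V" if "w \<in> flag u s" for w using that flag_subset[OF u] by auto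
  have z: "w + 0 \<cdot>\<^sub>v ?b = w" if "w \<in> V" for w using that u by (intro eq_vecI) auto
  have "f (v + w) = f v + f w" if vw: "v \<in> V" "w \<in> V" for v w
  proof -
    obtain v' c w' e where *: "v' \<in> flag u s" "v = v' + c \<cdot>\<^sub>v ?b" "w' \<in> flag u s" "w = w' + e \<cdot>\<^sub>v ?b"
      using dec[OF vw(1)] dec[OF vw(2)] by blast
    have "v + w = (v' + w') + (c + e) \<cdot>\<^sub>v ?b"
      using *(2,4) FV[OF *(1)] FV[OF *(3)] u by (intro eq_vecI) (auto simp: algebra_simps)
    then show ?thesis using * f flag_add[OF u *(1,3)] by simp
  qed
  moreover have "f (v - w) = f v - f w" if vw: "v \<in> V" "w \<in> V" for v w
  proof -
    obtain v' c w' e where *: "v' \<in> flag u s" "v = v' + c \<cdot>\<^sub>v ?b" "w' \<in> flag u s" "w = w' + e \<cdot>\<^sub>v ?b"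
      using dec[OF vw(1)] dec[OF vw(2)] by blast
    have "v - w = (v' - w') + (c - e) \<cdot>\<^sub>v ?b"
      using *(2,4) FV[OF *(1)] FV[OF *(3)] u by (intro eq_vecI) (auto simp: algebra_simps)
    then show ?thesis using * f flag_diff[OF u *(1,3)] by simp
  qed
  moreover have "f w = 0" if "w \<in> flag u s" for w using f[OF that, of 0] z[OF FV[OF that]] by simp
  moreover have "v \<in> flag u s" if v: "v \<in> V" "f v = 0" for v
  proof -
    obtain w c where *: "w \<in> flag u s" "v = w + c \<cdot>\<^sub>v ?b" using dec[OF v(1)] by blast
    then have "c = 0" using f v(2) by simp
    then show ?thesis using * z FV by simp
  qed
  ultimately show ?thesis using that f by blast
qed

text \<open>Let i be the position of g. Since tau'' fixes u, right multiplication of (w, g) by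
  powers of a changes w by multiples of rho^i u and keeps i, so a vertex is i together with w modulo
  rho^i u. The s coordinates f(rho^-(i+j) w) with j < s see exactly this class, because f kills
  rho^-j u for j < s. An edge remembers all of w, by s + 1 coordinates; its two ends forget the last
  or the first.\<close>

lemma PX_map_graph:
  assumes u: "u \<in> V" "u \<noteq> 0\<^sub>v d" "A u = u"
    and l: "labels G (u, (Suc 0, True)) (0\<^sub>v d, (0, True)) \<beta> D R L"
  shows "\<exists>s. mgraph_iso (map_graph D R L) (PX_graph CARD('p) r s)"
proof -
  obtain s where s: "flag u (Suc s) = V" "rot (- int s) u \<notin> flag u s" "card V = CARD('p) ^ Suc s"
    by (rule exists_flag_length[OF u])
  obtain f where f: "\<And>v w. v \<in> V \<Longrightarrow> w \<in> V \<Longrightarrow> f (v + w) = f v + f w"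
    "\<And>v w. v \<in> V \<Longrightarrow> w \<in> V \<Longrightarrow> f (v - w) = f v - f w"
    "\<And>w. w \<in> flag u s \<Longrightarrow> f w = 0"
    "\<And>v. v \<in> V \<Longrightarrow> f v = 0 \<Longrightarrow> v \<in> flag u s"
    "\<And>w c. w \<in> flag u s \<Longrightarrow> f (w + c \<cdot>\<^sub>v rot (- int s) u) = c"
    using flag_functional[OF u(1) s(1,2)] by blast
  \<comment> \<open>Each vanishing coordinate lowers the flag by one step: for v in
    \<open>flag u (Suc k)\<close> the coefficient of rho^-k u is f(rho^-(s-k) v). With m = s this
    yields v = 0, and with m = s - 1 a multiple of u.\<close>
  have kernel: "v \<in> flag u (s - m)" if "v \<in> V" "m \<le> s" "\<forall>j\<le>m. f (rot (- int j) v) = 0" for v m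
    using that(2,3)
  proof (induction m)
    case 0
    then show ?case using f(4)[OF that(1)] that(1) by simp
  next
    case (Suc m)
    define k where "k = s - Suc m"
    have k: "s - m = Suc k" "s = k + Suc m" using Suc.prems by (auto simp: k_def)
    have "v \<in> flag u (Suc k)" using Suc k by simp
    then obtain w c where w: "w \<in> flag u k" "v = w + c \<cdot>\<^sub>v rot (- int k) u" by auto
    have wV: "w \<in> V" using w flag_subset[OF u(1)] by auto
    have "rot (- int (Suc m)) v = rot (- int (Suc m)) w + c \<cdot>\<^sub>v rot (- int s) u"
      using wV u by (simp add: w rot_dist rot_rot k(2) algebra_simps)
    moreover have "rot (- int (Suc m)) w \<in> flag u s"
      using rot_flag[OF u(1) w(1), of "Suc m"] unfolding k(2)[symmetric] .
    moreover have "f (rot (- int (Suc m)) v) = 0" using Suc.prems by blast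
    ultimately have "c = 0" using f(5) by metis
    then have "v = w" using w wV u by (intro eq_vecI) auto
    then show ?case using w k by simp
  qed
  define \<pi> where "\<pi> = (\<lambda>g :: nat \<times> bool. dihedral_pos r g)"
  \<comment> \<open>A window of n consecutive coordinates starting at i. Vertices use a window of
    length s at their position, edges one of length s + 1 at their first end.\<close>
  define co where "co i n w = map (\<lambda>j. mod_ring_to_nat (f (rot (- (int i + int j)) w))) [0..<n]" for i n w
  have co_eq: "co i n w = co i n w' \<longleftrightarrow> (\<forall>j<n. f (rot (- int j) (rot (- int i) (w' - w))) = 0)"
    if "w \<in> V" "w' \<in> V" for i n w w'
  proof -
    have "co i n w = co i n w' \<longleftrightarrow> (\<forall>j<n. f (rot (- (int i + int j)) w) = f (rot (- (int i + int j)) w'))"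
      by (auto simp: co_def mod_ring_to_nat_eq_iff)
    moreover have "f (rot (- int j) (rot (- int i) (w' - w))) =
        f (rot (- (int i + int j)) w') - f (rot (- (int i + int j)) w)" for j
      using that by (simp add: rot_rot rot_dist f(2) add.commute)
    ultimately show ?thesis by auto
  qed
  define F where "F = (\<lambda>(w, g). (\<pi> g, co (\<pi> g) s w))"
  define E where "E = (\<lambda>(w, g :: nat \<times> bool). ((fst g + r - 1) mod r, co ((fst g + r - 1) mod r) (Suc s) w))"
  let ?a = "(u, (Suc 0, True))" and ?z = "(0\<^sub>v d :: 'p mod_ring vec, (0 :: nat, True))"
  let ?\<tau> = "(Suc 0, True)"
  \<comment> \<open>As tau'' fixes u, the vector g u depends only on the coset of g modulo tau'',
    that is on its position.\<close>
  have \<pi>_act: "\<psi> g *\<^sub>v u = rot (int (\<pi> g)) u" if g: "g \<in> carrier (dihedral r)" for g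
  proof -
    obtain k e where ke: "g = (k, e)" by (cases g)
    have k: "k < r" using g ke by simp
    have Zu: "Z u = rot (-1) u" using Z_eq[OF u(1)] u(3) by simp
    show ?thesis
    proof (cases e)
      case True
      have "int ((k + r - 1) mod r) = (int k - 1 + int r) mod int r"
        using of_nat_diff[of 1 "k + r"] k by (simp add: zmod_int algebra_simps)
      then have "rot (int (\<pi> g)) u = rot (int k - 1) u"
        using True by (simp add: ke \<pi>_def dihedral_pos_def rot_mod)
      then show ?thesis using True k u by (simp add: ke act_True Zu rot_rot)
    next
      case False
      then show ?thesis using k by (simp add: ke \<pi>_def dihedral_pos_def rot_int)
    qed
  qed
  have \<pi>_mult: "\<pi> (g \<otimes>\<^bsub>dihedral r\<^esub> ?\<tau>) = \<pi> g" if "g \<in> carrier (dihedral r)" for g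
    unfolding \<pi>_def using that by (rule dihedral_pos_mult)
  have \<tau>: "?\<tau> \<in> carrier (dihedral r)" by simp
  have apow: "(w, g) \<otimes>\<^bsub>G\<^esub> ?a [^]\<^bsub>G\<^esub> n =
      (w + of_nat n \<cdot>\<^sub>v rot (int (\<pi> g)) u, if even n then g else g \<otimes>\<^bsub>dihedral r\<^esub> ?\<tau>)"
    if wg: "w \<in> V" "g \<in> carrier (dihedral r)" for w g n
  proof (induction n)
    case 0
    have "w + 0 \<cdot>\<^sub>v rot (int (\<pi> g)) u = w" using wg u by (intro eq_vecI) auto
    then show ?case using wg G.r_one[of "(w, g)"] by simp
  next
    case (Suc n)
    let ?h = "if even n then g else g \<otimes>\<^bsub>dihedral r\<^esub> ?\<tau>"
    have a: "?a \<in> carrier G" "(w, g) \<in> carrier G" using u wg by auto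
    have h: "?h \<in> carrier (dihedral r)" using wg D.m_closed[OF wg(2) \<tau>] by simp
    have \<pi>h: "\<pi> ?h = \<pi> g" using \<pi>_mult wg by simp
    have "(w, g) \<otimes>\<^bsub>G\<^esub> ?a [^]\<^bsub>G\<^esub> Suc n = (w, g) \<otimes>\<^bsub>G\<^esub> ?a [^]\<^bsub>G\<^esub> n \<otimes>\<^bsub>G\<^esub> ?a"
      using a by (simp add: G.m_assoc del: semidirect_mult semidirect_carrier)
    also have "\<dots> = (w + of_nat n \<cdot>\<^sub>v rot (int (\<pi> g)) u, ?h) \<otimes>\<^bsub>G\<^esub> ?a" by (simp only: Suc)
    also have "\<dots> = (w + of_nat n \<cdot>\<^sub>v rot (int (\<pi> g)) u + rot (int (\<pi> g)) u, ?h \<otimes>\<^bsub>dihedral r\<^esub> ?\<tau>)"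
      unfolding semidirect_mult \<pi>_act[OF h] \<pi>h ..
    also have "w + of_nat n \<cdot>\<^sub>v rot (int (\<pi> g)) u + rot (int (\<pi> g)) u = w + of_nat (Suc n) \<cdot>\<^sub>v rot (int (\<pi> g)) u"
      using wg u by (intro eq_vecI) (auto simp: algebra_simps)
    also have "?h \<otimes>\<^bsub>dihedral r\<^esub> ?\<tau> = (if even (Suc n) then g else g \<otimes>\<^bsub>dihedral r\<^esub> ?\<tau>)"
    proof (cases "even n")
      case False
      have "g \<otimes>\<^bsub>dihedral r\<^esub> ?\<tau> \<otimes>\<^bsub>dihedral r\<^esub> ?\<tau> = g \<otimes>\<^bsub>dihedral r\<^esub> \<one>\<^bsub>dihedral r\<^esub>"
        using wg \<tau> by (simp add: D.m_assoc del: dihedral_mult) simp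
      then show ?thesis using False wg by (simp del: dihedral_mult dihedral_one)
    qed simp
    finally show ?case .
  qed
  have rot0: "rot (- int i) (rot (int i) v) = v" if "v \<in> V" for i v using that by (simp add: rot_rot)
  have F_iff: "F x = F y \<longleftrightarrow> (\<exists>n::nat. y = x \<otimes>\<^bsub>G\<^esub> ?a [^]\<^bsub>G\<^esub> n)"
    if xy: "x \<in> carrier G" "y \<in> carrier G" for x y
  proof -
    obtain w g where x: "x = (w, g)" "w \<in> V" "g \<in> carrier (dihedral r)" using xy by auto
    obtain w' h where y: "y = (w', h)" "w' \<in> V" "h \<in> carrier (dihedral r)" using xy by auto
    show ?thesis
    proof
      assume eq: "F x = F y"
      then have \<pi>: "\<pi> g = \<pi> h" by (simp add: F_def x y)
      let ?t = "rot (- int (\<pi> g)) (w' - w)"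
      have tV: "?t \<in> V" using x y by simp
      have "co (\<pi> g) s w = co (\<pi> g) s w'" using eq \<pi> by (simp add: F_def x y)
      then have 0: "\<forall>j<s. f (rot (- int j) ?t) = 0" using co_eq[OF x(2) y(2)] by blast
      have "?t \<in> flag u (Suc 0)"
      \<comment> \<open>For s = 0 a vertex has no coordinates, but then V is already the line
        spanned by u.\<close>
      proof (cases s)
        case 0
        then show ?thesis using s(1) tV by simp
      next
        case (Suc s')
        then show ?thesis using kernel[OF tV, of s'] 0 by simp
      qed
      then obtain c where "?t = 0\<^sub>v d + c \<cdot>\<^sub>v rot 0 u" by auto
      then have c: "?t = c \<cdot>\<^sub>v u" using u by simp
      have "w' - w = rot (int (\<pi> g)) ?t" using x y by (simp add: rot_rot)
      also have "\<dots> = c \<cdot>\<^sub>v rot (int (\<pi> g)) u" unfolding c using u by (simp add: rot_dist)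
      finally have diff: "w' - w = c \<cdot>\<^sub>v rot (int (\<pi> g)) u" .
      have "w' = w + (w' - w)" using x y by (intro eq_vecI) auto
      then have w': "w' = w + c \<cdot>\<^sub>v rot (int (\<pi> g)) u" by (simp only: diff)
      obtain n where n: "c = of_nat n" using surj_of_nat_mod_ring[of c] by blast
      have h: "h = g \<or> h = g \<otimes>\<^bsub>dihedral r\<^esub> ?\<tau>"
        using dihedral_pos_eq_iff[OF x(3) y(3)] \<pi> by (simp add: \<pi>_def)
      \<comment> \<open>The parity of the exponent of a decides the part in D, its residue mod p the
        part in V. As p is odd, adding p changes the first and keeps the second.\<close>
      have par: "\<exists>m. of_nat m = c \<and> even m = b" for b
        using n p_odd by (cases "even n = b") (auto intro: exI[of _ n] exI[of _ "n + CARD('p)"])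
      show "\<exists>n::nat. y = x \<otimes>\<^bsub>G\<^esub> ?a [^]\<^bsub>G\<^esub> n"
        using h
      proof
        assume "h = g"
        moreover obtain m where "of_nat m = c" "even m" using par[of True] by blast
        ultimately show ?thesis using apow[OF x(2,3), of m] by (intro exI[of _ m]) (simp add: x(1) y(1) w')
      next
        assume "h = g \<otimes>\<^bsub>dihedral r\<^esub> ?\<tau>"
        moreover obtain m where "of_nat m = c" "odd m" using par[of False] by blast
        ultimately show ?thesis using apow[OF x(2,3), of m]
          by (intro exI[of _ m]) (simp add: x(1) y(1) w' del: dihedral_mult)
      qed
    next
      assume "\<exists>n::nat. y = x \<otimes>\<^bsub>G\<^esub> ?a [^]\<^bsub>G\<^esub> n"
      then obtain n :: nat where "y = x \<otimes>\<^bsub>G\<^esub> ?a [^]\<^bsub>G\<^esub> n" by blast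
      then have w': "w' = w + of_nat n \<cdot>\<^sub>v rot (int (\<pi> g)) u"
        and h: "h = (if even n then g else g \<otimes>\<^bsub>dihedral r\<^esub> ?\<tau>)"
        using apow[OF x(2,3), of n] by (simp_all add: x(1) y(1) del: dihedral_mult)
      have \<pi>: "\<pi> h = \<pi> g" using h \<pi>_mult[OF x(3)] by simp
      have "w' - w = of_nat n \<cdot>\<^sub>v rot (int (\<pi> g)) u" unfolding w' using x u by (intro eq_vecI) auto
      then have t: "rot (- int (\<pi> g)) (w' - w) = of_nat n \<cdot>\<^sub>v u" using u by (simp add: rot_dist rot0)
      have "f (rot (- int j) (of_nat n \<cdot>\<^sub>v u)) = 0" if "j < s" for j
      proof -
        have "rot (- int j) u \<in> flag u s" using rot_in_flag[OF u(1), of j] flag_mono[OF u(1), of "Suc j" s] that by auto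
        then have "of_nat n \<cdot>\<^sub>v rot (- int j) u \<in> flag u s" by (rule flag_smult[OF u(1)])
        then show ?thesis using f(3) u by (simp add: rot_dist)
      qed
      then have "co (\<pi> g) s w = co (\<pi> g) s w'" using co_eq[OF x(2) y(2)] t by simp
      then show "F x = F y" using \<pi> by (simp add: F_def x(1) y(1))
    qed
  qed
  have xz: "(w, (k, e)) \<otimes>\<^bsub>G\<^esub> ?z = (w, (k, \<not> e))" if "w \<in> V" "k < r" for w k e
    using that by (cases e) auto
  have E_iff: "E x = E y \<longleftrightarrow> y = x \<or> y = x \<otimes>\<^bsub>G\<^esub> ?z"
    if xy: "x \<in> carrier G" "y \<in> carrier G" for x y
  proof -
    obtain w k e where x: "x = (w, (k, e))" "w \<in> V" "k < r" using xy by (cases x) auto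
    obtain w' k' e' where y: "y = (w', (k', e'))" "w' \<in> V" "k' < r" using xy by (cases y) auto
    have "E x = E y \<longleftrightarrow> k = k' \<and> w = w'"
    proof
      assume eq: "E x = E y"
      let ?i = "(k + r - 1) mod r"
      have i: "?i = (k' + r - 1) mod r" and co: "co ?i (Suc s) w = co ?i (Suc s) w'"
        using eq by (auto simp: E_def x y)
      have k: "k = k'" using mod_pred_Suc[OF x(3)] mod_pred_Suc[OF y(3)] i by metis
      let ?t = "rot (- int ?i) (w' - w)"
      have tV: "?t \<in> V" using x y by simp
      have "\<forall>j<Suc s. f (rot (- int j) ?t) = 0" using co co_eq[OF x(2) y(2)] by blast
      then have "?t \<in> flag u (s - s)" by (intro kernel tV) auto
      then have "?t = 0\<^sub>v d" by simp
      moreover have "w' - w = rot (int ?i) ?t" using x y by (simp add: rot_rot)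
      ultimately have diff: "w' - w = 0\<^sub>v d" by simp
      have "w' = w + (w' - w)" using x y by (intro eq_vecI) auto
      then have "w' = w" using x by (simp add: diff)
      then show "k = k' \<and> w = w'" using k by simp
    qed (simp add: E_def x y)
    then show ?thesis unfolding x(1) y(1) xz[OF x(2,3)] by auto
  qed
  have ends: "(case E x of (i, xs) \<Rightarrow> {(i, butlast xs), ((i + 1) mod r, tl xs)}) = {F x, F (x \<otimes>\<^bsub>G\<^esub> ?z)}"
    if xG: "x \<in> carrier G" for x
  proof -
    obtain w k e where x: "x = (w, (k, e))" "w \<in> V" "k < r" using xG by (cases x) auto
    let ?i = "(k + r - 1) mod r"
    have ik: "(?i + 1) mod r = k" by (rule mod_pred_Suc[OF x(3)])
    have "butlast (co ?i (Suc s) w) = co ?i s w" by (simp add: co_def)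
    moreover have "tl (co ?i (Suc s) w) = co k s w"
    proof -
      \<comment> \<open>The edge window starts at k - 1 mod r, so dropping its first entry starts it
        at k. The wrap-around at k = 0 is absorbed by rho^r = 1.\<close>
      have "rot (- (int ?i + int (Suc j))) w = rot (- (int k + int j)) w" for j
      proof -
        have "(- (int ?i + int (Suc j))) mod int r = (- (int k + int j)) mod int r"
        proof -
          have "(int ?i + 1) mod int r = int k" using ik by (metis of_nat_1 of_nat_add zmod_int)
          then have "(- (int k + int j)) mod int r = (- ((int ?i + 1) mod int r + int j)) mod int r" by simp
          also have "\<dots> = (- (int ?i + int (Suc j))) mod int r"
            by (metis (no_types, opaque_lifting) ab_semigroup_add_class.add_ac(1) mod_add_left_eq mod_minus_cong of_nat_Suc add.commute)
          finally show ?thesis by simp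
        qed
        then show ?thesis by (simp add: rot_def)
      qed
      moreover have "tl (co ?i (Suc s) w) = map (\<lambda>j. mod_ring_to_nat (f (rot (- (int ?i + int (Suc j))) w))) [0..<s]"
        unfolding co_def map_tl[symmetric] by (simp add: map_Suc_upt[symmetric] comp_def algebra_simps del: upt_Suc map_Suc_upt)
      ultimately show ?thesis by (simp only: co_def)
    qed
    ultimately have "(case E x of (i, xs) \<Rightarrow> {(i, butlast xs), ((i + 1) mod r, tl xs)}) = {(?i, co ?i s w), (k, co k s w)}"
      using ik by (simp add: E_def x(1))
    moreover have "{F x, F (x \<otimes>\<^bsub>G\<^esub> ?z)} = {(?i, co ?i s w), (k, co k s w)}"
      unfolding x(1) xz[OF x(2,3)] by (cases e) (auto simp: F_def \<pi>_def dihedral_pos_def)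
    ultimately show ?thesis by simp
  qed
  let ?E' = "{(i, xs). i < r \<and> length xs = Suc s \<and> (\<forall>x\<in>set xs. x < CARD('p))}"
  let ?V' = "{(i, xs). i < r \<and> length xs = s \<and> (\<forall>x\<in>set xs. x < CARD('p))}"
  have E': "E ` carrier G = ?E'"
  proof (rule card_subset_eq)
    show "finite ?E'" by (rule finite_bounded_lists)
    show sub: "E ` carrier G \<subseteq> ?E'"
      by (auto simp: E_def co_def mod_ring_to_nat_less)
    \<comment> \<open>One dart from each edge already gives r p^(s+1) distinct labels, as many as
      there are edges in the target; surjectivity follows by counting.\<close>
    have inj: "inj_on (\<lambda>(w, k). E (w, (k, False))) (V \<times> {..<r})"
    proof (rule inj_onI)
      fix x y assume "x \<in> V \<times> {..<r}" "y \<in> V \<times> {..<r}"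
        and "(\<lambda>(w, k). E (w, (k, False))) x = (\<lambda>(w, k). E (w, (k, False))) y"
      then show "x = y"
        using E_iff[of "(fst x, (snd x, False))" "(fst y, (snd y, False))"]
        by (auto simp: xz split: prod.splits)
    qed
    have "card ((\<lambda>(w, k). E (w, (k, False))) ` (V \<times> {..<r})) = r * CARD('p) ^ Suc s"
      using card_image[OF inj] by (simp only: card_cartesian_product s(3) card_lessThan mult.commute)
    moreover have "(\<lambda>(w, k). E (w, (k, False))) ` (V \<times> {..<r}) \<subseteq> E ` carrier G" by auto
    ultimately have "r * CARD('p) ^ Suc s \<le> card (E ` carrier G)"
      by (metis card_mono finite_G finite_imageI)
    moreover have "card (E ` carrier G) \<le> card ?E'" using sub finite_bounded_lists by (rule card_mono[rotated])
    ultimately show "card (E ` carrier G) = card ?E'" by (simp only: card_bounded_lists)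
  qed
  have V': "F ` carrier G = ?V'"
  proof
    show "F ` carrier G \<subseteq> ?V'"
      by (auto simp: F_def co_def mod_ring_to_nat_less \<pi>_def dihedral_pos_def)
    show "?V' \<subseteq> F ` carrier G"
    proof
      fix v assume "v \<in> ?V'"
      then obtain i xs where v: "v = (i, xs)" "i < r" "length xs = s" "\<forall>x\<in>set xs. x < CARD('p)" by auto
      \<comment> \<open>Every vertex is the first end of some edge, here the one with last
        coordinate 0, so surjectivity on vertices is inherited from edges.\<close>
      have "(i, xs @ [0]) \<in> ?E'" using v by auto
      then obtain x where x: "x \<in> carrier G" "E x = (i, xs @ [0])" unfolding E'[symmetric] by auto
      have "v \<in> (case E x of (i, xs) \<Rightarrow> {(i, butlast xs), ((i + 1) mod r, tl xs)})" by (simp add: x v)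
      then have "v \<in> {F x, F (x \<otimes>\<^bsub>G\<^esub> ?z)}" unfolding ends[OF x(1)] .
      moreover have "x \<otimes>\<^bsub>G\<^esub> ?z \<in> carrier G" using x(1) by (intro G.m_closed) auto
      ultimately show "v \<in> F ` carrier G" using x(1) by blast
    qed
  qed
  have "mgraph_iso (map_graph D R L) (PX_graph CARD('p) r s)"
    unfolding PX_graph_def
    by (rule map_graph_iso[OF G.is_group l, of F E]) (use F_iff E_iff E' V' ends in auto)
  then show ?thesis by blast
qed

end

lemma semidirect_iso:
  assumes Q: "bij_betw Q (carrier_vec d) (carrier_vec d)"
    and add: "\<And>v w. v \<in> carrier_vec d \<Longrightarrow> w \<in> carrier_vec d \<Longrightarrow> Q (v + w) = Q v + Q w"
    and comm: "\<And>g v. g \<in> carrier (dihedral r) \<Longrightarrow> v \<in> carrier_vec d \<Longrightarrow> Q (\<psi> g *\<^sub>v v) = \<psi>' g *\<^sub>v Q v"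
    and \<psi>: "\<And>g. g \<in> carrier (dihedral r) \<Longrightarrow> \<psi> g \<in> carrier_mat d d"
  shows "(\<lambda>(v, g). (Q v, g)) \<in> iso (semidirect r d \<psi>) (semidirect r d \<psi>')"
proof (rule isoI)
  show "(\<lambda>(v, g). (Q v, g)) \<in> hom (semidirect r d \<psi>) (semidirect r d \<psi>')"
  proof (rule homI)
    fix x assume "x \<in> carrier (semidirect r d \<psi>)"
    then show "(\<lambda>(v, g). (Q v, g)) x \<in> carrier (semidirect r d \<psi>')"
      using bij_betwE[OF Q] by auto
  next
    fix x y assume xy: "x \<in> carrier (semidirect r d \<psi>)" "y \<in> carrier (semidirect r d \<psi>)"
    obtain v g where x: "x = (v, g)" "v \<in> carrier_vec d" "g \<in> carrier (dihedral r)" using xy by auto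
    obtain w h where y: "y = (w, h)" "w \<in> carrier_vec d" "h \<in> carrier (dihedral r)" using xy by auto
    have "\<psi> g *\<^sub>v w \<in> carrier_vec d" using \<psi>[OF x(3)] y by auto
    then show "(\<lambda>(v, g). (Q v, g)) (x \<otimes>\<^bsub>semidirect r d \<psi>\<^esub> y) =
        (\<lambda>(v, g). (Q v, g)) x \<otimes>\<^bsub>semidirect r d \<psi>'\<^esub> (\<lambda>(v, g). (Q v, g)) y"
      using x y by (simp add: add comm del: dihedral_mult)
  qed
  have "bij_betw (map_prod Q id) (carrier_vec d \<times> carrier (dihedral r)) (carrier_vec d \<times> carrier (dihedral r))"
    by (rule bij_betw_map_prod[OF Q bij_betw_id])
  then show "bij_betw (\<lambda>(v, g). (Q v, g)) (carrier (semidirect r d \<psi>)) (carrier (semidirect r d \<psi>'))"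
    by (simp add: map_prod_def)
qed

section \<open>Cyclic vectors, the cycle case and existence of maps\<close>

context dihedral_irrep
begin

text \<open>Linear combinations of rotates of u, generated summand by summand so that operators can
  be built along the same induction.\<close>

inductive_set rot_span :: "'p mod_ring vec \<Rightarrow> 'p mod_ring vec set" for u where
  zero: "0\<^sub>v d \<in> rot_span u"
| step: "w \<in> rot_span u \<Longrightarrow> w + c \<cdot>\<^sub>v rot i u \<in> rot_span u"

text \<open>An eigenvector of \<open>A\<close> is cyclic for rho: \<open>A\<close> sends rho^i u to
  a multiple of rho^-i u, so the span of the rotates is invariant under D.\<close>

lemma rot_span_eq_V:
  assumes u: "u \<in> V" "u \<noteq> 0\<^sub>v d" "A u = \<epsilon> \<cdot>\<^sub>v u"
  shows "rot_span u = V"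
proof -
  have sub: "w \<in> V" if "w \<in> rot_span u" for w
    using that by induction (use u in auto)
  have add: "v + w \<in> rot_span u" if v: "v \<in> rot_span u" and w: "w \<in> rot_span u" for v w
    using w
  proof induction
    case zero
    then show ?case using v sub by simp
  next
    case (step w c i)
    have "v + (w + c \<cdot>\<^sub>v rot i u) = (v + w) + c \<cdot>\<^sub>v rot i u"
      using sub[OF v] sub[OF step.hyps] u by (simp add: assoc_add_vec[of _ d])
    then show ?case using rot_span.step[OF step.IH] by simp
  qed
  have A: "A w \<in> rot_span u" if "w \<in> rot_span u" for w
    using that
  proof induction
    case zero
    then show ?case by (simp add: rot_span.zero)
  next
    case (step w c i)
    have "A (w + c \<cdot>\<^sub>v rot i u) = A w + (c * \<epsilon>) \<cdot>\<^sub>v rot (- i) u"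
      using sub[OF step.hyps] u by (simp add: act_add act_smult A_rot rot_dist smult_smult_assoc)
    then show ?case using rot_span.step[OF step.IH] by simp
  qed
  have rot: "rot j w \<in> rot_span u" if "w \<in> rot_span u" for w j
    using that
  proof induction
    case zero
    then show ?case by (simp add: rot_span.zero)
  next
    case (step w c i)
    have "rot j (w + c \<cdot>\<^sub>v rot i u) = rot j w + c \<cdot>\<^sub>v rot (j + i) u"
      using sub[OF step.hyps] u by (simp add: rot_dist rot_rot)
    then show ?case using rot_span.step[OF step.IH] by simp
  qed
  have "rot_span u = {0\<^sub>v d} \<or> rot_span u = V"
  proof (rule invariant_subspace_cases)
    fix v assume v: "v \<in> rot_span u"
    show "A v \<in> rot_span u" by (rule A[OF v])
    then have "rot (-1) (A v) \<in> rot_span u" by (rule rot)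
    then show "Z v \<in> rot_span u" using sub[OF v] by (simp add: Z_eq)
  qed (use sub add rot_span.zero in auto)
  moreover have "u \<in> rot_span u"
  proof -
    have "0\<^sub>v d + 1 \<cdot>\<^sub>v rot 0 u = u" using u by (intro eq_vecI) auto
    then show ?thesis using rot_span.step[OF rot_span.zero, of 1 0 u] by simp
  qed
  ultimately show ?thesis using u by blast
qed

text \<open>With rho trivial and u cyclic, V is a line, so the group has order 2pr. Both generators
  are involutions, a because u + A u = 0, and (az)^(pr) is translation by pr u = 0; this is the
  dihedral presentation.\<close>

lemma cycle_map_graph:
  assumes u: "u \<in> V" "u \<noteq> 0\<^sub>v d" "A u = - u" and rot1: "\<forall>v\<in>V. rot 1 v = v"
    and l: "labels G (u, (Suc 0, True)) (0\<^sub>v d, (0, True)) \<beta> D R L"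
  shows "mgraph_iso (map_graph D R L) (cycle_graph (CARD('p) * r))"
proof -
  let ?a = "(u, (Suc 0, True))" and ?z = "(0\<^sub>v d :: 'p mod_ring vec, (0 :: nat, True))"
  have adm: "admissible u" using u rot1 by (simp add: admissible_def)
  have Au: "A u = (-1) \<cdot>\<^sub>v u" using u by (intro eq_vecI) auto
  have rotv: "rot i v = v" if "v \<in> V" for i v
  proof -
    have "rot (int n) v = v" for n
    proof (induction n)
      case (Suc n)
      have "rot 1 (rot (int n) v) = rot (int (Suc n)) v" using that by (simp add: rot_rot)
      then show ?case using Suc rot1 that by simp
    qed (use that in simp)
    from this[of "nat (i mod int r)"] show ?thesis by (simp add: rot_mod)
  qed
  have V: "V = (\<lambda>c. c \<cdot>\<^sub>v u) ` UNIV"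
  proof
    show "V \<subseteq> (\<lambda>c. c \<cdot>\<^sub>v u) ` UNIV"
    proof
      fix w assume "w \<in> V"
      then have "w \<in> rot_span u" using rot_span_eq_V[OF u(1,2) Au] by simp
      then show "w \<in> (\<lambda>c. c \<cdot>\<^sub>v u) ` UNIV"
      proof induction
        case zero
        have "0\<^sub>v d = 0 \<cdot>\<^sub>v u" using u by (intro eq_vecI) auto
        then show ?case by blast
      next
        case (step w c i)
        then obtain c' where w: "w = c' \<cdot>\<^sub>v u" by blast
        have "w + c \<cdot>\<^sub>v rot i u = (c' + c) \<cdot>\<^sub>v u" unfolding w using u by (simp add: rotv add_smult_distrib_vec)
        then show ?case by blast
      qed
    qed
  qed (use u in auto)
  have "inj (\<lambda>c. c \<cdot>\<^sub>v u)"
  proof (rule injI)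
    fix c c' assume eq: "c \<cdot>\<^sub>v u = c' \<cdot>\<^sub>v u"
    have "\<exists>i<d. u $ i \<noteq> 0"
    proof (rule ccontr)
      assume "\<not> ?thesis"
      then have "u = 0\<^sub>v d" using u(1) by (intro eq_vecI) auto
      then show False using u(2) by simp
    qed
    then obtain i where i: "i < d" "u $ i \<noteq> 0" by blast
    then show "c = c'" using arg_cong[OF eq, of "\<lambda>v. v $ i"] u(1) by simp
  qed
  then have "card V = CARD('p)" unfolding V by (simp add: card_image)
  then have card: "card (carrier G) = 2 * (CARD('p) * r)" by (simp only: card_G)
  have a: "?a \<in> carrier G" "?z \<in> carrier G" using u by auto
  have aa: "?a \<otimes>\<^bsub>G\<^esub> ?a = \<one>\<^bsub>G\<^esub>" using u by simp
  have zz: "?z \<otimes>\<^bsub>G\<^esub> ?z = \<one>\<^bsub>G\<^esub>" by simp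
  have "?a \<otimes>\<^bsub>G\<^esub> ?z = (u, (Suc 0, False))" using u by simp
  moreover have "(0 :: 'p mod_ring) \<cdot>\<^sub>v u = 0\<^sub>v d" using u by (intro eq_vecI) auto
  ultimately have pow: "(?a \<otimes>\<^bsub>G\<^esub> ?z) [^]\<^bsub>G\<^esub> (CARD('p) * r) = \<one>\<^bsub>G\<^esub>"
    using rot_trivial_pow[OF rot1 u(1), of "CARD('p) * r"] by simp
  have "CARD('p) \<ge> 1" using prime_card[where 'a='p] prime_ge_1_nat by blast
  then have N: "CARD('p) * r \<ge> 3" using r3 mult_le_mono[of 1 "CARD('p)" 3 r] by simp
  obtain \<alpha> where \<alpha>: "\<alpha> \<in> iso (dihedral (CARD('p) * r)) G" "\<alpha> (Suc 0, True) = ?a" "\<alpha> (0, True) = ?z"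
    by (rule G.dihedral_iso[OF a(1) aa a(2) zz pow generated_by_admissible[OF adm] card]) (use N in auto)
  have "labels (dihedral (CARD('p) * r)) (Suc 0, True) (0, True) (\<beta> \<circ> \<alpha>) D R L"
    by (rule labels_iso[OF l \<alpha>(1) _ _ \<alpha>(2,3)]) (use N in auto)
  then show ?thesis by (rule dihedral_map_graph[OF N])
qed

lemma exists_map:
  assumes "\<not> exceptional"
  shows "\<exists>(n::nat) R L \<beta> u. admissible u \<and> labels G (u, (Suc 0, True)) (0\<^sub>v d, (0, True)) \<beta> {0..<n} R L \<and>
    irreducible_rotary_aug_PX_map TYPE('p) r {0..<n} R L"
proof -
  let ?z = "(0\<^sub>v d :: 'p mod_ring vec, (0 :: nat, True))"
  obtain u where adm: "admissible u" using exists_admissible[OF assms] by blast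
  then have u: "u \<in> V" "u \<noteq> 0\<^sub>v d" "A u = u \<or> A u = - u \<and> (\<forall>v\<in>V. rot 1 v = v)"
    by (auto simp: admissible_def)
  let ?a = "(u, (Suc 0, True))"
  define n where "n = card (carrier G)"
  have a: "?a \<in> carrier G" "?z \<in> carrier G" using u by auto
  obtain \<beta> R L where l: "labels G ?a ?z \<beta> {0..<n} R L" and perm: "R permutes {0..<n}" "L permutes {0..<n}"
    using exists_labels[OF G.is_group finite_G a, of "{0..<n}"] by (auto simp: n_def)
  note gen = generated_by_admissible[OF adm]
  \<comment> \<open>No loops: modulo V the powers of a are 1 and tau'', while z lies over
    tau'.\<close>
  have "snd (?a [^]\<^bsub>G\<^esub> k) = (if even k then (0, False) else (Suc 0, True))" for k :: nat
  proof (induction k)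
    case (Suc k)
    have "?a [^]\<^bsub>G\<^esub> k = (fst (?a [^]\<^bsub>G\<^esub> k), snd (?a [^]\<^bsub>G\<^esub> k))" by simp
    then have "snd (?a [^]\<^bsub>G\<^esub> Suc k) = snd (?a [^]\<^bsub>G\<^esub> k) \<otimes>\<^bsub>dihedral r\<^esub> (Suc 0, True)"
      by (metis G.nat_pow_Suc semidirect_mult snd_conv)
    then show ?case using Suc r3 by auto
  qed simp
  then have "snd ?z \<noteq> snd (?a [^]\<^bsub>G\<^esub> k)" for k :: nat by simp
  then have za: "?z \<noteq> ?a [^]\<^bsub>G\<^esub> k" for k :: nat by metis
  have map: "is_map {0..<n} R L"
    by (rule labels_is_map[OF G.is_group finite_G l perm gen _ za]) simp
  have "\<exists>s \<delta>. (\<delta> = 1 \<or> \<delta> = -1) \<and> mgraph_iso (map_graph {0..<n} R L) (aug_PX_graph CARD('p) r s \<delta>)"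
  proof (cases "A u = u")
    case True
    then obtain s where "mgraph_iso (map_graph {0..<n} R L) (PX_graph CARD('p) r s)"
      using PX_map_graph[OF u(1,2) _ l] by blast
    then show ?thesis by (intro exI[of _ s] exI[of _ 1]) (simp add: aug_PX_graph_def)
  next
    case False
    then have "mgraph_iso (map_graph {0..<n} R L) (cycle_graph (CARD('p) * r))"
      using u cycle_map_graph[OF u(1,2) _ _ l] by blast
    then show ?thesis by (intro exI[of _ 0] exI[of _ "-1"]) (simp add: aug_PX_graph_def)
  qed
  then have "aug_PX_map CARD('p) r {0..<n} R L" using map by (simp add: aug_PX_map_def)
  then have "irreducible_rotary_aug_PX_map TYPE('p) r {0..<n} R L"
    unfolding irreducible_rotary_aug_PX_map_def
    using labels_rotary[OF G.is_group l gen] irr by blast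
  with adm l show ?thesis
    by (intro exI[of _ n] exI[of _ R] exI[of _ L] exI[of _ \<beta>] exI[of _ u] conjI)
qed

section \<open>Normal form of a generating pair and its uniqueness\<close>

text \<open>Conjugation by the translation x, written out.\<close>

lemma conj_iso:
  assumes x: "x \<in> V"
  shows "(\<lambda>(v, g). (v + (x - \<psi> g *\<^sub>v x), g)) \<in> iso G G"
proof (rule isoI)
  show "(\<lambda>(v, g). (v + (x - \<psi> g *\<^sub>v x), g)) \<in> hom G G"
  proof (rule homI)
    fix y assume "y \<in> carrier G"
    then show "(\<lambda>(v, g). (v + (x - \<psi> g *\<^sub>v x), g)) y \<in> carrier G" using x by auto
  next
    fix y y' assume "y \<in> carrier G" "y' \<in> carrier G"
    then obtain v g w h where y: "y = (v, g)" "v \<in> V" "g \<in> carrier (dihedral r)"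
      and y': "y' = (w, h)" "w \<in> V" "h \<in> carrier (dihedral r)" by auto
    have c: "\<psi> h *\<^sub>v x \<in> V" "\<psi> g *\<^sub>v x \<in> V" "\<psi> g *\<^sub>v w \<in> V" "\<psi> g *\<^sub>v (\<psi> h *\<^sub>v x) \<in> V"
      using x y y' by auto
    have "v + \<psi> g *\<^sub>v w + (x - \<psi> g *\<^sub>v (\<psi> h *\<^sub>v x)) =
        v + (x - \<psi> g *\<^sub>v x) + (\<psi> g *\<^sub>v w + (\<psi> g *\<^sub>v x - \<psi> g *\<^sub>v (\<psi> h *\<^sub>v x)))"
      using c x y(2) by (intro eq_vecI) auto
    then show "(\<lambda>(v, g). (v + (x - \<psi> g *\<^sub>v x), g)) (y \<otimes>\<^bsub>G\<^esub> y') =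
        (\<lambda>(v, g). (v + (x - \<psi> g *\<^sub>v x), g)) y \<otimes>\<^bsub>G\<^esub> (\<lambda>(v, g). (v + (x - \<psi> g *\<^sub>v x), g)) y'"
      using x y y' c by (simp add: act_mult act_add act_diff del: dihedral_mult)
  qed
  have 1: "v + (x - \<psi> g *\<^sub>v x) - (x - \<psi> g *\<^sub>v x) = v" "v - (x - \<psi> g *\<^sub>v x) + (x - \<psi> g *\<^sub>v x) = v"
    if "v \<in> V" "g \<in> carrier (dihedral r)" for v g
    using that x by (auto intro!: eq_vecI)
  show "bij_betw (\<lambda>(v, g). (v + (x - \<psi> g *\<^sub>v x), g)) (carrier G) (carrier G)"
    by (rule bij_betwI[where g="\<lambda>(v, g). (v - (x - \<psi> g *\<^sub>v x), g)"]) (use x 1 in auto)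
qed

text \<open>One conjugation clears the vector part of z. The conjugations that preserve this are by
  Z-fixed y, and they are used to remove the (-1)-part under \<open>A\<close> from the vector part
  of a. If rho is trivial, \<open>A\<close> is a scalar and nothing has to be removed.\<close>

lemma exists_admissible_labels:
  assumes l: "labels G (v, (Suc 0, True)) (w, (0, True)) \<beta> D R L" and m: "is_map D R L"
  shows "\<exists>u \<beta>'. admissible u \<and> labels G (u, (Suc 0, True)) (0\<^sub>v d, (0, True)) \<beta>' D R L"
proof -
  have vw: "v \<in> V" "w \<in> V" using labelsD(1,2)[OF l] by auto
  have "w + Z w = 0\<^sub>v d" using labels_generated(2)[OF G.is_group l m] by simp
  then have "(w + Z w) $ i = 0" if "i < d" for i using that by simp
  then have wZ: "w $ i + Z w $ i = 0" if "i < d" for i using that vw by simp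
  \<comment> \<open>From z^2 = 1 comes Z w = -w, so x0 = w/2 satisfies x0 - Z x0 = w; halving is
    possible as p is odd.\<close>
  define h :: "'p mod_ring" where "h = 1 / 2"
  have h: "h * c + h * c = c" for c
    using two_neq_0 by (simp add: h_def flip: mult_2)
  define x0 where "x0 = h \<cdot>\<^sub>v w"
  have x0: "x0 \<in> V" using vw by (simp add: x0_def)
  have Zx0: "x0 - Z x0 = w"
  proof (rule eq_vecI)
    fix i assume "i < dim_vec w"
    then have i: "i < d" using vw by simp
    have "Z w $ i = - w $ i" using wZ[OF i] by (simp add: eq_neg_iff_add_eq_0 add.commute)
    then show "(x0 - Z x0) $ i = w $ i" using i vw h by (simp add: x0_def act_smult)
  qed (use vw in \<open>auto simp: x0_def act_smult\<close>)
  define v0 where "v0 = v - (x0 - A x0)"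
  have v0: "v0 \<in> V" using vw x0 by (simp add: v0_def)
  \<comment> \<open>Conjugating by y with Z y = y leaves (0, tau') alone and changes the vector part
    of a by y - A y.\<close>
  have red: "\<exists>\<beta>'. labels G (v0 - (y - A y), (Suc 0, True)) (0\<^sub>v d, (0, True)) \<beta>' D R L"
    if y: "y \<in> V" "Z y = y" for y
  proof -
    have xy: "x0 + y \<in> V" using x0 y by simp
    show ?thesis
    proof (rule exI, rule labels_iso[OF l conj_iso[OF xy]])
      have "v0 - (y - A y) + (x0 + y - (A x0 + A y)) = v"
        using vw x0 y by (intro eq_vecI) (auto simp: v0_def)
      then show "(\<lambda>(v, g). (v + (x0 + y - \<psi> g *\<^sub>v (x0 + y)), g)) (v0 - (y - A y), (Suc 0, True)) = (v, (Suc 0, True))"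
        using x0 y by (simp add: act_add)
      have "0\<^sub>v d + (x0 + y - (Z x0 + y)) = x0 - Z x0"
        using x0 y by (intro eq_vecI) auto
      then show "(\<lambda>(v, g). (v + (x0 + y - \<psi> g *\<^sub>v (x0 + y)), g)) (0\<^sub>v d, (0, True)) = (w, (0, True))"
        using x0 y Zx0 vw by (simp add: act_add)
    qed (use v0 y in auto)
  qed
  have "\<exists>y. y \<in> V \<and> Z y = y \<and> (A (v0 - (y - A y)) = v0 - (y - A y) \<or>
      A (v0 - (y - A y)) = - (v0 - (y - A y)) \<and> (\<forall>v\<in>V. rot 1 v = v))"
  proof (cases "\<forall>v\<in>V. rot 1 v = v")
    case True
    have "v0 - (0\<^sub>v d - A (0\<^sub>v d)) = v0" using v0 by simp
    moreover have "A v0 = v0 \<or> A v0 = - v0" using A_scalar[OF True] v0 by blast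
    ultimately show ?thesis using True by (intro exI[of _ "0\<^sub>v d"]) simp
  next
    case False
    then have fix0: "rot 1 v = v \<Longrightarrow> v = 0\<^sub>v d" if "v \<in> V" for v using rot_1_cases that by blast
    have inj: "inj_on (\<lambda>v. v - rot 1 v) V"
    proof (rule inj_onI)
      fix a b assume ab: "a \<in> V" "b \<in> V" "a - rot 1 a = b - rot 1 b"
      have ix: "a $ i - rot 1 a $ i = b $ i - rot 1 b $ i" if "i < d" for i
      proof -
        have "(a - rot 1 a) $ i = (b - rot 1 b) $ i" by (simp only: ab(3))
        then show ?thesis using that ab(1,2) by simp
      qed
      have "rot 1 (a - b) = a - b"
      proof (rule eq_vecI)
        fix i assume "i < dim_vec (a - b)"
        then have i: "i < d" using ab by simp
        then show "rot 1 (a - b) $ i = (a - b) $ i" using ix[OF i] ab by (simp add: rot_dist algebra_simps)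
      qed (use ab in auto)
      then have "a - b = 0\<^sub>v d" using fix0[of "a - b"] ab by simp
      then have "(a - b) $ i = 0" if "i < d" for i using that by simp
      then have "a $ i = b $ i" if "i < d" for i using that ab by simp
      then show "a = b" using ab by (intro eq_vecI) auto
    qed
    have "(\<lambda>v. v - rot 1 v) ` V \<subseteq> V" by auto
    then have surj: "(\<lambda>v. v - rot 1 v) ` V = V" using inj by (intro endo_inj_surj) auto
    \<comment> \<open>The (-1)-part of v0 under \<open>A\<close>, so that v0 - m is fixed. For
      Z-fixed y the vector y - A y equals y - rho y, hence y is sought as the preimage of m under
      the invertible 1 - rho.\<close>
    define m where "m = h \<cdot>\<^sub>v (v0 - A v0)"
    have mV: "m \<in> V" using v0 by (simp add: m_def)
    have Am: "A m = - m"
      unfolding m_def using v0 by (intro eq_vecI) (auto simp: act_smult act_diff A_A algebra_simps)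
    obtain y where y: "y \<in> V" "y - rot 1 y = m"
    proof -
      have "m \<in> (\<lambda>v. v - rot 1 v) ` V" using surj mV by simp
      then show ?thesis using that by blast
    qed
    \<comment> \<open>The vector Z y solves the same equation: (1 - rho) Z y = -Z rho^-1 m = -A m =
      m. Uniqueness gives Z y = y.\<close>
    have Zy: "Z y = y"
    proof (rule inj_onD[OF inj])
      have "Z y - rot 1 (Z y) = Z (y - rot (-1) y)"
        using y by (simp add: act_diff Z_rot)
      also have "y - rot (-1) y = - rot (-1) (y - rot 1 y)"
        using y(1) by (intro eq_vecI) (auto simp: rot_dist rot_rot)
      also have "Z (- rot (-1) (y - rot 1 y)) = - Z (rot (-1) m)"
        unfolding y(2) using mV by (simp add: act_uminus)
      also have "\<dots> = - A m" using mV by (simp add: Z_rot A_eq)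
      also have "\<dots> = y - rot 1 y" using Am y by simp
      finally show "Z y - rot 1 (Z y) = y - rot 1 y" .
    qed (use y in auto)
    have "y - A y = m"
      using y rot_1[OF y(1)] Zy by simp
    moreover have "A (v0 - m) = v0 - m"
    proof (rule eq_vecI)
      fix i assume "i < dim_vec (v0 - m)"
      then have i: "i < d" using mV v0 by simp
      have "A (v0 - m) $ i = A v0 $ i + m $ i" using i v0 mV Am by (simp add: act_diff)
      also have "\<dots> = A v0 $ i + h * (v0 $ i - A v0 $ i)" using i v0 by (simp add: m_def)
      also have "\<dots> = v0 $ i - h * (v0 $ i - A v0 $ i)" using h[of "v0 $ i - A v0 $ i"] by (simp add: algebra_simps)
      also have "\<dots> = (v0 - m) $ i" using i v0 mV by (simp add: m_def)
      finally show "A (v0 - m) $ i = (v0 - m) $ i" .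
    qed (use v0 mV in auto)
    ultimately show ?thesis using y Zy by (intro exI[of _ y]) simp
  qed
  then obtain y where y: "y \<in> V" "Z y = y" and cases: "A (v0 - (y - A y)) = v0 - (y - A y) \<or>
      A (v0 - (y - A y)) = - (v0 - (y - A y)) \<and> (\<forall>v\<in>V. rot 1 v = v)" by blast
  define u where "u = v0 - (y - A y)"
  have u: "u \<in> V" using v0 y by (simp add: u_def)
  obtain \<beta>' where l': "labels G (u, (Suc 0, True)) (0\<^sub>v d, (0, True)) \<beta>' D R L"
    using red[OF y] unfolding u_def by blast
  have "u \<noteq> 0\<^sub>v d"
  proof
    assume u0: "u = 0\<^sub>v d"
    \<comment> \<open>With u = 0 both generators would lie in the complement {0} x D, yet the map
      being connected they generate nonzero translations.\<close>
    have "fst x = 0\<^sub>v d" if "x \<in> generated_by G (u, (Suc 0, True)) (0\<^sub>v d, (0, True))" for x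
      using that
    proof induction
      case (left x)
      have "x \<in> carrier G" using left G.generated_by_subset[OF labelsD(1,2)[OF l']] by blast
      then show ?case using left u0 by (cases x) (auto simp del: dihedral_mult)
    next
      case (right x)
      have "x \<in> carrier G" using right G.generated_by_subset[OF labelsD(1,2)[OF l']] by blast
      then show ?case using right by (cases x) (auto simp del: dihedral_mult)
    qed simp
    moreover have "(unit_vec d 0, (0, False)) \<in> carrier G" by simp
    ultimately have "fst (unit_vec d 0 :: 'p mod_ring vec, (0 :: nat, False)) = 0\<^sub>v d"
      using labels_generated(1)[OF G.is_group l' m] by blast
    then have "(unit_vec d 0 :: 'p mod_ring vec) $ 0 = 0" using d_pos by simp
    then show False using d_pos by simp
  qed
  then have "admissible u" using u cases by (simp add: admissible_def u_def)
  then show ?thesis using l' by blast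
qed

text \<open>A D-equivariant automorphism Q of V with Q u1 = u2 is wanted. The operators rho^i +
  rho^-i commute with D. Writing u2 as a combination of rho^i u1 and replacing each rho^i by rho^i +
  rho^-i gives an operator with value u2 + eps A u2 = 2 u2 at u1, and 2 is invertible.\<close>

lemma admissible_transitive:
  assumes u1: "admissible u1" and u2: "admissible u2"
  shows "\<exists>\<kappa>\<in>iso G G. \<kappa> (u1, (Suc 0, True)) = (u2, (Suc 0, True)) \<and> \<kappa> (0\<^sub>v d, (0, True)) = (0\<^sub>v d, (0, True))"
proof -
  have uV: "u1 \<in> V" "u1 \<noteq> 0\<^sub>v d" "u2 \<in> V" "u2 \<noteq> 0\<^sub>v d" using u1 u2 by (auto simp: admissible_def)
  have one: "1 \<cdot>\<^sub>v v = v" "(-1) \<cdot>\<^sub>v v = - v" for v :: "'p mod_ring vec" by (auto intro!: eq_vecI)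
  \<comment> \<open>Both vectors have the same sign under \<open>A\<close>: for trivial rho it is a
    scalar on V, and otherwise admissible vectors are fixed.\<close>
  obtain \<epsilon> where \<epsilon>: "A u1 = \<epsilon> \<cdot>\<^sub>v u1" "A u2 = \<epsilon> \<cdot>\<^sub>v u2" "\<epsilon> * \<epsilon> = 1"
  proof (cases "\<forall>v\<in>V. rot 1 v = v")
    case True
    have "(A u1 = u1 \<and> A u2 = u2) \<or> (A u1 = - u1 \<and> A u2 = - u2)"
      using A_scalar[OF True] uV by blast
    then show ?thesis using that[of 1] that[of "-1"] one by auto
  next
    case False
    then have "A u1 = u1" "A u2 = u2" using u1 u2 unfolding admissible_def by blast+
    then show ?thesis using that[of 1] one by auto
  qed
  define E where "E = {Q. (\<forall>v\<in>V. Q v \<in> V \<and> Q (A v) = A (Q v) \<and> Q (Z v) = Z (Q v)) \<and>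
      (\<forall>v\<in>V. \<forall>w\<in>V. Q (v + w) = Q v + Q w)}"
  have E_add: "(\<lambda>v. Q v + Q' v) \<in> E" if "Q \<in> E" "Q' \<in> E" for Q Q'
  proof -
    have "Q v + Q w + (Q' v + Q' w) = Q v + Q' v + (Q w + Q' w)" if vw: "v \<in> V" "w \<in> V" for v w
    proof -
      have "Q v \<in> V" "Q w \<in> V" "Q' v \<in> V" "Q' w \<in> V"
        using vw \<open>Q \<in> E\<close> \<open>Q' \<in> E\<close> unfolding E_def by blast+
      then show ?thesis by (intro eq_vecI) auto
    qed
    then show ?thesis using that by (auto simp: E_def act_add)
  qed
  have E_smult: "(\<lambda>v. c \<cdot>\<^sub>v Q v) \<in> E" if "Q \<in> E" for Q c
    using that by (auto simp: E_def act_smult smult_add_distrib_vec[of _ d])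
  have E_rot: "(\<lambda>v. rot i v + rot (- i) v) \<in> E" for i
  proof -
    have "rot i v + rot i w + (rot (- i) v + rot (- i) w) = rot i v + rot (- i) v + (rot i w + rot (- i) w)"
      if "v \<in> V" "w \<in> V" for v w using that by (intro eq_vecI) auto
    then show ?thesis
      by (auto simp: E_def act_add A_rot Z_rot rot_dist comm_add_vec[of "rot (- i) _" d "rot i _"])
  qed
  have E_0: "(\<lambda>v. 0\<^sub>v d) \<in> E" by (auto simp: E_def)
  \<comment> \<open>A summand c rho^i u1 contributes c (rho^i + rho^-i). Its value at u1 is that
    summand plus eps times its image under \<open>A\<close>, because A rho^i u1 = eps rho^-i u1 and
    eps^2 = 1.\<close>
  have S: "\<exists>Q\<in>E. Q u1 = w + \<epsilon> \<cdot>\<^sub>v A w" if "w \<in> rot_span u1" for w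
    using that
  proof induction
    case zero
    then show ?case using E_0 by (intro bexI[of _ "\<lambda>v. 0\<^sub>v d"]) auto
  next
    case (step w c i)
    then obtain Q where Q: "Q \<in> E" "Q u1 = w + \<epsilon> \<cdot>\<^sub>v A w" by blast
    have w: "w \<in> V" using step.hyps rot_span_eq_V[OF uV(1,2) \<epsilon>(1)] by simp
    have "A (w + c \<cdot>\<^sub>v rot i u1) = A w + c \<cdot>\<^sub>v (\<epsilon> \<cdot>\<^sub>v rot (- i) u1)"
      using w uV by (simp add: act_add act_smult A_rot \<epsilon>(1) rot_dist)
    moreover have "\<epsilon> * (c * (\<epsilon> * b)) = c * b" for b
      using \<epsilon>(3) by (metis mult.assoc mult.left_commute mult_1)
    ultimately have eq: "Q u1 + c \<cdot>\<^sub>v (rot i u1 + rot (- i) u1) = (w + c \<cdot>\<^sub>v rot i u1) + \<epsilon> \<cdot>\<^sub>v A (w + c \<cdot>\<^sub>v rot i u1)"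
      unfolding Q(2) using w uV by (intro eq_vecI) (simp_all add: distrib_left)
    show ?case
      by (rule bexI[OF _ E_add[OF Q(1) E_smult[OF E_rot]]]) (rule eq)
  qed
  obtain Q where Q: "Q \<in> E" "Q u1 = u2"
  proof -
    obtain Q where Q: "Q \<in> E" "Q u1 = u2 + \<epsilon> \<cdot>\<^sub>v A u2"
      using S[of u2] rot_span_eq_V[OF uV(1,2) \<epsilon>(1)] uV by blast
    have "(1 / 2) \<cdot>\<^sub>v Q u1 = u2"
      unfolding Q(2) \<epsilon>(2) using uV \<epsilon>(3) two_neq_0
      by (intro eq_vecI) (auto simp flip: mult.assoc mult_2)
    then show ?thesis using that[OF E_smult[OF Q(1)]] by blast
  qed
  have QV: "Q v \<in> V" if "v \<in> V" for v using Q that by (auto simp: E_def)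
  have Qadd: "Q (v + w) = Q v + Q w" if "v \<in> V" "w \<in> V" for v w using Q that by (auto simp: E_def)
  have Q0: "Q (0\<^sub>v d) = 0\<^sub>v d"
  proof -
    have "Q (0\<^sub>v d + 0\<^sub>v d) = Q (0\<^sub>v d) + Q (0\<^sub>v d)" by (rule Qadd) auto
    then have "Q (0\<^sub>v d) = Q (0\<^sub>v d) + Q (0\<^sub>v d)" by simp
    then have "Q (0\<^sub>v d) $ i = 0" if "i < d" for i
      using that QV[of "0\<^sub>v d"] by (metis add_cancel_right_right carrier_vecD index_add_vec(1) zero_carrier_vec)
    then show ?thesis using QV[of "0\<^sub>v d"] by (intro eq_vecI) auto
  qed
  \<comment> \<open>As in Schur's lemma: the kernel is a subrepresentation missing u1, hence zero,
    and V is finite.\<close>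
  let ?W = "{v \<in> V. Q v = 0\<^sub>v d}"
  have "?W = {0\<^sub>v d} \<or> ?W = V"
    by (rule invariant_subspace_cases) (use Q in \<open>auto simp: Q0 E_def\<close>)
  moreover have "u1 \<notin> ?W" using Q uV by simp
  ultimately have ker: "?W = {0\<^sub>v d}" using uV by blast
  have inj: "inj_on Q V"
  proof (rule inj_onI)
    fix v w assume vw: "v \<in> V" "w \<in> V" "Q v = Q w"
    have "v = (v - w) + w" using vw by (intro eq_vecI) auto
    then have "Q v = Q (v - w) + Q w" using Qadd[of "v - w" w] vw by simp
    then have "Q w $ i = (Q (v - w) + Q w) $ i" for i using vw by simp
    then have "Q (v - w) $ i = 0" if "i < d" for i
      using that QV[OF vw(2)] by (metis add_cancel_left_left carrier_vecD index_add_vec(1))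
    then have "Q (v - w) = 0\<^sub>v d" using QV[of "v - w"] vw by (intro eq_vecI) auto
    then have "v - w \<in> ?W" using vw by simp
    then have "v - w = 0\<^sub>v d" unfolding ker by simp
    then show "v = w" using \<open>v = (v - w) + w\<close> vw by simp
  qed
  have "Q ` V = V" using inj QV by (intro endo_inj_surj) auto
  then have bij: "bij_betw Q V V" using inj by (simp add: bij_betw_def)
  have comm: "\<forall>v\<in>V. Q (\<psi> g *\<^sub>v v) = \<psi> g *\<^sub>v Q v" if "g \<in> carrier (dihedral r)" for g
  proof -
    have "g \<in> generated_by (dihedral r) (Suc 0, True) (0, True)" using that dihedral_generated[of r] by auto
    then show ?thesis
    proof induction
      case one
      then show ?case using QV by auto
    next
      case (left g)
      have "g \<in> carrier (dihedral r)" using left D.generated_by_subset[of "(Suc 0, True)" "(0, True)"] by auto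
      then show ?case using left Q QV by (simp add: act_mult E_def del: dihedral_mult)
    next
      case (right g)
      have "g \<in> carrier (dihedral r)" using right D.generated_by_subset[of "(Suc 0, True)" "(0, True)"] by auto
      then show ?case using right Q QV by (simp add: act_mult E_def del: dihedral_mult)
    qed
  qed
  have "(\<lambda>(v, g). (Q v, g)) \<in> iso G G"
    by (rule semidirect_iso[OF bij]) (use Qadd comm in auto)
  then show ?thesis using Q Q0 by (intro bexI) auto
qed

end

section \<open>Maps and representations\<close>

lemma mat_eq_if_mult_vec_eq:
  fixes M N :: "'a::comm_ring_1 mat"
  assumes M: "M \<in> carrier_mat n n" and N: "N \<in> carrier_mat n n"
    and eq: "\<And>v. v \<in> carrier_vec n \<Longrightarrow> M *\<^sub>v v = N *\<^sub>v v"
  shows "M = N"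
proof (rule eq_matI)
  fix i j assume "i < dim_row N" "j < dim_col N"
  then have ij: "i < n" "j < n" using N by auto
  have "(M *\<^sub>v unit_vec n j) $ i = (N *\<^sub>v unit_vec n j) $ i" using eq[of "unit_vec n j"] by simp
  then show "M $$ (i, j) = N $$ (i, j)" using ij M N by simp
qed (use M(1) N(1) in auto)

text \<open>Additivity over the prime field already gives linearity. It turns the restriction of a
  group isomorphism to V into an intertwining matrix.\<close>

lemma additive_matrix:
  fixes P :: "'p::prime_card mod_ring vec \<Rightarrow> 'p mod_ring vec"
  assumes P: "\<And>v. v \<in> carrier_vec n \<Longrightarrow> P v \<in> carrier_vec n"
    and add: "\<And>v w. v \<in> carrier_vec n \<Longrightarrow> w \<in> carrier_vec n \<Longrightarrow> P (v + w) = P v + P w"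
  shows "\<exists>M\<in>carrier_mat n n. \<forall>v\<in>carrier_vec n. P v = M *\<^sub>v v"
proof -
  have P0: "P (0\<^sub>v n) = 0\<^sub>v n"
  proof -
    have eq: "P (0\<^sub>v n) = P (0\<^sub>v n) + P (0\<^sub>v n)" using add[of "0\<^sub>v n" "0\<^sub>v n"] by simp
    have "P (0\<^sub>v n) $ i = 0" if "i < n" for i
      using that P[of "0\<^sub>v n"] eq by (metis add_cancel_right_right carrier_vecD index_add_vec(1) zero_carrier_vec)
    then show ?thesis using P[of "0\<^sub>v n"] by (intro eq_vecI) auto
  qed
  have smult: "P (c \<cdot>\<^sub>v v) = c \<cdot>\<^sub>v P v" if v: "v \<in> carrier_vec n" for c v
  proof -
    have "P (of_nat k \<cdot>\<^sub>v v) = of_nat k \<cdot>\<^sub>v P v" for k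
    proof (induction k)
      case 0
      have "0 \<cdot>\<^sub>v w = 0\<^sub>v n" if "w \<in> carrier_vec n" for w :: "'p mod_ring vec"
        using that by (intro eq_vecI) auto
      then show ?case using v P[OF v] P0 by simp
    next
      case (Suc k)
      have e: "of_nat (Suc k) \<cdot>\<^sub>v w = of_nat k \<cdot>\<^sub>v w + w" if "w \<in> carrier_vec n" for w :: "'p mod_ring vec"
        using that by (intro eq_vecI) (auto simp: algebra_simps)
      show ?case unfolding e[OF v] e[OF P[OF v]] using add[of "of_nat k \<cdot>\<^sub>v v" v] v Suc by simp
    qed
    moreover obtain k where "c = of_nat k" using surj_of_nat_mod_ring[of c] by auto
    ultimately show ?thesis by simp
  qed
  define M where "M = mat n n (\<lambda>(i, j). P (unit_vec n j) $ i)"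
  have main: "P v = M *\<^sub>v v" if v: "v \<in> carrier_vec n" for v
  proof -
    \<comment> \<open>The truncation of v to its first k entries, so that the sum over the standard
      basis is an induction on k.\<close>
    define t where "t k = vec n (\<lambda>i. if i < k then v $ i else 0)" for k
    have tV: "t k \<in> carrier_vec n" for k by (simp add: t_def)
    have "P (t k) $ i = (\<Sum>j<k. P (unit_vec n j) $ i * v $ j)" if "k \<le> n" "i < n" for k i
      using that(1)
    proof (induction k)
      case 0
      have "t 0 = 0\<^sub>v n" by (intro eq_vecI) (auto simp: t_def)
      then show ?case using P0 \<open>i < n\<close> by simp
    next
      case (Suc k)
      have "t (Suc k) = t k + v $ k \<cdot>\<^sub>v unit_vec n k"
        using Suc.prems by (intro eq_vecI) (auto simp: t_def less_Suc_eq)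
      then have "P (t (Suc k)) = P (t k) + v $ k \<cdot>\<^sub>v P (unit_vec n k)"
        using add[OF tV[of k], of "v $ k \<cdot>\<^sub>v unit_vec n k"] smult[of "unit_vec n k"] by simp
      then have "P (t (Suc k)) $ i = P (t k) $ i + v $ k * P (unit_vec n k) $ i"
        using \<open>i < n\<close> P[OF tV[of k]] P[of "unit_vec n k"] by simp
      then show ?case using Suc by (simp add: mult.commute)
    qed
    moreover have "t n = v" using v by (intro eq_vecI) (auto simp: t_def)
    ultimately have "P v $ i = (\<Sum>j<n. P (unit_vec n j) $ i * v $ j)" if "i < n" for i using that by force
    then show ?thesis
      using v P[OF v] by (intro eq_vecI) (auto simp: M_def scalar_prod_def atLeast0LessThan)
  qed
  show ?thesis
  proof (rule bexI[of _ M])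
    show "\<forall>v\<in>carrier_vec n. P v = M *\<^sub>v v" by (rule ballI) (rule main)
    show "M \<in> carrier_mat n n" by (simp add: M_def)
  qed
qed

lemma snd_semidirect_mult: "snd (x \<otimes>\<^bsub>semidirect r d \<psi>\<^esub> y) = snd x \<otimes>\<^bsub>dihedral r\<^esub> snd y"
  by (cases x; cases y) (simp del: dihedral_mult)

lemma snd_semidirect_pow: "snd (x [^]\<^bsub>semidirect r d \<psi>\<^esub> (n::nat)) = snd x [^]\<^bsub>dihedral r\<^esub> n"
  by (induction n) (simp_all add: nat_pow_def snd_semidirect_mult)

lemma snd_generated_by:
  "x \<in> generated_by (semidirect r d \<psi>) a z \<Longrightarrow> snd x \<in> generated_by (dihedral r) (snd a) (snd z)"
proof (induction rule: generated_by.induct)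
  case one
  then show ?case using generated_by.one[of "dihedral r"] by simp
next
  case (left x)
  show ?case unfolding snd_semidirect_mult by (rule generated_by.left[OF left.IH])
next
  case (right x)
  show ?case unfolding snd_semidirect_mult by (rule generated_by.right[OF right.IH])
qed

lemma irreducible_rep_twist:
  assumes irr: "irreducible_rep r d \<psi>" and \<alpha>: "\<alpha> \<in> iso (dihedral r) (dihedral r)" and r: "r > 0"
  shows "irreducible_rep r d (\<psi> \<circ> \<alpha>)"
proof -
  interpret D: group "dihedral r" using r by (rule group_dihedral)
  have hom: "\<alpha> \<in> hom (dihedral r) (dihedral r)" and surj: "\<alpha> ` carrier (dihedral r) = carrier (dihedral r)"
    using \<alpha> by (auto simp: iso_def bij_betw_def)
  have c: "\<alpha> g \<in> carrier (dihedral r)" if "g \<in> carrier (dihedral r)" for g using surj that by blast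
  have "\<alpha> \<one>\<^bsub>dihedral r\<^esub> = \<one>\<^bsub>dihedral r\<^esub>" using hom_one[OF hom D.is_group D.is_group] .
  then have "is_rep r d (\<psi> \<circ> \<alpha>)"
    using irr c hom_mult[OF hom] by (simp add: irreducible_rep_def is_rep_def del: dihedral_one)
  moreover have "(\<forall>g\<in>carrier (dihedral r). \<forall>v\<in>W. (\<psi> \<circ> \<alpha>) g *\<^sub>v v \<in> W) \<longleftrightarrow>
      (\<forall>g\<in>carrier (dihedral r). \<forall>v\<in>W. \<psi> g *\<^sub>v v \<in> W)" for W
  proof -
    have "(\<forall>g\<in>carrier (dihedral r). \<forall>v\<in>W. \<psi> g *\<^sub>v v \<in> W) \<longleftrightarrow>
        (\<forall>g\<in>\<alpha> ` carrier (dihedral r). \<forall>v\<in>W. \<psi> g *\<^sub>v v \<in> W)" by (simp only: surj)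
    then show ?thesis by simp
  qed
  ultimately show ?thesis using irr unfolding irreducible_rep_def by simp
qed

lemma semidirect_twist_iso:
  assumes \<alpha>: "\<alpha> \<in> iso (dihedral r) (dihedral r)"
  shows "(\<lambda>(v, g). (v, \<alpha> g)) \<in> iso (semidirect r d (\<psi> \<circ> \<alpha>)) (semidirect r d \<psi>)"
proof (rule isoI)
  have hom: "\<alpha> \<in> hom (dihedral r) (dihedral r)" and bij: "bij_betw \<alpha> (carrier (dihedral r)) (carrier (dihedral r))"
    using \<alpha> by (auto simp: iso_def)
  show "(\<lambda>(v, g). (v, \<alpha> g)) \<in> hom (semidirect r d (\<psi> \<circ> \<alpha>)) (semidirect r d \<psi>)"
    using hom by (intro homI) (auto simp: hom_mult hom_in_carrier simp del: dihedral_mult)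
  have "bij_betw (map_prod id \<alpha>) (carrier_vec d \<times> carrier (dihedral r)) (carrier_vec d \<times> carrier (dihedral r))"
    by (rule bij_betw_map_prod[OF bij_betw_id bij])
  then show "bij_betw (\<lambda>(v, g). (v, \<alpha> g)) (carrier (semidirect r d (\<psi> \<circ> \<alpha>))) (carrier (semidirect r d \<psi>))"
    by (simp add: map_prod_def)
qed

lemma invertible_matE:
  assumes "P \<in> carrier_mat n n" "invertible_mat P"
  obtains B where "B \<in> carrier_mat n n" "P * B = 1\<^sub>m n" "B * P = 1\<^sub>m n"
proof -
  obtain B where B: "P * B = 1\<^sub>m (dim_row P)" "B * P = 1\<^sub>m (dim_row B)"
    using assms(2) by (auto simp: invertible_mat_def inverts_mat_def)
  have "dim_row B = n" "dim_col B = n"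
    using arg_cong[OF B(1), of dim_col] arg_cong[OF B(2), of dim_col] assms(1) by auto
  then show ?thesis using that[of B] B assms(1) by auto
qed

lemma invertible_matI:
  "P \<in> carrier_mat n n \<Longrightarrow> B \<in> carrier_mat n n \<Longrightarrow> P * B = 1\<^sub>m n \<Longrightarrow> B * P = 1\<^sub>m n \<Longrightarrow> invertible_mat P"
  by (auto simp: invertible_mat_def inverts_mat_def square_mat.simps)

text \<open>Besides the group, the generators are prescribed up to the choice of u, with fixed
  projections to D. This is what makes the representation an invariant of the map up to equivalence,
  and not merely up to automorphisms of D.\<close>

definition represents ::
  "nat \<Rightarrow> nat \<Rightarrow> (nat \<times> bool \<Rightarrow> 'p::prime_card mod_ring mat) \<Rightarrow> 'd set \<Rightarrow> ('d \<Rightarrow> 'd) \<Rightarrow> ('d \<Rightarrow> 'd) \<Rightarrow> bool" where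
  "represents r d \<psi> D R L \<longleftrightarrow> dihedral_irrep r d \<psi> \<and>
     (\<exists>u \<beta>. dihedral_irrep.admissible r d \<psi> u \<and>
        labels (semidirect r d \<psi>) (u, (Suc 0, True)) (0\<^sub>v d, (0, True)) \<beta> D R L)"

text \<open>The representation supplied by the definition of the map is known only up to twist. It
  is precomposed with the automorphism of D taking the standard reflections to the projections of a
  and z, after which conjugation by V normalises the vectors.\<close>

lemma exists_represents:
  assumes r: "r \<ge> 3" and p: "odd CARD('p::prime_card)" "\<not> CARD('p::prime_card) dvd r"
    and m: "irreducible_rotary_aug_PX_map TYPE('p::prime_card) r D R L"
  obtains d and \<psi> :: "nat \<times> bool \<Rightarrow> 'p::prime_card mod_ring mat" where "represents r d \<psi> D R L"
proof -
  obtain d and \<psi> :: "nat \<times> bool \<Rightarrow> 'p mod_ring mat" where irr: "irreducible_rep r d \<psi>"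
    and iso: "map_aut_group D R L \<cong> semidirect r d \<psi>"
    and px: "aug_PX_map CARD('p) r D R L" and rot: "rotary D R L"
    using m unfolding irreducible_rotary_aug_PX_map_def by (elim conjE exE)
  interpret dihedral_irrep r d \<psi> by unfold_locales (fact r p irr)+
  have map: "is_map D R L" using px by (simp add: aug_PX_map_def)
  obtain a z \<beta> where l: "labels G a z \<beta> D R L" by (rule rotary_map_labels[OF G.is_group map rot iso])
  have pp: "CARD('p) > 0" by simp
  have a2p: "a [^]\<^bsub>G\<^esub> (2 * CARD('p)) = \<one>\<^bsub>G\<^esub>"
    by (rule aug_PX_map_pow[OF G.is_group finite_G l px pp]) simp
  note gen = labels_generated[OF G.is_group l map]
  have ac: "snd a \<in> carrier (dihedral r)" "snd z \<in> carrier (dihedral r)" "fst a \<in> V" "fst z \<in> V"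
    using labelsD(1,2)[OF l] by auto
  have ap: "snd a [^]\<^bsub>dihedral r\<^esub> (2 * CARD('p)) = \<one>\<^bsub>dihedral r\<^esub>"
    using a2p by (metis dihedral_one semidirect_one snd_conv snd_semidirect_pow)
  have zp: "snd z \<otimes>\<^bsub>dihedral r\<^esub> snd z = \<one>\<^bsub>dihedral r\<^esub>"
    using gen(2) by (metis dihedral_one semidirect_one snd_conv snd_semidirect_mult)
  have gen': "carrier (dihedral r) \<subseteq> generated_by (dihedral r) (snd a) (snd z)"
  proof
    fix g assume "g \<in> carrier (dihedral r)"
    then have "(0\<^sub>v d, g) \<in> carrier G" by simp
    then have "(0\<^sub>v d, g) \<in> generated_by G a z" using gen(1) by blast
    from snd_generated_by[OF this] show "g \<in> generated_by (dihedral r) (snd a) (snd z)" by simp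
  qed
  have cop: "coprime CARD('p) r" using p(2) prime_card[where 'a='p] by (simp add: prime_imp_coprime)
  obtain \<alpha> where \<alpha>: "\<alpha> \<in> iso (dihedral r) (dihedral r)" "\<alpha> (Suc 0, True) = snd a" "\<alpha> (0, True) = snd z"
    by (rule dihedral_generating_pair[OF r cop ac(1) ap ac(2) zp gen'])
  have irr': "irreducible_rep r d (\<psi> \<circ> \<alpha>)" by (rule irreducible_rep_twist[OF irr \<alpha>(1)]) simp
  interpret T: dihedral_irrep r d "\<psi> \<circ> \<alpha>" by unfold_locales (fact r p irr')+
  have "labels (semidirect r d (\<psi> \<circ> \<alpha>)) (fst a, (Suc 0, True)) (fst z, (0, True)) (\<beta> \<circ> (\<lambda>(v, g). (v, \<alpha> g))) D R L"
    by (rule labels_iso[OF l semidirect_twist_iso[OF \<alpha>(1)]]) (use ac \<alpha> in auto)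
  then have "\<exists>u \<beta>'. T.admissible u \<and> labels T.G (u, (Suc 0, True)) (0\<^sub>v d, (0, True)) \<beta>' D R L"
    by (rule T.exists_admissible_labels[OF _ map])
  then have "represents r d (\<psi> \<circ> \<alpha>) D R L"
    unfolding represents_def using T.dihedral_irrep_axioms by (intro conjI)
  then show ?thesis by (rule that)
qed

text \<open>The intertwiner P induces an isomorphism of the two groups over the identity of D and
  takes u to an admissible vector; transitivity on admissible vectors then moves P u to u'.\<close>

lemma map_iso_if_rep_equiv:
  assumes 1: "represents r d \<psi> D R L" and 2: "represents r d' \<psi>' D' R' L'"
    and eq: "((d, \<psi>), (d', \<psi>')) \<in> rep_equiv r"
  shows "map_iso D R L D' R' L'"
proof -
  have d: "d' = d" using eq by (simp add: rep_equiv_def)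
  interpret X: dihedral_irrep r d \<psi> using 1 by (simp add: represents_def)
  interpret Y: dihedral_irrep r d \<psi>' using 2 d by (simp add: represents_def)
  obtain u \<beta> where u: "X.admissible u" and l: "labels X.G (u, (Suc 0, True)) (0\<^sub>v d, (0, True)) \<beta> D R L"
    using 1 by (auto simp: represents_def)
  obtain u' \<beta>' where u': "Y.admissible u'" and l': "labels Y.G (u', (Suc 0, True)) (0\<^sub>v d, (0, True)) \<beta>' D' R' L'"
    using 2 d by (auto simp: represents_def)
  obtain P where P: "P \<in> carrier_mat d d" "invertible_mat P"
    and comm: "\<And>g. g \<in> carrier (dihedral r) \<Longrightarrow> P * \<psi> g = \<psi>' g * P"
    using eq d by (auto simp: rep_equiv_def)
  obtain B where Bc: "B \<in> carrier_mat d d" and B: "P * B = 1\<^sub>m d" "B * P = 1\<^sub>m d"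
    by (rule invertible_matE[OF P])
  have PV: "P *\<^sub>v v \<in> carrier_vec d" "B *\<^sub>v v \<in> carrier_vec d" if "v \<in> carrier_vec d" for v
    using P(1) Bc that by auto
  have BP: "B *\<^sub>v (P *\<^sub>v v) = v" "P *\<^sub>v (B *\<^sub>v v) = v" if "v \<in> carrier_vec d" for v
    using assoc_mult_mat_vec[OF Bc P(1) that] assoc_mult_mat_vec[OF P(1) Bc that] B P(1) Bc that by auto
  have bij: "bij_betw (\<lambda>v. P *\<^sub>v v) (carrier_vec d) (carrier_vec d)"
    by (rule bij_betwI[where g="\<lambda>v. B *\<^sub>v v"]) (use PV BP in auto)
  have comm': "P *\<^sub>v (\<psi> g *\<^sub>v v) = \<psi>' g *\<^sub>v (P *\<^sub>v v)" if "g \<in> carrier (dihedral r)" "v \<in> carrier_vec d" for g v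
    using comm[OF that(1)] assoc_mult_mat_vec[OF P(1) X.rep_carrier[OF that(1)] that(2)]
      assoc_mult_mat_vec[OF Y.rep_carrier[OF that(1)] P(1) that(2)] by simp
  have Padd: "P *\<^sub>v (v + w) = P *\<^sub>v v + P *\<^sub>v w" if "v \<in> carrier_vec d" "w \<in> carrier_vec d" for v w
    using P(1) that by (rule mult_add_distrib_mat_vec)
  have P0: "P *\<^sub>v 0\<^sub>v d = 0\<^sub>v d" using P(1) by (intro eq_vecI) auto
  have uV: "u \<in> carrier_vec d" "u \<noteq> 0\<^sub>v d" using u by (auto simp: X.admissible_def)
  have adm: "Y.admissible (P *\<^sub>v u)"
  proof -
    have ne: "P *\<^sub>v u \<noteq> 0\<^sub>v d"
    proof
      assume "P *\<^sub>v u = 0\<^sub>v d"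
      then have "P *\<^sub>v u = P *\<^sub>v 0\<^sub>v d" by (simp only: P0)
      then show False using uV inj_onD[OF bij_betw_imp_inj_on[OF bij], of u "0\<^sub>v d"] by simp
    qed
    have APu: "Y.A (P *\<^sub>v u) = P *\<^sub>v X.A u" using comm'[of "(Suc 0, True)" u] uV by simp
    have Pneg: "P *\<^sub>v (- u) = - (P *\<^sub>v u)" using P(1) uV by (intro eq_vecI) auto
    have rotY: "\<forall>v\<in>carrier_vec d. Y.rot 1 v = v" if rot: "\<forall>v\<in>carrier_vec d. X.rot 1 v = v"
    proof
      fix v :: "'a mod_ring vec" assume v: "v \<in> carrier_vec d"
      have "Y.rot 1 (P *\<^sub>v (B *\<^sub>v v)) = P *\<^sub>v X.rot 1 (B *\<^sub>v v)"
        unfolding X.rot_def Y.rot_def using comm'[of "(nat (1 mod int r), False)" "B *\<^sub>v v"] PV[OF v] by simp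
      then show "Y.rot 1 v = v" using rot PV[OF v] BP[OF v] by simp
    qed
    have "X.A u = u \<or> X.A u = - u \<and> (\<forall>v\<in>carrier_vec d. X.rot 1 v = v)"
      using u unfolding X.admissible_def by (elim conjE)
    then have "Y.A (P *\<^sub>v u) = P *\<^sub>v u \<or> Y.A (P *\<^sub>v u) = - (P *\<^sub>v u) \<and> (\<forall>v\<in>carrier_vec d. Y.rot 1 v = v)"
    proof (elim disjE conjE)
      assume "X.A u = u"
      then show ?thesis unfolding APu by simp
    next
      assume *: "X.A u = - u" and rot: "\<forall>v\<in>carrier_vec d. X.rot 1 v = v"
      show ?thesis unfolding APu * Pneg by (intro disjI2 conjI rotY[OF rot] refl)
    qed
    then show ?thesis unfolding Y.admissible_def by (intro conjI ne PV(1)[OF uV(1)])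
  qed
  obtain \<kappa> where \<kappa>: "\<kappa> \<in> iso Y.G Y.G" "\<kappa> (P *\<^sub>v u, (Suc 0, True)) = (u', (Suc 0, True))"
    "\<kappa> (0\<^sub>v d, (0, True)) = (0\<^sub>v d, (0, True))"
    using Y.admissible_transitive[OF adm u'] by (elim bexE conjE)
  have l'': "labels Y.G (P *\<^sub>v u, (Suc 0, True)) (0\<^sub>v d, (0, True)) (\<beta>' \<circ> \<kappa>) D' R' L'"
    by (rule labels_iso[OF l' \<kappa>(1) _ _ \<kappa>(2,3)]) (use PV uV in auto)
  have "(\<lambda>(v, g). (P *\<^sub>v v, g)) \<in> iso X.G Y.G"
    by (rule semidirect_iso[OF bij Padd comm']) auto
  then show ?thesis
    by (rule map_iso_if_group_iso[OF X.G.is_group l l'']) (use P0 in auto)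
qed

text \<open>The group isomorphism matches generators with equal projections, so it induces the
  identity on D and maps V to V. Applying it to (0, g)(v, 1) = (g v, 1)(0, g) shows that its
  restriction to V is equivariant; the dimensions agree by cardinality.\<close>

lemma rep_equiv_if_map_iso:
  fixes \<psi> :: "nat \<times> bool \<Rightarrow> 'p::prime_card mod_ring mat" and \<psi>' :: "nat \<times> bool \<Rightarrow> 'p mod_ring mat"
  assumes 1: "represents r d \<psi> D R L" and 2: "represents r d' \<psi>' D' R' L'"
    and iso: "map_iso D R L D' R' L'"
  shows "((d, \<psi>), (d', \<psi>')) \<in> rep_equiv r"
proof -
  interpret X: dihedral_irrep r d \<psi> using 1 by (simp add: represents_def)
  interpret Y: dihedral_irrep r d' \<psi>' using 2 by (simp add: represents_def)
  obtain u \<beta> where u: "X.admissible u" and l: "labels X.G (u, (Suc 0, True)) (0\<^sub>v d, (0, True)) \<beta> D R L"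
    using 1 by (auto simp: represents_def)
  obtain u' \<beta>' where u': "Y.admissible u'" and l': "labels Y.G (u', (Suc 0, True)) (0\<^sub>v d', (0, True)) \<beta>' D' R' L'"
    using 2 by (auto simp: represents_def)
  note gen = X.generated_by_admissible[OF u]
  obtain \<kappa> where \<kappa>: "\<kappa> \<in> iso X.G Y.G" "\<kappa> (u, (Suc 0, True)) = (u', (Suc 0, True))"
    "\<kappa> (0\<^sub>v d, (0, True)) = (0\<^sub>v d', (0, True))"
    by (rule group_iso_if_map_iso[OF X.G.is_group Y.G.is_group l l' gen iso])
  have hom: "\<kappa> \<in> hom X.G Y.G" and bij: "bij_betw \<kappa> (carrier X.G) (carrier Y.G)"
    using \<kappa>(1) by (auto simp: iso_def)
  have "card (carrier X.G) = card (carrier Y.G)" using bij by (rule bij_betw_same_card)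
  then have "CARD('p) ^ d = CARD('p) ^ d'"
    unfolding X.card_G Y.card_G by (simp add: card_carrier_vec)
  then have dd: "d' = d" using power_inject_exp[of "CARD('p)" d d'] prime_gt_1_nat[OF prime_card[where 'a='p]] by simp
  have \<kappa>mult: "\<kappa> (x \<otimes>\<^bsub>X.G\<^esub> y) = \<kappa> x \<otimes>\<^bsub>Y.G\<^esub> \<kappa> y" if "x \<in> carrier X.G" "y \<in> carrier X.G" for x y
    using hom_mult[OF hom that] .
  have snd\<kappa>: "snd (\<kappa> x) = snd x" if "x \<in> generated_by X.G (u, (Suc 0, True)) (0\<^sub>v d, (0, True))" for x
    using that
  proof induction
    case one
    have "\<kappa> \<one>\<^bsub>X.G\<^esub> = \<one>\<^bsub>Y.G\<^esub>" by (rule hom_one[OF hom X.G.is_group Y.G.is_group])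
    then show ?case by simp
  next
    case (left x)
    have "x \<in> carrier X.G" using left X.G.generated_by_subset[OF labelsD(1,2)[OF l]] by blast
    then have "\<kappa> (x \<otimes>\<^bsub>X.G\<^esub> (u, (Suc 0, True))) = \<kappa> x \<otimes>\<^bsub>Y.G\<^esub> (u', (Suc 0, True))"
      using \<kappa>mult[OF _ labelsD(1)[OF l]] \<kappa>(2) by simp
    then show ?case using left by (simp add: snd_semidirect_mult del: dihedral_mult)
  next
    case (right x)
    have "x \<in> carrier X.G" using right X.G.generated_by_subset[OF labelsD(1,2)[OF l]] by blast
    then have "\<kappa> (x \<otimes>\<^bsub>X.G\<^esub> (0\<^sub>v d, (0, True))) = \<kappa> x \<otimes>\<^bsub>Y.G\<^esub> (0\<^sub>v d', (0, True))"
      using \<kappa>mult[OF _ labelsD(2)[OF l]] \<kappa>(3) by simp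
    then show ?case using right by (simp add: snd_semidirect_mult del: dihedral_mult)
  qed
  have \<kappa>c: "\<kappa> x \<in> carrier Y.G" if "x \<in> carrier X.G" for x using bij that by (auto simp: bij_betw_def)
  define P where "P v = fst (\<kappa> (v, (0, False)))" for v
  have \<kappa>P: "\<kappa> (v, (0, False)) = (P v, (0, False))" if v: "v \<in> carrier_vec d" for v
  proof -
    have "snd (\<kappa> (v, (0, False))) = snd (v, (0, False))"
      by (rule snd\<kappa>[OF subsetD[OF gen]]) (use v in simp)
    then show ?thesis by (simp add: P_def prod_eq_iff)
  qed
  have PV: "P v \<in> carrier_vec d" if v: "v \<in> carrier_vec d" for v
    using \<kappa>c[of "(v, (0, False))"] \<kappa>P[OF v] v dd by simp
  have Padd: "P (v + w) = P v + P w" if vw: "v \<in> carrier_vec d" "w \<in> carrier_vec d" for v w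
  proof -
    have "\<kappa> ((v, (0, False)) \<otimes>\<^bsub>X.G\<^esub> (w, (0, False))) = (P v, (0, False)) \<otimes>\<^bsub>Y.G\<^esub> (P w, (0, False))"
      using \<kappa>mult[of "(v, (0, False))" "(w, (0, False))"] vw \<kappa>P by simp
    then show ?thesis using vw PV[OF vw(2)] dd by (simp add: \<kappa>P)
  qed
  have Pcomm: "P (\<psi> g *\<^sub>v v) = \<psi>' g *\<^sub>v P v" if gv: "g \<in> carrier (dihedral r)" "v \<in> carrier_vec d" for g v
  proof -
    have g: "(0\<^sub>v d, g) \<in> carrier X.G" using gv by simp
    have "snd (\<kappa> (0\<^sub>v d, g)) = snd (0\<^sub>v d :: 'p mod_ring vec, g)"
      by (rule snd\<kappa>[OF subsetD[OF gen g]])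
    \<comment> \<open>The complement D need not be mapped to itself, but the error t is a
      translation and cancels since V is abelian.\<close>
    then obtain t where t: "\<kappa> (0\<^sub>v d, g) = (t, g)" by (metis prod.collapse snd_conv)
    have tV: "t \<in> carrier_vec d" using \<kappa>c[OF g] t dd by simp
    have g1: "(0, False) \<otimes>\<^bsub>dihedral r\<^esub> g = g" "g \<otimes>\<^bsub>dihedral r\<^esub> (0, False) = g"
      using X.D.l_one[OF gv(1)] X.D.r_one[OF gv(1)] by simp_all
    have gV: "\<psi> g *\<^sub>v v \<in> carrier_vec d" "\<psi>' g *\<^sub>v P v \<in> carrier_vec d"
      using gv PV[OF gv(2)] Y.act_closed dd by auto
    have "(0\<^sub>v d, g) \<otimes>\<^bsub>X.G\<^esub> (v, (0, False)) = (\<psi> g *\<^sub>v v, (0, False)) \<otimes>\<^bsub>X.G\<^esub> (0\<^sub>v d, g)"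
      using gv gV by (simp add: g1 del: dihedral_mult)
    then have "\<kappa> (0\<^sub>v d, g) \<otimes>\<^bsub>Y.G\<^esub> \<kappa> (v, (0, False)) = \<kappa> (\<psi> g *\<^sub>v v, (0, False)) \<otimes>\<^bsub>Y.G\<^esub> \<kappa> (0\<^sub>v d, g)"
      using \<kappa>mult[OF g, of "(v, (0, False))"] \<kappa>mult[of "(\<psi> g *\<^sub>v v, (0, False))", OF _ g] gv gV by simp
    then have eq: "t + \<psi>' g *\<^sub>v P v = P (\<psi> g *\<^sub>v v) + t"
      using gv gV tV dd by (simp add: t \<kappa>P g1 del: dihedral_mult)
    have "(t + \<psi>' g *\<^sub>v P v) $ i = (P (\<psi> g *\<^sub>v v) + t) $ i" for i by (simp only: eq)
    then have "P (\<psi> g *\<^sub>v v) $ i = (\<psi>' g *\<^sub>v P v) $ i" if "i < d" for i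
      using that gV(2) tV PV[OF gV(1)] by (metis add.commute add_left_cancel carrier_vecD index_add_vec(1))
    then show ?thesis
      using carrier_vecD[OF PV[OF gV(1)]] carrier_vecD[OF gV(2)] by (intro eq_vecI) (simp_all only:)
  qed
  have inj: "inj_on P (carrier_vec d)"
  proof (rule inj_onI)
    fix v w assume vw: "v \<in> carrier_vec d" "w \<in> carrier_vec d" "P v = P w"
    then have "\<kappa> (v, (0, False)) = \<kappa> (w, (0, False))" by (simp add: \<kappa>P)
    then show "v = w" using vw inj_onD[OF bij_betw_imp_inj_on[OF bij], of "(v, (0, False))" "(w, (0, False))"] by simp
  qed
  have surj: "P ` carrier_vec d = carrier_vec d"
    using inj PV by (intro endo_inj_surj) auto
  define B where "B = inv_into (carrier_vec d) P"
  have BV: "B v \<in> carrier_vec d" and PB: "P (B v) = v" if "v \<in> carrier_vec d" for v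
    using that surj by (auto simp: B_def inv_into_into f_inv_into_f)
  have BP: "B (P v) = v" if "v \<in> carrier_vec d" for v using that inj by (simp add: B_def)
  have Badd: "B (v + w) = B v + B w" if "v \<in> carrier_vec d" "w \<in> carrier_vec d" for v w
  proof -
    have "B (v + w) = B (P (B v) + P (B w))" using that by (simp add: PB)
    also have "\<dots> = B (P (B v + B w))" using that BV by (simp add: Padd)
    also have "\<dots> = B v + B w" using that BV by (simp add: BP)
    finally show ?thesis .
  qed
  obtain M where M: "M \<in> carrier_mat d d" "\<forall>v\<in>carrier_vec d. P v = M *\<^sub>v v"
    using additive_matrix[of d P] PV Padd by blast
  obtain N where N: "N \<in> carrier_mat d d" "\<forall>v\<in>carrier_vec d. B v = N *\<^sub>v v"
    using additive_matrix[of d B] BV Badd by blast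
  have "M * N = 1\<^sub>m d"
  proof (rule mat_eq_if_mult_vec_eq[of _ d])
    fix v :: "'p mod_ring vec" assume v: "v \<in> carrier_vec d"
    have "(M * N) *\<^sub>v v = M *\<^sub>v (N *\<^sub>v v)" by (rule assoc_mult_mat_vec[OF M(1) N(1) v])
    then show "(M * N) *\<^sub>v v = 1\<^sub>m d *\<^sub>v v" using PB[OF v] BV[OF v] v by (simp add: M(2) N(2))
  qed (use M(1) N(1) in auto)
  moreover have "N * M = 1\<^sub>m d"
  proof (rule mat_eq_if_mult_vec_eq[of _ d])
    fix v :: "'p mod_ring vec" assume v: "v \<in> carrier_vec d"
    have "(N * M) *\<^sub>v v = N *\<^sub>v (M *\<^sub>v v)" by (rule assoc_mult_mat_vec[OF N(1) M(1) v])
    then show "(N * M) *\<^sub>v v = 1\<^sub>m d *\<^sub>v v" using BP[OF v] PV[OF v] v by (simp add: M(2) N(2))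
  qed (use M(1) N(1) in auto)
  ultimately have "invertible_mat M" using M(1) N(1) by (auto simp: invertible_mat_def inverts_mat_def square_mat.simps)
  moreover have "M * \<psi> g = \<psi>' g * M" if g: "g \<in> carrier (dihedral r)" for g
  proof (rule mat_eq_if_mult_vec_eq[of _ d])
    have c: "\<psi> g \<in> carrier_mat d d" "\<psi>' g \<in> carrier_mat d d" using g Y.rep_carrier dd by auto
    show "M * \<psi> g \<in> carrier_mat d d" "\<psi>' g * M \<in> carrier_mat d d" using M(1) c by auto
    fix v :: "'p mod_ring vec" assume v: "v \<in> carrier_vec d"
    have "(M * \<psi> g) *\<^sub>v v = M *\<^sub>v (\<psi> g *\<^sub>v v)" by (rule assoc_mult_mat_vec[OF M(1) c(1) v])
    also have "\<dots> = P (\<psi> g *\<^sub>v v)" using M(2) g v by simp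
    also have "\<dots> = \<psi>' g *\<^sub>v (M *\<^sub>v v)" using Pcomm[OF g v] M(2) v by simp
    also have "\<dots> = (\<psi>' g * M) *\<^sub>v v" by (rule assoc_mult_mat_vec[OF c(2) M(1) v, symmetric])
    finally show "(M * \<psi> g) *\<^sub>v v = (\<psi>' g * M) *\<^sub>v v" .
  qed
  ultimately show ?thesis using M(1) dd by (auto simp: rep_equiv_def)
qed

section \<open>Counting classes\<close>

text \<open>The correspondence is a relation because a map has many representing functions and
  conversely. Equality of classes is controlled only on A and B, since the relations in use are not
  equivalences on their whole types: \<open>map_iso\<close> can fail to be symmetric off genuine
  maps, and \<open>rep_equiv\<close> can fail to be reflexive off genuine representations.\<close>

lemma card_quotient_eq:
  assumes r1: "\<And>x x'. x \<in> A \<Longrightarrow> x' \<in> A \<Longrightarrow> r1 `` {x} = r1 `` {x'} \<longleftrightarrow> (x, x') \<in> r1"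
    and r2: "\<And>y y'. y \<in> B \<Longrightarrow> y' \<in> B \<Longrightarrow> r2 `` {y} = r2 `` {y'} \<longleftrightarrow> (y, y') \<in> r2"
    and left: "\<And>x. x \<in> A \<Longrightarrow> \<exists>y\<in>B. T x y" and right: "\<And>y. y \<in> B \<Longrightarrow> \<exists>x\<in>A. T x y"
    and T: "\<And>x x' y y'. x \<in> A \<Longrightarrow> x' \<in> A \<Longrightarrow> y \<in> B \<Longrightarrow> y' \<in> B \<Longrightarrow> T x y \<Longrightarrow> T x' y' \<Longrightarrow>
      (x, x') \<in> r1 \<longleftrightarrow> (y, y') \<in> r2"
  shows "card (A // r1) = card (B // r2)"
proof -
  obtain t where t: "\<forall>x\<in>A. t x \<in> B \<and> T x (t x)" using bchoice[of A "\<lambda>x y. y \<in> B \<and> T x y"] left by blast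
  have "r1 `` {x} = r1 `` {x'} \<longleftrightarrow> r2 `` {t x} = r2 `` {t x'}" if "x \<in> A" "x' \<in> A" for x x'
    using r1[OF that] r2[of "t x" "t x'"] T[of x x' "t x" "t x'"] t that by simp
  then obtain h where "bij_betw h ((\<lambda>x. r1 `` {x}) ` A) ((\<lambda>x. r2 `` {t x}) ` A)"
    using bij_betw_quotient[of A "\<lambda>x. r1 `` {x}" "\<lambda>x. r2 `` {t x}"] by metis
  moreover have "(\<lambda>x. r1 `` {x}) ` A = A // r1" by (auto simp: quotient_def)
  moreover have "(\<lambda>x. r2 `` {t x}) ` A = B // r2"
  proof
    show "(\<lambda>x. r2 `` {t x}) ` A \<subseteq> B // r2" using t by (auto intro: quotientI)
    show "B // r2 \<subseteq> (\<lambda>x. r2 `` {t x}) ` A"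
    proof
      fix c assume "c \<in> B // r2"
      then obtain y where y: "y \<in> B" "c = r2 `` {y}" by (auto elim: quotientE)
      obtain x where x: "x \<in> A" "T x y" using right[OF y(1)] by blast
      have tx: "t x \<in> B" "T x (t x)" using t x(1) by auto
      have "(x, x) \<in> r1" using r1[OF x(1) x(1)] by simp
      then have "(y, t x) \<in> r2" using T[OF x(1) x(1) y(1) tx(1) x(2) tx(2)] by simp
      then have "c = r2 `` {t x}" using r2[OF y(1) tx(1)] y by simp
      then show "c \<in> (\<lambda>x. r2 `` {t x}) ` A" using x by blast
    qed
  qed
  ultimately show ?thesis by (simp add: bij_betw_same_card)
qed

lemma map_iso_refl: "map_iso D R L D R L"
  unfolding map_iso_def by (intro exI[of _ id]) simp

lemma map_iso_trans:
  assumes "map_iso D R L D' R' L'" "map_iso D' R' L' D'' R'' L''"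
  shows "map_iso D R L D'' R'' L''"
proof -
  obtain f where f: "bij_betw f D D'" "\<forall>x\<in>D. f (R x) = R' (f x) \<and> f (L x) = L' (f x)"
    using assms(1) by (auto simp: map_iso_def)
  obtain g where g: "bij_betw g D' D''" "\<forall>x\<in>D'. g (R' x) = R'' (g x) \<and> g (L' x) = L'' (g x)"
    using assms(2) by (auto simp: map_iso_def)
  have "bij_betw (g \<circ> f) D D''" using f(1) g(1) by (rule bij_betw_trans)
  moreover have "\<forall>x\<in>D. (g \<circ> f) (R x) = R'' ((g \<circ> f) x) \<and> (g \<circ> f) (L x) = L'' ((g \<circ> f) x)"
    using f g bij_betwE[OF f(1)] by simp
  ultimately show ?thesis unfolding map_iso_def by blast
qed

lemma map_iso_sym:
  assumes m: "is_map D R L" and "map_iso D R L D' R' L'"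
  shows "map_iso D' R' L' D R L"
proof -
  obtain f where f: "bij_betw f D D'" "\<And>x. x \<in> D \<Longrightarrow> f (R x) = R' (f x)" "\<And>x. x \<in> D \<Longrightarrow> f (L x) = L' (f x)"
    using assms(2) by (auto simp: map_iso_def)
  have RL: "R x \<in> D" "L x \<in> D" if "x \<in> D" for x
    using m that by (auto simp: is_map_def permutes_in_image)
  have "inv_into D f (R' y) = R (inv_into D f y) \<and> inv_into D f (L' y) = L (inv_into D f y)" if y: "y \<in> D'" for y
  proof -
    have x: "inv_into D f y \<in> D" "f (inv_into D f y) = y"
      using f(1) y by (auto simp: bij_betw_def inv_into_into f_inv_into_f)
    have "R' y = f (R (inv_into D f y))" "L' y = f (L (inv_into D f y))"
      using f(2,3)[OF x(1)] x(2) by auto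
    then show ?thesis using RL[OF x(1)] f(1) by (simp add: bij_betw_def)
  qed
  then show ?thesis unfolding map_iso_def using bij_betw_inv_into[OF f(1)] by blast
qed

text \<open>No dimension condition on \<open>X\<close>: the classes of \<^const>\<open>rep_equiv\<close> may contain functions
  whose values are not \<open>n \<times> n\<close> matrices.\<close>

lemma assoc_mult_square_mat:
  fixes X P Q :: "'a::comm_semiring_1 mat"
  assumes "P \<in> carrier_mat n n" "Q \<in> carrier_mat n n"
  shows "X * P * Q = X * (P * Q)"
proof (rule eq_matI)
  fix i j assume "i < dim_row (X * (P * Q))" "j < dim_col (X * (P * Q))"
  then have ij: "i < dim_row X" "j < n" using assms by auto
  have "(X * P * Q) $$ (i, j) = (\<Sum>k<n. (\<Sum>l<n. row X i $ l * P $$ (l, k)) * Q $$ (k, j))"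
    using ij assms by (simp add: scalar_prod_def atLeast0LessThan)
  also have "\<dots> = (\<Sum>k<n. \<Sum>l<n. row X i $ l * (P $$ (l, k) * Q $$ (k, j)))"
    by (simp add: sum_distrib_right mult.assoc)
  also have "\<dots> = (\<Sum>l<n. \<Sum>k<n. row X i $ l * (P $$ (l, k) * Q $$ (k, j)))"
    by (rule sum.swap)
  also have "\<dots> = (X * (P * Q)) $$ (i, j)"
    using ij assms by (simp add: scalar_prod_def atLeast0LessThan sum_distrib_left)
  finally show "(X * P * Q) $$ (i, j) = (X * (P * Q)) $$ (i, j)" .
qed (use assms in auto)

lemma rep_equiv_refl:
  assumes "irreducible_rep r d \<psi>"
  shows "((d, \<psi>), (d, \<psi>)) \<in> rep_equiv r"
proof -
  have "1\<^sub>m d * \<psi> g = \<psi> g * 1\<^sub>m d" if "g \<in> carrier (dihedral r)" for g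
    using assms that left_mult_one_mat[of "\<psi> g" d d] right_mult_one_mat[of "\<psi> g" d d]
    by (simp add: irreducible_rep_def is_rep_def)
  moreover have "invertible_mat (1\<^sub>m d :: 'a mat)" by (rule invertible_matI[of _ d "1\<^sub>m d"]) auto
  ultimately show ?thesis by (auto simp: rep_equiv_def intro!: bexI[of _ "1\<^sub>m d"])
qed

lemma rep_equiv_sym:
  assumes irr: "irreducible_rep r d \<psi>" "irreducible_rep r d' \<psi>'" and eq: "((d, \<psi>), (d', \<psi>')) \<in> rep_equiv r"
  shows "((d', \<psi>'), (d, \<psi>)) \<in> rep_equiv r"
proof -
  have d: "d' = d" using eq by (simp add: rep_equiv_def)
  obtain P where P: "P \<in> carrier_mat d d" "invertible_mat P"
    and comm: "\<And>g. g \<in> carrier (dihedral r) \<Longrightarrow> P * \<psi> g = \<psi>' g * P"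
    using eq by (auto simp: rep_equiv_def)
  obtain B where B: "B \<in> carrier_mat d d" "P * B = 1\<^sub>m d" "B * P = 1\<^sub>m d" by (rule invertible_matE[OF P])
  have "B * \<psi>' g = \<psi> g * B" if g: "g \<in> carrier (dihedral r)" for g
  proof -
    have c: "\<psi> g \<in> carrier_mat d d" "\<psi>' g \<in> carrier_mat d d"
      using irr g d by (auto simp: irreducible_rep_def is_rep_def)
    have "B * \<psi>' g = B * (\<psi>' g * (P * B))" using B c by simp
    also have "\<dots> = B * (P * \<psi> g * B)" using B(1) P(1) c by (simp add: assoc_mult_square_mat[of _ d] comm[OF g])
    also have "\<dots> = (B * P) * (\<psi> g * B)" using B(1) P(1) c by (simp add: assoc_mult_square_mat[of _ d])
    also have "\<dots> = \<psi> g * B" using B c by simp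
    finally show ?thesis .
  qed
  moreover have "invertible_mat B" by (rule invertible_matI[OF B(1) P(1) B(3,2)])
  ultimately show ?thesis using B(1) d by (auto simp: rep_equiv_def)
qed

lemma rep_equiv_trans:
  assumes irr: "irreducible_rep r d \<psi>" "irreducible_rep r d' \<psi>'"
    and eq: "((d, \<psi>), (d', \<psi>')) \<in> rep_equiv r" "((d', \<psi>'), (d'', \<chi>)) \<in> rep_equiv r"
  shows "((d, \<psi>), (d'', \<chi>)) \<in> rep_equiv r"
proof -
  have d: "d' = d" "d'' = d" using eq by (auto simp: rep_equiv_def)
  obtain P where P: "P \<in> carrier_mat d d" "invertible_mat P"
    and comm: "\<And>g. g \<in> carrier (dihedral r) \<Longrightarrow> P * \<psi> g = \<psi>' g * P"
    using eq(1) by (auto simp: rep_equiv_def)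
  obtain Q where Q: "Q \<in> carrier_mat d d" "invertible_mat Q"
    and comm': "\<And>g. g \<in> carrier (dihedral r) \<Longrightarrow> Q * \<psi>' g = \<chi> g * Q"
    using eq(2) d by (auto simp: rep_equiv_def)
  obtain B where B: "B \<in> carrier_mat d d" "P * B = 1\<^sub>m d" "B * P = 1\<^sub>m d" by (rule invertible_matE[OF P])
  obtain C where C: "C \<in> carrier_mat d d" "Q * C = 1\<^sub>m d" "C * Q = 1\<^sub>m d" by (rule invertible_matE[OF Q])
  note assoc = assoc_mult_square_mat[of _ d]
  have "Q * P * (B * C) = Q * (P * B) * C" using P(1) Q(1) B(1) C(1) by (simp add: assoc)
  then have 1: "Q * P * (B * C) = 1\<^sub>m d" using Q(1) B C by simp
  have "B * C * (Q * P) = B * (C * Q) * P" using P(1) Q(1) B(1) C(1) by (simp add: assoc)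
  then have 2: "B * C * (Q * P) = 1\<^sub>m d" using P(1) B C by simp
  have "invertible_mat (Q * P)"
    by (rule invertible_matI[OF _ _ 1 2]) (use P(1) Q(1) B(1) C(1) in auto)
  moreover have "Q * P * \<psi> g = \<chi> g * (Q * P)" if g: "g \<in> carrier (dihedral r)" for g
  proof -
    have c: "\<psi> g \<in> carrier_mat d d" "\<psi>' g \<in> carrier_mat d d"
      using irr g d by (auto simp: irreducible_rep_def is_rep_def)
    have "Q * P * \<psi> g = Q * (\<psi>' g * P)" using P(1) Q(1) c by (simp add: assoc comm[OF g])
    also have "\<dots> = \<chi> g * Q * P" using P(1) Q(1) c by (simp add: assoc flip: comm'[OF g])
    also have "\<dots> = \<chi> g * (Q * P)" using P(1) Q(1) by (simp add: assoc)
    finally show ?thesis .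
  qed
  ultimately show ?thesis using P(1) Q(1) d by (auto simp: rep_equiv_def intro!: bexI[of _ "Q * P"])
qed

lemma rep_equiv_class_eq_iff:
  assumes irr: "irreducible_rep r d \<psi>" "irreducible_rep r d' \<psi>'"
  shows "rep_equiv r `` {(d, \<psi>)} = rep_equiv r `` {(d', \<psi>')} \<longleftrightarrow> ((d, \<psi>), (d', \<psi>')) \<in> rep_equiv r"
proof
  assume "rep_equiv r `` {(d, \<psi>)} = rep_equiv r `` {(d', \<psi>')}"
  moreover have "(d', \<psi>') \<in> rep_equiv r `` {(d', \<psi>')}" using rep_equiv_refl[OF irr(2)] by simp
  ultimately have "(d', \<psi>') \<in> rep_equiv r `` {(d, \<psi>)}" by simp
  then show "((d, \<psi>), (d', \<psi>')) \<in> rep_equiv r" by simp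
next
  assume eq: "((d, \<psi>), (d', \<psi>')) \<in> rep_equiv r"
  note eq' = rep_equiv_sym[OF irr eq]
  show "rep_equiv r `` {(d, \<psi>)} = rep_equiv r `` {(d', \<psi>')}"
  proof (rule Set.set_eqI)
    fix y :: "nat \<times> (nat \<times> bool \<Rightarrow> 'a mat)"
    obtain e \<chi> where y: "y = (e, \<chi>)" by (cases y)
    show "y \<in> rep_equiv r `` {(d, \<psi>)} \<longleftrightarrow> y \<in> rep_equiv r `` {(d', \<psi>')}"
      unfolding y Image_singleton_iff
      using rep_equiv_trans[OF irr eq, of e \<chi>] rep_equiv_trans[OF irr(2,1) eq', of e \<chi>] by (rule iffI[rotated])
  qed
qed

section \<open>The exceptional representation\<close>

context dihedral_irrep
begin

text \<open>With rho = A = -1 the relation A = rho Z gives Z = 1, so only the rotation part of an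
  element matters.\<close>

lemma exceptional_act:
  assumes "exceptional" and v: "v \<in> V" and k: "k < r"
  shows "\<psi> (k, e) *\<^sub>v v = (-1) ^ k \<cdot>\<^sub>v v"
proof -
  have rot1: "rot 1 w = - w" and A: "A w = - w" if "w \<in> V" for w
    using assms that by (auto simp: exceptional_def)
  have rot: "rot (int n) w = (-1) ^ n \<cdot>\<^sub>v w" if w: "w \<in> V" for n w
  proof (induction n)
    case 0
    then show ?case using w by simp
  next
    case (Suc n)
    have "rot (int (Suc n)) w = rot 1 (rot (int n) w)" using w by (simp add: rot_rot)
    also have "\<dots> = - ((-1) ^ n \<cdot>\<^sub>v w)" using Suc rot1 w by simp
    also have "\<dots> = (-1) ^ Suc n \<cdot>\<^sub>v w" by (intro eq_vecI) auto
    finally show ?case .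
  qed
  have "- Z v = - v" using A[OF v] A_eq[OF v] rot1[of "Z v"] v by simp
  then have Z: "Z v = v" by simp
  show ?thesis
  proof (cases e)
    case True
    then show ?thesis using act_True[OF k v] rot[OF v] Z by simp
  next
    case False
    then show ?thesis using rot_int[OF k, of v] rot[OF v] by simp
  qed
qed

text \<open>For odd r, rho^-1 = rho^(r-1) would be an even power of -1 and hence trivial, against
  rho = -1 in odd characteristic.\<close>

lemma exceptional_even:
  assumes "exceptional"
  shows "even r"
proof (rule ccontr)
  assume odd: "odd r"
  let ?v = "unit_vec d 0 :: 'p mod_ring vec"
  have v: "?v \<in> V" by simp
  have "(-1) ^ (r - 1) \<cdot>\<^sub>v ?v = rot (int (r - 1)) ?v"
    using exceptional_act[OF assms v, of "r - 1" False] rot_int[of "r - 1" ?v] by simp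
  also have "\<dots> = rot (- 1) ?v" using rot_r(1)[of "-1" ?v] of_nat_diff[of 1 r, where 'a=int] r3 by simp
  finally have "rot (-1) ?v = ?v" using odd by simp
  then have "rot 1 ?v = ?v" using rot_rot[OF v, of 1 "-1"] v by simp
  then have "- ?v = ?v" using assms v by (auto simp: exceptional_def)
  then have "(- ?v) $ 0 = ?v $ 0" by simp
  then show False using d_pos eq_uminus_self_iff(2)[of "1 :: 'p mod_ring"] by simp
qed

text \<open>D acts by scalars, so the rotates of a vector span only a line, whereas by
  irreducibility they span V.\<close>

lemma exceptional_dim:
  assumes "exceptional"
  shows "d = 1"
proof (rule ccontr)
  assume "d \<noteq> 1"
  then have d: "1 < d" using d_pos by simp
  let ?u = "unit_vec d 0 :: 'p mod_ring vec"
  have u: "?u \<in> V" "?u \<noteq> 0\<^sub>v d" using d_pos by auto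
  have "A ?u = (-1) \<cdot>\<^sub>v ?u" using exceptional_act[OF assms u(1), of "Suc 0" True] by simp
  then have span: "rot_span ?u = V" by (rule rot_span_eq_V[OF u])
  have "w \<in> V \<and> w $ 1 = 0" if "w \<in> rot_span ?u" for w
    using that
  proof induction
    case zero
    then show ?case using d by simp
  next
    case (step w c i)
    have "rot i ?u = rot (int (nat (i mod int r))) ?u" by (simp add: rot_mod)
    also have "\<dots> = (-1) ^ nat (i mod int r) \<cdot>\<^sub>v ?u"
      using exceptional_act[OF assms u(1), of "nat (i mod int r)" False] rot_int[of "nat (i mod int r)" ?u] by simp
    finally have "rot i ?u $ 1 = 0" using d by simp
    then show ?case using step d by simp
  qed
  then have "(unit_vec d 1 :: 'p mod_ring vec) $ 1 = 0" using span by simp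
  then show False using d by simp
qed

end

text \<open>The linear character with rho = -1, tau' = 1 and hence tau'' = -1; it respects rho^r = 1
  when r is even.\<close>

definition alternating_rep :: "nat \<times> bool \<Rightarrow> 'a::field mat" where
  "alternating_rep = (\<lambda>(k, e). (-1) ^ k \<cdot>\<^sub>m 1\<^sub>m 1)"

lemma alternating_rep_irreducible:
  assumes "even r" "r > 0"
  shows "irreducible_rep r 1 (alternating_rep :: _ \<Rightarrow> 'a::field mat)"
proof -
  \<comment> \<open>Reduction modulo an even r preserves parity, and addition and subtraction have
    the same parity, so the sign is multiplicative in both branches of the product.\<close>
  have par: "even (n mod r) \<longleftrightarrow> even n" for n using assms by (simp add: dvd_mod_iff)
  have "is_rep r 1 (alternating_rep :: _ \<Rightarrow> 'a mat)"
    unfolding is_rep_def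
  proof (intro conjI ballI)
    fix g h assume gh: "g \<in> carrier (dihedral r)" "h \<in> carrier (dihedral r)"
    obtain k e l f where [simp]: "g = (k, e)" "h = (l, f)" by (cases g; cases h)
    have l: "l \<le> k + r" using gh by simp
    have "(-1 :: 'a) ^ ((if e then k + r - l else k + l) mod r) = (-1) ^ k * (-1) ^ l"
      using l assms by (auto simp: minus_one_power_iff par)
    then show "alternating_rep (g \<otimes>\<^bsub>dihedral r\<^esub> h) = (alternating_rep g * alternating_rep h :: 'a mat)"
      by (intro eq_matI) (auto simp: alternating_rep_def)
  qed (auto simp: alternating_rep_def split: prod.splits intro!: eq_matI)
  moreover have "W = {0\<^sub>v 1} \<or> W = carrier_vec 1"
    if W: "W \<subseteq> carrier_vec 1" "0\<^sub>v 1 \<in> W" "\<forall>c. \<forall>v\<in>W. c \<cdot>\<^sub>v v \<in> W" for W :: "'a vec set"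
  proof (cases "W = {0\<^sub>v 1}")
    case False
    then obtain w where w: "w \<in> W" "w \<noteq> 0\<^sub>v 1" using W(2) by blast
    have wV: "w \<in> carrier_vec 1" using w W(1) by blast
    have w0: "w $ 0 \<noteq> 0"
    proof
      assume "w $ 0 = 0"
      then have "w = 0\<^sub>v 1" using wV by (intro eq_vecI) auto
      then show False using w by simp
    qed
    have "v \<in> W" if v: "v \<in> carrier_vec 1" for v
    proof -
      have "v = (v $ 0 / w $ 0) \<cdot>\<^sub>v w" using v wV w0 by (intro eq_vecI) auto
      then show ?thesis using W(3) w(1) by metis
    qed
    then show ?thesis using W(1) by blast
  qed simp
  ultimately show ?thesis unfolding irreducible_rep_def by (intro conjI allI impI) (auto elim: conjE)
qed

lemma alternating_rep_exceptional:
  assumes "dihedral_irrep r 1 (alternating_rep :: _ \<Rightarrow> 'p::prime_card mod_ring mat)"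
  shows "dihedral_irrep.exceptional r 1 (alternating_rep :: _ \<Rightarrow> 'p mod_ring mat)"
proof -
  interpret dihedral_irrep r 1 "alternating_rep :: _ \<Rightarrow> 'p mod_ring mat" by fact
  have "(alternating_rep (Suc 0, e) :: 'p mod_ring mat) *\<^sub>v v = - v" if "v \<in> carrier_vec 1" for v e
    using that by (intro eq_vecI) (auto simp: alternating_rep_def scalar_prod_def)
  then show ?thesis
    using rot_int[of "Suc 0"] unfolding exceptional_def by auto
qed

text \<open>The two representations agree on the carrier of D but possibly not elsewhere as
  functions, so the identity matrix is the intertwiner.\<close>

lemma exceptional_equiv_alternating:
  fixes \<psi> :: "nat \<times> bool \<Rightarrow> 'p::prime_card mod_ring mat"
  assumes "dihedral_irrep r d \<psi>" "dihedral_irrep.exceptional r d \<psi>"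
  shows "((d, \<psi>), (1, alternating_rep)) \<in> rep_equiv r"
proof -
  interpret dihedral_irrep r d \<psi> by fact
  have d: "d = 1" by (rule exceptional_dim[OF assms(2)])
  have "\<psi> g = alternating_rep g" if g: "g \<in> carrier (dihedral r)" for g
  proof (rule mat_eq_if_mult_vec_eq[of _ d])
    obtain k e where ke: "g = (k, e)" "k < r" using g by (cases g) auto
    show "\<psi> g \<in> carrier_mat d d" using g by simp
    show "alternating_rep g \<in> carrier_mat d d" by (simp add: alternating_rep_def d split: prod.splits)
    fix v :: "'p mod_ring vec" assume v: "v \<in> carrier_vec d"
    have "alternating_rep g *\<^sub>v v = (-1) ^ k \<cdot>\<^sub>v v"
      using v d by (intro eq_vecI) (auto simp: alternating_rep_def ke scalar_prod_def)
    then show "\<psi> g *\<^sub>v v = alternating_rep g *\<^sub>v v" using exceptional_act[OF assms(2) v ke(2)] ke by simp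
  qed
  then show ?thesis using rep_equiv_refl[OF irr] d by (auto simp: rep_equiv_def)
qed

text \<open>Both rho and tau'' are the scalar -1, and scalars are unchanged by conjugation with an
  intertwiner; so the exceptional representations fill complete classes among the irreducible
  ones.\<close>

lemma exceptional_if_equiv:
  assumes "dihedral_irrep r d \<psi>" "dihedral_irrep r d' \<psi>'" "((d, \<psi>), (d', \<psi>')) \<in> rep_equiv r"
    and exc: "dihedral_irrep.exceptional r d' \<psi>'"
  shows "dihedral_irrep.exceptional r d \<psi>"
proof -
  have d: "d' = d" using assms(3) by (simp add: rep_equiv_def)
  interpret X: dihedral_irrep r d \<psi> by fact
  interpret Y: dihedral_irrep r d \<psi>' using assms(2) d by simp
  obtain P where P: "P \<in> carrier_mat d d" "invertible_mat P"
    and comm: "\<And>g. g \<in> carrier (dihedral r) \<Longrightarrow> P * \<psi> g = \<psi>' g * P"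
    using assms(3) by (auto simp: rep_equiv_def)
  obtain B where B: "B \<in> carrier_mat d d" "P * B = 1\<^sub>m d" "B * P = 1\<^sub>m d" by (rule invertible_matE[OF P])
  have "\<psi> (Suc 0, e) *\<^sub>v v = - v" if v: "v \<in> carrier_vec d" for v e
  proof -
    have g: "(Suc 0, e) \<in> carrier (dihedral r)" by simp
    have PV: "P *\<^sub>v v \<in> carrier_vec d" using P(1) v by auto
    have "\<psi> (Suc 0, e) *\<^sub>v v = (B * P) *\<^sub>v (\<psi> (Suc 0, e) *\<^sub>v v)" using B v by simp
    also have "\<dots> = B *\<^sub>v (P *\<^sub>v (\<psi> (Suc 0, e) *\<^sub>v v))" by (rule assoc_mult_mat_vec[OF B(1) P(1)]) (use v in auto)
    also have "P *\<^sub>v (\<psi> (Suc 0, e) *\<^sub>v v) = (\<psi>' (Suc 0, e) * P) *\<^sub>v v"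
      using assoc_mult_mat_vec[OF P(1) X.rep_carrier[OF g] v] comm[OF g] by simp
    also have "\<dots> = \<psi>' (Suc 0, e) *\<^sub>v (P *\<^sub>v v)" by (rule assoc_mult_mat_vec[OF Y.rep_carrier[OF g] P(1) v])
    also have "\<dots> = (-1) \<cdot>\<^sub>v (P *\<^sub>v v)" using Y.exceptional_act[OF _ PV, of "Suc 0" e] exc d by simp
    also have "B *\<^sub>v \<dots> = (-1) \<cdot>\<^sub>v (B *\<^sub>v (P *\<^sub>v v))" by (rule mult_mat_vec[OF B(1) PV])
    also have "B *\<^sub>v (P *\<^sub>v v) = v" using assoc_mult_mat_vec[OF B(1) P(1) v] B v by simp
    also have "(-1) \<cdot>\<^sub>v v = - v" by (intro eq_vecI) auto
    finally show ?thesis .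
  qed
  then show ?thesis using X.rot_int[of "Suc 0"] unfolding X.exceptional_def by auto
qed

theorem theorem5p7:
  fixes p r :: nat
  assumes "p = CARD('p::prime_card)"
    and "prime p" and "odd p"
    and "r \<ge> 3" and "\<not> p dvd r"
  shows "card (irr_rotary_aug_PX_map_classes TYPE('p) r) =
           (if odd r then card (Irr_D TYPE('p) r) else card (Irr_D TYPE('p) r) - 1)"
proof -
  have p: "odd CARD('p)" "\<not> CARD('p) dvd r" using assms by auto
  define irrep :: "(nat \<times> (nat \<times> bool \<Rightarrow> 'p mod_ring mat)) set" where "irrep = {(d, \<psi>). irreducible_rep r d \<psi>}"
  define exc :: "nat \<times> (nat \<times> bool \<Rightarrow> 'p mod_ring mat) \<Rightarrow> bool" where "exc = (\<lambda>(d, \<psi>). dihedral_irrep.exceptional r d \<psi>)"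
  define B where "B = {y \<in> irrep. \<not> exc y}"
  define A where "A = {(n::nat, R, L). irreducible_rotary_aug_PX_map TYPE('p) r {0..<n} R L}"
  define r1 where "r1 = {((n::nat, R, L), (n'::nat, R', L')). map_iso {0..<n} R L {0..<n'} R' L'}"
  define T where "T = (\<lambda>(n::nat, R, L) (d, \<psi> :: nat \<times> bool \<Rightarrow> 'p mod_ring mat). represents r d \<psi> {0..<n} R L)"
  have irrepI: "dihedral_irrep r d \<psi>" if "(d, \<psi>) \<in> irrep" for d and \<psi> :: "nat \<times> bool \<Rightarrow> 'p mod_ring mat"
    using that assms(4) p by unfold_locales (auto simp: irrep_def)
  have eq2: "rep_equiv r `` {y} = rep_equiv r `` {y'} \<longleftrightarrow> (y, y') \<in> rep_equiv r" if "y \<in> irrep" "y' \<in> irrep" for y y'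
    using that rep_equiv_class_eq_iff[of r "fst y" "snd y" "fst y'" "snd y'"]
    by (simp add: irrep_def split_beta)
  have "card (A // r1) = card (B // rep_equiv r)"
  proof (rule card_quotient_eq[where T=T])
    fix x x' assume x: "x \<in> A" "x' \<in> A"
    have sym: "(w', w) \<in> r1" if "w \<in> A" "(w, w') \<in> r1" for w w'
      using that map_iso_sym
      by (auto simp: A_def r1_def irreducible_rotary_aug_PX_map_def aug_PX_map_def)
    have trans: "(w, w'') \<in> r1" if "(w, w') \<in> r1" "(w', w'') \<in> r1" for w w' w''
      using that map_iso_trans by (auto simp: r1_def)
    have refl: "(w, w) \<in> r1" for w by (auto simp: r1_def map_iso_refl)
    show "r1 `` {x} = r1 `` {x'} \<longleftrightarrow> (x, x') \<in> r1"
    proof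
      assume "r1 `` {x} = r1 `` {x'}"
      moreover have "x' \<in> r1 `` {x'}" using refl by simp
      ultimately have "x' \<in> r1 `` {x}" by simp
      then show "(x, x') \<in> r1" by simp
    next
      assume xx: "(x, x') \<in> r1"
      show "r1 `` {x} = r1 `` {x'}"
      proof (rule Set.set_eqI)
        fix w
        show "w \<in> r1 `` {x} \<longleftrightarrow> w \<in> r1 `` {x'}"
          unfolding Image_singleton_iff using trans[OF xx] trans[OF sym[OF x(1) xx]] by (rule iffI[rotated])
      qed
    qed
  next
    fix y y' assume "y \<in> B" "y' \<in> B"
    then show "rep_equiv r `` {y} = rep_equiv r `` {y'} \<longleftrightarrow> (y, y') \<in> rep_equiv r"
      by (intro eq2) (auto simp: B_def)
  next
    fix x assume xA: "x \<in> A"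
    obtain n R L where x: "x = (n, R, L)" by (cases x)
    have m: "irreducible_rotary_aug_PX_map TYPE('p) r {0..<n} R L" using xA by (simp add: A_def x)
    obtain d and \<psi> :: "nat \<times> bool \<Rightarrow> 'p mod_ring mat" where rep: "represents r d \<psi> {0..<n} R L"
      by (rule exists_represents[OF assms(4) p m])
    interpret dihedral_irrep r d \<psi> using rep by (simp add: represents_def)
    obtain u where "admissible u" using rep unfolding represents_def by (elim conjE exE)
    then have "\<not> exceptional" by (rule admissible_not_exceptional)
    then have "(d, \<psi>) \<in> B" using irr by (simp add: B_def irrep_def exc_def)
    moreover have "T x (d, \<psi>)" using rep by (simp add: T_def x)
    ultimately show "\<exists>y\<in>B. T x y" by (rule bexI[rotated])
  next
    fix y assume yB: "y \<in> B"
    obtain d \<psi> where y: "y = (d, \<psi>)" by (cases y)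
    have yI: "(d, \<psi>) \<in> irrep" "\<not> dihedral_irrep.exceptional r d \<psi>" using yB by (auto simp: B_def y exc_def)
    interpret dihedral_irrep r d \<psi> by (rule irrepI[OF yI(1)])
    obtain n :: nat and R L \<beta> u where *: "admissible u" "labels G (u, (Suc 0, True)) (0\<^sub>v d, (0, True)) \<beta> {0..<n} R L"
      "irreducible_rotary_aug_PX_map TYPE('p) r {0..<n} R L"
      using exists_map[OF yI(2)] by (elim exE conjE)
    have "represents r d \<psi> {0..<n} R L"
      unfolding represents_def using dihedral_irrep_axioms *(1,2) by (intro conjI exI)
    then have "T (n, R, L) y" by (simp add: T_def y)
    moreover have "(n, R, L) \<in> A" using *(3) by (simp add: A_def)
    ultimately show "\<exists>x\<in>A. T x y" by (rule bexI)
  next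
    fix x x' y y' assume "T x y" "T x' y'"
    moreover obtain n R L n' R' L' where x: "x = (n, R, L)" "x' = (n', R', L')" by (cases x; cases x')
    moreover obtain d \<psi> d' \<psi>' where y: "y = (d, \<psi>)" "y' = (d', \<psi>')" by (cases y; cases y')
    ultimately have "represents r d \<psi> {0..<n} R L" "represents r d' \<psi>' {0..<n'} R' L'" by (simp_all add: T_def)
    then have "map_iso {0..<n} R L {0..<n'} R' L' \<longleftrightarrow> ((d, \<psi>), (d', \<psi>')) \<in> rep_equiv r"
      using rep_equiv_if_map_iso map_iso_if_rep_equiv by metis
    then show "(x, x') \<in> r1 \<longleftrightarrow> (y, y') \<in> rep_equiv r" by (simp add: r1_def x y)
  qed
  then have main: "card (irr_rotary_aug_PX_map_classes TYPE('p) r) = card (B // rep_equiv r)"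
    by (simp add: irr_rotary_aug_PX_map_classes_def A_def r1_def)
  have Irr: "Irr_D TYPE('p) r = irrep // rep_equiv r" by (simp add: Irr_D_def irrep_def)
  show ?thesis
  proof (cases "odd r")
    case True
    have "\<not> exc y" if yI: "y \<in> irrep" for y
    proof -
      obtain d \<psi> where y: "y = (d, \<psi>)" by (cases y)
      have "dihedral_irrep r d \<psi>" using irrepI yI y by simp
      then show ?thesis using dihedral_irrep.exceptional_even True by (auto simp: exc_def y)
    qed
    then have "B = irrep" by (auto simp: B_def)
    then show ?thesis using True main Irr by simp
  next
    case False
    define y0 where "y0 = (1 :: nat, alternating_rep :: _ \<Rightarrow> 'p mod_ring mat)"
    have y0: "y0 \<in> irrep" using alternating_rep_irreducible[of r] False assms(4) by (simp add: y0_def irrep_def)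
    have irr0: "dihedral_irrep r 1 (alternating_rep :: _ \<Rightarrow> 'p mod_ring mat)"
      using y0 unfolding y0_def by (rule irrepI)
    note exc0 = alternating_rep_exceptional[OF irr0]
    \<comment> \<open>For even r exactly one class is lost: every exceptional representation is
      equivalent to the alternating character, and nothing outside the exceptional ones is.\<close>
    have "B // rep_equiv r = irrep // rep_equiv r - {rep_equiv r `` {y0}}"
    proof
      show "B // rep_equiv r \<subseteq> irrep // rep_equiv r - {rep_equiv r `` {y0}}"
      proof
        fix c assume "c \<in> B // rep_equiv r"
        then obtain y where y: "y \<in> B" "c = rep_equiv r `` {y}" by (rule quotientE)
        have yI: "y \<in> irrep" "\<not> exc y" using y by (auto simp: B_def)
        have "c \<noteq> rep_equiv r `` {y0}"
        proof
          assume "c = rep_equiv r `` {y0}"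
          then have "(y, y0) \<in> rep_equiv r" using eq2[OF yI(1) y0] y by simp
          moreover obtain d \<psi> where dy: "y = (d, \<psi>)" by (cases y)
          ultimately have "((d, \<psi>), (1, alternating_rep)) \<in> rep_equiv r" by (simp only: y0_def)
          moreover have "dihedral_irrep r d \<psi>" using yI(1) unfolding dy by (rule irrepI)
          ultimately have "dihedral_irrep.exceptional r d \<psi>" using exceptional_if_equiv irr0 exc0 by blast
          then show False using yI(2) by (simp add: exc_def dy)
        qed
        then show "c \<in> irrep // rep_equiv r - {rep_equiv r `` {y0}}" using y yI by (auto intro: quotientI)
      qed
      show "irrep // rep_equiv r - {rep_equiv r `` {y0}} \<subseteq> B // rep_equiv r"
      proof
        fix c assume c: "c \<in> irrep // rep_equiv r - {rep_equiv r `` {y0}}"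
        then have "c \<in> irrep // rep_equiv r" by (rule DiffD1)
        then obtain y where y: "y \<in> irrep" "c = rep_equiv r `` {y}" by (rule quotientE)
        have "\<not> exc y"
        proof
          assume e: "exc y"
          obtain d \<psi> where dy: "y = (d, \<psi>)" by (cases y)
          have "dihedral_irrep r d \<psi>" using y(1) unfolding dy by (rule irrepI)
          moreover have "dihedral_irrep.exceptional r d \<psi>" using e by (simp add: exc_def dy)
          ultimately have "(y, y0) \<in> rep_equiv r"
            unfolding dy y0_def by (rule exceptional_equiv_alternating)
          then have "c = rep_equiv r `` {y0}" using eq2[OF y(1) y0] y by simp
          then show False using c by simp
        qed
        then show "c \<in> B // rep_equiv r" using y by (auto simp: B_def intro: quotientI)
      qed
    qed
    moreover have "rep_equiv r `` {y0} \<in> irrep // rep_equiv r" using y0 by (rule quotientI)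
    ultimately have "card (B // rep_equiv r) = card (irrep // rep_equiv r) - 1"
      by (simp add: card_Diff_singleton)
    then show ?thesis using False main Irr by simp
  qed
qed

end
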